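(* Let $L$ be a metric signature and let $M$ and $N$ be two $L$-structures. The following are equivalent: (i) $M\equiv_{\mathrm P}N$; (ii) $M^{\mathrm{Fin}^\ast}\equiv N^{\mathrm{Fin}^\ast}$; (iii) $M^F\simeq N^F$ for some filter $F$.
   Context: Continuous first-order logic. The domains of (metric) $L$-structures are nonempty complete bounded metric spaces; predicates are bounded uniformly continuous real-valued maps, with bounds and moduli of uniform continuity prescribed by the signature. Formulas are built from atomic formulas (predicates, including the metric $d$, applied to terms) using continuous connectives $\mathbb R^n\to\mathbb R$ and the quantifiers $\sup,\inf$; formulas are $\mathbb R$-valued. A unary connective is a continuous map $\mathbb R\to\mathbb R$. $\equiv$ is elementary equivalence (every continuous sentence has the same value) and $\simeq$ is isomorphism. All filters are proper filters on nonempty sets; $\mathrm{Fin}^\ast$ is the Fréchet filter on $\omega$ (cofinite subsets). For a bounded family of reals, $\limsup_{i\to F}u_i=\inf_{J\in F}\sup_{i\in J}u_i$. Reduced products: on $\prod_i M_i$ let $d_F(a,b)=\limsup_{i\to F}d^{M_i}(a_i,b_i)$. The reduced product $M_F=\prod_i M_i/F$ has as domain the quotient of $\prod_iM_i$ by $d_F(a,b)=0$ (a complete bounded metric space); $a_F$ denotes the image of $a$; constants and functions are interpreted coordinatewise, and $p^{M_F}(a_F)=\limsup_{i\to F}p^{M_i}(a_i)$ for predicate symbols $p$. If all $M_i$ equal $N$, this is the reduced power $N^F$. Palyutin formulas: the smallest set of formulas such that (1) every atomic formula is Palyutin; (2) if $\varphi$ is Palyutin and $C$ is a nondecreasing unary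 connective, then $C\varphi$ is Palyutin; (3) if $\varphi,\psi$ are Palyutin, so is $\max(\varphi,\psi)$; (4) if $\varphi$ is Palyutin and $x$ is a variable, $\inf_x\varphi$ and $\sup_x\varphi$ are Palyutin; (5) if $\varphi,\psi$ are Palyutin, $D$ is a nonincreasing unary connective with (necessarily unique) fixed point $\Delta$, and $x$ is a variable, then $\max(\inf_x\varphi,\ \sup_x\min(D\varphi,\Delta,\psi))$ is Palyutin. A Palyutin sentence is a Palyutin formula with no free variables. $M\equiv_{\mathrm P}N$ means that $\varphi^M=\varphi^N$ for every Palyutin sentence $\varphi$. *)

theory Defs
  imports "HOL-Analysis.Analysis"
begin

section \<open>Metric signatures and structures\<close>

text \<open>
  The symbols of a signature form subsets of the symbol types, so that either kind of symbol
  may be absent. Constants are the function symbols of arity 0.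
\<close>

record ('f, 'p) metric_sig =
  FunSyms :: "'f set"
  FunArity :: "'f \<Rightarrow> nat"
  FunModulus :: "'f \<Rightarrow> real \<Rightarrow> real"
  PredSyms :: "'p set"
  PredArity :: "'p \<Rightarrow> nat"
  PredModulus :: "'p \<Rightarrow> real \<Rightarrow> real"
  PredBound :: "'p \<Rightarrow> real"
  DistBound :: real

definition metric_signature :: "('f, 'p) metric_sig \<Rightarrow> bool" where
  "metric_signature L \<longleftrightarrow>
     (\<forall>f\<in>FunSyms L. \<forall>\<epsilon>>0. FunModulus L f \<epsilon> > 0) \<and>
     (\<forall>p\<in>PredSyms L. \<forall>\<epsilon>>0. PredModulus L p \<epsilon> > 0)"

record ('f, 'p, 'a) metric_struct =
  Dom :: "'a set"
  Met :: "'a \<Rightarrow> 'a \<Rightarrow> real"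
  FunI :: "'f \<Rightarrow> 'a list \<Rightarrow> 'a"
  PredI :: "'p \<Rightarrow> 'a list \<Rightarrow> real"

definition tuples :: "'a set \<Rightarrow> nat \<Rightarrow> 'a list set" where
  "tuples A n = {as. set as \<subseteq> A \<and> length as = n}"

definition L_structure :: "('f, 'p) metric_sig \<Rightarrow> ('f, 'p, 'a) metric_struct \<Rightarrow> bool" where
  "L_structure L M \<longleftrightarrow>
     Dom M \<noteq> {} \<and>
     Metric_space (Dom M) (Met M) \<and>
     Metric_space.mcomplete (Dom M) (Met M) \<and>
     (\<forall>a\<in>Dom M. \<forall>b\<in>Dom M. Met M a b \<le> DistBound L) \<and>
     (\<forall>f\<in>FunSyms L. \<forall>as\<in>tuples (Dom M) (FunArity L f). FunI M f as \<in> Dom M) \<and>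
     (\<forall>f\<in>FunSyms L. \<forall>as\<in>tuples (Dom M) (FunArity L f). \<forall>bs\<in>tuples (Dom M) (FunArity L f).
        \<forall>\<epsilon>>0. (\<forall>k<FunArity L f. Met M (as ! k) (bs ! k) < FunModulus L f \<epsilon>) \<longrightarrow>
          Met M (FunI M f as) (FunI M f bs) \<le> \<epsilon>) \<and>
     (\<forall>p\<in>PredSyms L. \<forall>as\<in>tuples (Dom M) (PredArity L p). \<bar>PredI M p as\<bar> \<le> PredBound L p) \<and>
     (\<forall>p\<in>PredSyms L. \<forall>as\<in>tuples (Dom M) (PredArity L p). \<forall>bs\<in>tuples (Dom M) (PredArity L p).
        \<forall>\<epsilon>>0. (\<forall>k<PredArity L p. Met M (as ! k) (bs ! k) < PredModulus L p \<epsilon>) \<longrightarrow>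
          \<bar>PredI M p as - PredI M p bs\<bar> \<le> \<epsilon>)"

definition isomorphic ::
  "('f, 'p) metric_sig \<Rightarrow> ('f, 'p, 'a) metric_struct \<Rightarrow> ('f, 'p, 'b) metric_struct \<Rightarrow> bool" where
  "isomorphic L M N \<longleftrightarrow>
     (\<exists>h. bij_betw h (Dom M) (Dom N) \<and>
        (\<forall>a\<in>Dom M. \<forall>b\<in>Dom M. Met N (h a) (h b) = Met M a b) \<and>
        (\<forall>f\<in>FunSyms L. \<forall>as\<in>tuples (Dom M) (FunArity L f).
           FunI N f (map h as) = h (FunI M f as)) \<and>
        (\<forall>p\<in>PredSyms L. \<forall>as\<in>tuples (Dom M) (PredArity L p).
           PredI N p (map h as) = PredI M p as))"

section \<open>Continuous formulas\<close>

datatype 'f trm = Var nat | App 'f "'f trm list"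

text \<open>
  \<open>Conn C \<phi>s\<close> applies a connective of arity \<open>n = length \<phi>s\<close>. The space $\mathbb{R}^n$ is the
  product space \<open>powertop_real {..<n}\<close>, whose points are the extensional functions on \<open>{..<n}\<close>.
\<close>

datatype ('f, 'p) fm =
    DistF "'f trm" "'f trm"
  | PredF 'p "'f trm list"
  | Conn "(nat \<Rightarrow> real) \<Rightarrow> real" "('f, 'p) fm list"
  | SupF nat "('f, 'p) fm"
  | InfF nat "('f, 'p) fm"

fun wf_trm :: "('f, 'p) metric_sig \<Rightarrow> 'f trm \<Rightarrow> bool" where
  "wf_trm L (Var x) = True"
| "wf_trm L (App f ts) = (f \<in> FunSyms L \<and> length ts = FunArity L f \<and> (\<forall>t\<in>set ts. wf_trm L t))"

fun wf_fm :: "('f, 'p) metric_sig \<Rightarrow> ('f, 'p) fm \<Rightarrow> bool" where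
  "wf_fm L (DistF s t) = (wf_trm L s \<and> wf_trm L t)"
| "wf_fm L (PredF p ts) = (p \<in> PredSyms L \<and> length ts = PredArity L p \<and> (\<forall>t\<in>set ts. wf_trm L t))"
| "wf_fm L (Conn C \<phi>s) =
     (continuous_map (powertop_real {..<length \<phi>s}) euclideanreal C \<and> (\<forall>\<phi>\<in>set \<phi>s. wf_fm L \<phi>))"
| "wf_fm L (SupF x \<phi>) = wf_fm L \<phi>"
| "wf_fm L (InfF x \<phi>) = wf_fm L \<phi>"

fun fv_trm :: "'f trm \<Rightarrow> nat set" where
  "fv_trm (Var x) = {x}"
| "fv_trm (App f ts) = (\<Union>t\<in>set ts. fv_trm t)"

fun fv_fm :: "('f, 'p) fm \<Rightarrow> nat set" where
  "fv_fm (DistF s t) = fv_trm s \<union> fv_trm t"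
| "fv_fm (PredF p ts) = (\<Union>t\<in>set ts. fv_trm t)"
| "fv_fm (Conn C \<phi>s) = (\<Union>\<phi>\<in>set \<phi>s. fv_fm \<phi>)"
| "fv_fm (SupF x \<phi>) = fv_fm \<phi> - {x}"
| "fv_fm (InfF x \<phi>) = fv_fm \<phi> - {x}"

fun trm_val :: "('f, 'p, 'a) metric_struct \<Rightarrow> (nat \<Rightarrow> 'a) \<Rightarrow> 'f trm \<Rightarrow> 'a" where
  "trm_val M e (Var x) = e x"
| "trm_val M e (App f ts) = FunI M f (map (trm_val M e) ts)"

fun fm_val :: "('f, 'p, 'a) metric_struct \<Rightarrow> (nat \<Rightarrow> 'a) \<Rightarrow> ('f, 'p) fm \<Rightarrow> real" where
  "fm_val M e (DistF s t) = Met M (trm_val M e s) (trm_val M e t)"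
| "fm_val M e (PredF p ts) = PredI M p (map (trm_val M e) ts)"
| "fm_val M e (Conn C \<phi>s) = C (\<lambda>k\<in>{..<length \<phi>s}. map (fm_val M e) \<phi>s ! k)"
| "fm_val M e (SupF x \<phi>) = (SUP a\<in>Dom M. fm_val M (e(x := a)) \<phi>)"
| "fm_val M e (InfF x \<phi>) = (INF a\<in>Dom M. fm_val M (e(x := a)) \<phi>)"

text \<open>The value of a sentence does not depend on the assignment; any one into the domain will do.\<close>

definition sentence_val :: "('f, 'p, 'a) metric_struct \<Rightarrow> ('f, 'p) fm \<Rightarrow> real" where
  "sentence_val M \<phi> = fm_val M (\<lambda>_. SOME a. a \<in> Dom M) \<phi>"

definition elem_equiv ::
  "('f, 'p) metric_sig \<Rightarrow> ('f, 'p, 'a) metric_struct \<Rightarrow> ('f, 'p, 'b) metric_struct \<Rightarrow> bool" where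
  "elem_equiv L M N \<longleftrightarrow>
     (\<forall>\<phi>. wf_fm L \<phi> \<and> fv_fm \<phi> = {} \<longrightarrow> sentence_val M \<phi> = sentence_val N \<phi>)"

section \<open>Palyutin formulas\<close>

definition Conn1 :: "(real \<Rightarrow> real) \<Rightarrow> ('f, 'p) fm \<Rightarrow> ('f, 'p) fm" where
  "Conn1 C \<phi> = Conn (\<lambda>v. C (v 0)) [\<phi>]"

definition ConstF :: "real \<Rightarrow> ('f, 'p) fm" where
  "ConstF c = Conn (\<lambda>v. c) []"

definition MaxF :: "('f, 'p) fm \<Rightarrow> ('f, 'p) fm \<Rightarrow> ('f, 'p) fm" where
  "MaxF \<phi> \<psi> = Conn (\<lambda>v. max (v 0) (v 1)) [\<phi>, \<psi>]"

definition MinF :: "('f, 'p) fm \<Rightarrow> ('f, 'p) fm \<Rightarrow> ('f, 'p) fm" where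
  "MinF \<phi> \<psi> = Conn (\<lambda>v. min (v 0) (v 1)) [\<phi>, \<psi>]"

inductive palyutin :: "('f, 'p) metric_sig \<Rightarrow> ('f, 'p) fm \<Rightarrow> bool" for L where
  dist: "wf_fm L (DistF s t) \<Longrightarrow> palyutin L (DistF s t)"
| pred: "wf_fm L (PredF p ts) \<Longrightarrow> palyutin L (PredF p ts)"
| conn: "palyutin L \<phi> \<Longrightarrow> continuous_on UNIV C \<Longrightarrow> mono C \<Longrightarrow> palyutin L (Conn1 C \<phi>)"
| max: "palyutin L \<phi> \<Longrightarrow> palyutin L \<psi> \<Longrightarrow> palyutin L (MaxF \<phi> \<psi>)"
| inf: "palyutin L \<phi> \<Longrightarrow> palyutin L (InfF x \<phi>)"
| sup: "palyutin L \<phi> \<Longrightarrow> palyutin L (SupF x \<phi>)"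
| pal: "palyutin L \<phi> \<Longrightarrow> palyutin L \<psi> \<Longrightarrow> continuous_on UNIV D \<Longrightarrow> antimono D \<Longrightarrow> D \<Delta> = \<Delta> \<Longrightarrow>
    palyutin L (MaxF (InfF x \<phi>) (SupF x (MinF (Conn1 D \<phi>) (MinF (ConstF \<Delta>) \<psi>))))"

definition palyutin_equiv ::
  "('f, 'p) metric_sig \<Rightarrow> ('f, 'p, 'a) metric_struct \<Rightarrow> ('f, 'p, 'b) metric_struct \<Rightarrow> bool" where
  "palyutin_equiv L M N \<longleftrightarrow>
     (\<forall>\<phi>. palyutin L \<phi> \<and> fv_fm \<phi> = {} \<longrightarrow> sentence_val M \<phi> = sentence_val N \<phi>)"

section \<open>Reduced products\<close>

text \<open>
  The proper filters on the index set \<open>UNIV :: 'i set\<close> are the \<open>F :: 'i filter\<close> with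
  \<open>F \<noteq> bot\<close>, and \<open>J \<in> F\<close> reads \<open>eventually (\<lambda>i. i \<in> J) F\<close>. A filter on a subset of \<open>'i\<close> is
  represented by the filter it generates on \<open>'i\<close>, with isomorphic reduced products.
\<close>

definition real_limsup :: "'i filter \<Rightarrow> ('i \<Rightarrow> real) \<Rightarrow> real" where
  "real_limsup F u = (INF J\<in>{J. eventually (\<lambda>i. i \<in> J) F}. SUP i\<in>J. u i)"

definition prod_dist ::
  "('i \<Rightarrow> ('f, 'p, 'a) metric_struct) \<Rightarrow> 'i filter \<Rightarrow> ('i \<Rightarrow> 'a) \<Rightarrow> ('i \<Rightarrow> 'a) \<Rightarrow> real" where
  "prod_dist Ms F a b = real_limsup F (\<lambda>i. Met (Ms i) (a i) (b i))"

definition prod_rel ::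
  "('i \<Rightarrow> ('f, 'p, 'a) metric_struct) \<Rightarrow> 'i filter \<Rightarrow> (('i \<Rightarrow> 'a) \<times> ('i \<Rightarrow> 'a)) set" where
  "prod_rel Ms F =
     {(a, b). a \<in> (\<Pi> i\<in>UNIV. Dom (Ms i)) \<and> b \<in> (\<Pi> i\<in>UNIV. Dom (Ms i)) \<and> prod_dist Ms F a b = 0}"

definition rep :: "('i \<Rightarrow> 'a) set \<Rightarrow> 'i \<Rightarrow> 'a" where
  "rep A = (SOME a. a \<in> A)"

text \<open>
  The interpretations are computed on chosen representatives of the classes; by uniform
  continuity (with moduli not depending on the index) they do not depend on the choice.
  The metric gets the value 0 outside the domain because the locale \<open>Metric_space\<close> demands
  symmetry and nonnegativity everywhere.
\<close>

definition reduced_product ::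
  "('i \<Rightarrow> ('f, 'p, 'a) metric_struct) \<Rightarrow> 'i filter \<Rightarrow> ('f, 'p, ('i \<Rightarrow> 'a) set) metric_struct" where
  "reduced_product Ms F =
     \<lparr>Dom = (\<Pi> i\<in>UNIV. Dom (Ms i)) // prod_rel Ms F,
      Met = (\<lambda>A B. if A \<in> (\<Pi> i\<in>UNIV. Dom (Ms i)) // prod_rel Ms F \<and>
                       B \<in> (\<Pi> i\<in>UNIV. Dom (Ms i)) // prod_rel Ms F
                    then prod_dist Ms F (rep A) (rep B) else 0),
      FunI = (\<lambda>f As. prod_rel Ms F `` {\<lambda>i. FunI (Ms i) f (map (\<lambda>A. rep A i) As)}),
      PredI = (\<lambda>p As. real_limsup F (\<lambda>i. PredI (Ms i) p (map (\<lambda>A. rep A i) As)))\<rparr>"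

definition reduced_power ::
  "('f, 'p, 'a) metric_struct \<Rightarrow> 'i filter \<Rightarrow> ('f, 'p, ('i \<Rightarrow> 'a) set) metric_struct" where
  "reduced_power N F = reduced_product (\<lambda>_. N) F"

text \<open>
  HOL cannot quantify existentially over the type of index sets. This type bounds the index sets
  on which a filter has to be sought. It has cardinality $2^{2^\kappa}$, where $\kappa$ is the sum
  of $\aleph_0$ and the cardinalities of the types of the symbols and of the elements of the two
  structures; reduced powers of these over countable index sets have at most $2^\kappa$ elements,
  so Shelah's isomorphism theorem provides ultrafilters on this type for them.
\<close>

type_synonym ('f, 'p, 'a, 'b) index = "('f + 'p + 'a + 'b + nat) set set"

end

theory Submission
  imports Defs
begin

text \<open>
  The value of a Palyutin formula in a reduced product is the limit superior of its values in the
  factors. In a power modulo the Frechet filter Palyutin formulas moreover control all formulas: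
  given finitely many Palyutin formulas with targets \<open>r\<close>, the mixed clause (5) expresses that some
  \<open>x\<close> satisfies all upper bounds and attains a given target, and since an infinite set of natural
  numbers splits into infinite pieces, points attaining the individual targets can be merged into
  one. This yields a back-and-forth system between the Frechet powers of \<open>M\<close> and \<open>N\<close>.

  For the isomorphism, families of sequences in \<open>M\<close> and in \<open>N\<close> indexed by a large set \<open>I\<close> are
  matched along a well-order of all of them, as in Shelah's isomorphism theorem: a large
  independent family of functions on \<open>I\<close> supplies a generic partner in each step, at the cost of
  few members of the family. As the back-and-forth is run separately at each index, no formula
  has to be decided, and the filter generated by the events where finitely many conditions
  are met need not be an ultrafilter. The final filter is its product with the Frechet filter.
\<close>

section \<open>Limits superior along a filter\<close>

text \<open>The obstacle is an asymmetry of limits superior: an upper bound holds eventually, a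
  lower bound only frequently, and two frequent events may never occur together. Clause (5) is
  compatible with it because a single frequent condition is combined with eventual ones; at the
  other indices \<open>D \<Delta> = \<Delta>\<close> supplies the lower bound that is still
  required. The same asymmetry is why partners are sequences: no single element of \<open>N\<close>
  need attain several targets, but different indices of one sequence can serve different targets. So
  every index of the large set carries a pair of sequences, and the Frechet filter has to come back
  as the inner factor of the final filter. The sizes are forced by counting. If \<open>'t\<close>
  has room for all pairs of sequences and \<open>'t set\<close> is the type of indices, then the
  families to be matched can be named by \<open>'t set set\<close>, which also numbers the
  independent functions, and every proper initial segment of the well-order spends fewer. Matched
  families need to agree only up to each \<open>eps > 0\<close> eventually.\<close>

lemma real_limsup_le_iff:
  assumes "F \<noteq> bot" and "bounded (range u)"
  shows "real_limsup F u \<le> r \<longleftrightarrow> (\<forall>s>r. eventually (\<lambda>i. u i < s) F)"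
proof -
  obtain B where B: "\<And>i. \<bar>u i\<bar> \<le> B"
    using assms(2) by (auto simp: bounded_iff)
  have bdd: "bdd_above (u ` J)" for J
    using B by (intro bdd_aboveI2[where M=B]) (auto simp: abs_le_iff)
  have ne: "J \<noteq> {}" if "eventually (\<lambda>i. i \<in> J) F" for J
    using that assms(1) by auto
  have low: "bdd_below ((\<lambda>J. SUP i\<in>J. u i) ` {J. eventually (\<lambda>i. i \<in> J) F})"
  proof (intro bdd_belowI2[where m="-B"])
    fix J assume "J \<in> {J. eventually (\<lambda>i. i \<in> J) F}"
    then obtain j where "j \<in> J" using ne by auto
    have "- B \<le> u j" using B[of j] by auto
    also have "\<dots> \<le> (SUP i\<in>J. u i)" using \<open>j \<in> J\<close> bdd by (rule cSUP_upper)
    finally show "- B \<le> (SUP i\<in>J. u i)" .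
  qed
  have full: "{J. eventually (\<lambda>i. i \<in> J) F} \<noteq> {}"
    by (auto intro!: exI[of _ UNIV])
  show ?thesis
  proof (intro iffI allI impI)
    fix s assume "real_limsup F u \<le> r" and "r < s"
    then have "(INF J\<in>{J. eventually (\<lambda>i. i \<in> J) F}. SUP i\<in>J. u i) < s"
      by (simp add: real_limsup_def)
    then obtain J where J: "eventually (\<lambda>i. i \<in> J) F" "(SUP i\<in>J. u i) < s"
      using cINF_less_iff[OF full low] by auto
    have "u i < s" if "i \<in> J" for i
      using cSUP_upper[OF that bdd[of J]] J(2) by simp
    with J(1) show "eventually (\<lambda>i. u i < s) F" by (auto elim: eventually_mono)
  next
    assume ev: "\<forall>s>r. eventually (\<lambda>i. u i < s) F"
    show "real_limsup F u \<le> r"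
    proof (rule dense_ge)
      fix s assume "r < s"
      then have J: "eventually (\<lambda>i. i \<in> {i. u i < s}) F" using ev by simp
      then have "real_limsup F u \<le> (SUP i\<in>{i. u i < s}. u i)"
        unfolding real_limsup_def by (intro cINF_lower[OF low]) simp
      also have "\<dots> \<le> s" using ne[OF J] by (intro cSUP_least) auto
      finally show "real_limsup F u \<le> s" .
    qed
  qed
qed

lemma real_limsup_eqI:
  assumes "\<And>r. real_limsup F u \<le> r \<longleftrightarrow> l \<le> r"
  shows "real_limsup F u = l"
  using assms by (meson order_antisym order_refl)

lemma real_limsup_less_eventually:
  assumes "F \<noteq> bot" and "bounded (range u)" and "real_limsup F u < s"
  shows "eventually (\<lambda>i. u i < s) F"
  using assms real_limsup_le_iff[OF assms(1,2)] by blast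

lemma real_limsup_leI:
  assumes "F \<noteq> bot" and "bounded (range u)" and "eventually (\<lambda>i. u i \<le> r) F"
  shows "real_limsup F u \<le> r"
proof -
  have "eventually (\<lambda>i. u i < s) F" if "r < s" for s
    using assms(3) by eventually_elim (use that in simp)
  then show ?thesis using real_limsup_le_iff[OF assms(1,2)] by blast
qed

lemma real_limsup_greater_frequently:
  assumes "F \<noteq> bot" and "bounded (range u)" and "s < real_limsup F u"
  shows "frequently (\<lambda>i. s < u i) F"
  using assms real_limsup_leI[OF assms(1,2)] unfolding frequently_def
  by (metis (mono_tags, lifting) eventually_mono not_less)

lemma real_limsup_geI:
  assumes "F \<noteq> bot" and "bounded (range u)" and "frequently (\<lambda>i. r \<le> u i) F"
  shows "r \<le> real_limsup F u"
proof (rule ccontr)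
  assume "\<not> ?thesis"
  then have "eventually (\<lambda>i. \<not> r \<le> u i) F"
    using real_limsup_less_eventually[OF assms(1,2), of r] by (simp add: not_le)
  with assms(3) show False by (simp add: frequently_def)
qed

lemma real_limsup_const: "F \<noteq> bot \<Longrightarrow> real_limsup F (\<lambda>i. c) = c"
  by (intro antisym real_limsup_leI real_limsup_geI) (auto simp: eventually_frequently)

lemma real_limsup_le_add:
  assumes "F \<noteq> bot" and "bounded (range u)" and "bounded (range v)"
    and "eventually (\<lambda>i. u i \<le> v i + eps) F"
  shows "real_limsup F u \<le> real_limsup F v + eps"
proof (subst real_limsup_le_iff[OF assms(1,2)], intro allI impI)
  fix s assume "real_limsup F v + eps < s"
  then have "eventually (\<lambda>i. v i < s - eps) F"
    by (intro real_limsup_less_eventually[OF assms(1,3)]) simp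
  with assms(4) show "eventually (\<lambda>i. u i < s) F" by eventually_elim simp
qed

lemma real_limsup_mono:
  assumes "F \<noteq> bot" and "bounded (range u)" and "bounded (range v)"
    and "eventually (\<lambda>i. u i \<le> v i) F"
  shows "real_limsup F u \<le> real_limsup F v"
  using real_limsup_le_add[OF assms(1-3), of 0] assms(4) by simp

text \<open>Each tolerance may use its own member of the filter. Both the independence of
  representatives and the equality of values behind the final isomorphism rest on this.\<close>

lemma real_limsup_close:
  assumes "F \<noteq> bot" and "bounded (range u)" and "bounded (range v)"
    and "\<And>eps. eps > 0 \<Longrightarrow> eventually (\<lambda>i. \<bar>u i - v i\<bar> \<le> eps) F"
  shows "real_limsup F u = real_limsup F v"
proof (rule antisym; rule field_le_epsilon)
  fix eps :: real assume "eps > 0"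
  note ev = assms(4)[OF this]
  show "real_limsup F u \<le> real_limsup F v + eps"
    by (rule real_limsup_le_add[OF assms(1-3)], use ev in eventually_elim) simp
  show "real_limsup F v \<le> real_limsup F u + eps"
    by (rule real_limsup_le_add[OF assms(1,3,2)], use ev in eventually_elim) simp
qed

lemma bounded_range_iff_abs: "bounded (range u) \<longleftrightarrow> (\<exists>B. \<forall>i. \<bar>u i :: real\<bar> \<le> B)"
  by (auto simp: bounded_iff)

lemma real_limsup_abs_le:
  assumes "F \<noteq> bot" and "\<And>i. \<bar>u i\<bar> \<le> B"
  shows "\<bar>real_limsup F u\<bar> \<le> B"
proof -
  have b: "bounded (range u)" using assms(2) unfolding bounded_range_iff_abs by blast
  have "u i \<le> B" "- B \<le> u i" for i using assms(2)[of i] by (simp_all add: abs_le_iff minus_le_iff)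
  then have "real_limsup F u \<le> B" "- B \<le> real_limsup F u"
    by (intro real_limsup_leI real_limsup_geI assms(1) b eventually_frequently always_eventually allI; simp)+
  then show ?thesis by simp
qed

lemma real_limsup_max:
  assumes "F \<noteq> bot" and u: "bounded (range u)" and v: "bounded (range v)"
  shows "real_limsup F (\<lambda>i. max (u i) (v i)) = max (real_limsup F u) (real_limsup F v)"
proof (rule real_limsup_eqI)
  obtain B B' where "\<And>i. \<bar>u i\<bar> \<le> B" "\<And>i. \<bar>v i\<bar> \<le> B'"
    using u v unfolding bounded_range_iff_abs by auto
  then have "\<bar>max (u i) (v i)\<bar> \<le> max B B'" for i
    by (smt (verit) max_def)
  then have m: "bounded (range (\<lambda>i. max (u i) (v i)))"
    unfolding bounded_range_iff_abs by blast
  show "real_limsup F (\<lambda>i. max (u i) (v i)) \<le> r \<longleftrightarrow> max (real_limsup F u) (real_limsup F v) \<le> r"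
    for r
    by (auto simp: real_limsup_le_iff[OF assms(1)] u v m eventually_conj_iff)
qed

lemma bounded_range_continuous:
  assumes "bounded (range u)" and "continuous_on UNIV (C :: real \<Rightarrow> real)"
  shows "bounded (range (\<lambda>i. C (u i)))"
proof -
  obtain B where "\<And>i. \<bar>u i\<bar> \<le> B" using assms(1) bounded_range_iff_abs by blast
  then have "range (\<lambda>i. C (u i)) \<subseteq> C ` {- B..B}"
    by (auto intro!: imageI simp: abs_le_iff minus_le_iff)
  moreover have "compact (C ` {- B..B})"
    using assms(2) by (intro compact_continuous_image) (auto intro: continuous_on_subset)
  ultimately show ?thesis using bounded_subset compact_imp_bounded by blast
qed

lemma continuous_upper_bound:
  fixes C :: "real \<Rightarrow> real"
  assumes "continuous_on UNIV C" and "C l < s"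
  shows "\<exists>eps>0. \<forall>t. \<bar>t - l\<bar> \<le> eps \<longrightarrow> C t < s"
proof -
  have "open (C -` {..<s})" using assms(1) by (intro open_vimage) auto
  moreover have "l \<in> C -` {..<s}" using assms(2) by simp
  ultimately obtain eps where "eps > 0" "cball l eps \<subseteq> C -` {..<s}"
    using open_contains_cball by blast
  then show ?thesis by (force simp: dist_real_def abs_minus_commute)
qed

text \<open>Monotonicity lets \<open>C\<close> carry both kinds of bound on \<open>u\<close>: below
  \<open>?l + eps\<close> eventually and above \<open>?l - eps\<close> frequently. Continuity then
  removes \<open>eps\<close>.\<close>

lemma real_limsup_mono_continuous:
  assumes F: "F \<noteq> bot" and u: "bounded (range u)"
    and C: "continuous_on UNIV C" and "mono (C :: real \<Rightarrow> real)"
  shows "real_limsup F (\<lambda>i. C (u i)) = C (real_limsup F u)"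
proof (rule antisym)
  let ?l = "real_limsup F u"
  note Cu = bounded_range_continuous[OF u C]
  show "real_limsup F (\<lambda>i. C (u i)) \<le> C ?l"
  proof (subst real_limsup_le_iff[OF F Cu], intro allI impI)
    fix s assume "C ?l < s"
    with C obtain eps where "eps > 0" and eps: "\<And>t. \<bar>t - ?l\<bar> \<le> eps \<Longrightarrow> C t < s"
      using continuous_upper_bound by blast
    have "eventually (\<lambda>i. u i < ?l + eps) F"
      using \<open>eps > 0\<close> by (intro real_limsup_less_eventually[OF F u]) simp
    then show "eventually (\<lambda>i. C (u i) < s) F"
    proof eventually_elim
      case (elim i)
      then have "C (u i) \<le> C (?l + eps)" using assms(4) by (simp add: monoD)
      also have "\<dots> < s" using eps[of "?l + eps"] \<open>eps > 0\<close> by simp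
      finally show ?case .
    qed
  qed
  show "C ?l \<le> real_limsup F (\<lambda>i. C (u i))"
  proof (rule dense_le)
    fix s assume "s < C ?l"
    moreover have "continuous_on UNIV (\<lambda>t. - C t)" using C by (rule continuous_on_minus)
    ultimately obtain eps where "eps > 0" and eps: "\<And>t. \<bar>t - ?l\<bar> \<le> eps \<Longrightarrow> - C t < - s"
      using continuous_upper_bound[of "\<lambda>t. - C t" ?l "- s"] by auto
    have "frequently (\<lambda>i. ?l - eps < u i) F"
      using \<open>eps > 0\<close> by (intro real_limsup_greater_frequently[OF F u]) simp
    then have "frequently (\<lambda>i. s \<le> C (u i)) F"
    proof (rule frequently_elim1)
      fix i assume "?l - eps < u i"
      then have "C (?l - eps) \<le> C (u i)" using assms(4) by (simp add: monoD)
      with eps[of "?l - eps"] \<open>eps > 0\<close> show "s \<le> C (u i)" by simp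
    qed
    then show "s \<le> real_limsup F (\<lambda>i. C (u i))" by (rule real_limsup_geI[OF F Cu])
  qed
qed

text \<open>
  Quantifiers over the reduced power range over choice functions \<open>c\<close>, and \<open>w i a\<close> stands for the value
  of a formula at index \<open>i\<close>.
\<close>

locale bounded_family =
  fixes F :: "'i filter" and X :: "'a set" and w :: "'i \<Rightarrow> 'a \<Rightarrow> real" and B :: real
  assumes F: "F \<noteq> bot" and X: "X \<noteq> {}" and bound: "\<And>i a. a \<in> X \<Longrightarrow> \<bar>w i a\<bar> \<le> B"
begin

lemma bdd_above_family: "bdd_above (w i ` X)"
  using bound by (intro bdd_aboveI2[where M=B]) (auto simp: abs_le_iff)

lemma bdd_below_family: "bdd_below (w i ` X)"
  using bound by (intro bdd_belowI2[where m="-B"]) (simp add: abs_le_iff minus_le_iff)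

lemma bounded_choice: "c \<in> (\<Pi> i\<in>UNIV. X) \<Longrightarrow> bounded (range (\<lambda>i. w i (c i)))"
  using bound unfolding bounded_range_iff_abs by (intro exI[of _ B]) auto

lemma INF_in: "(INF a\<in>X. w i a) \<in> {-B..B}"
proof -
  obtain a where a: "a \<in> X" using X by auto
  have "(INF a\<in>X. w i a) \<le> B"
    using cINF_lower[OF bdd_below_family a, of i] bound[OF a, of i] by linarith
  moreover have "- B \<le> (INF a\<in>X. w i a)"
    using X bound by (intro cINF_greatest) (auto simp: abs_le_iff minus_le_iff)
  ultimately show ?thesis by simp
qed

lemma SUP_in: "(SUP a\<in>X. w i a) \<in> {-B..B}"
proof -
  obtain a where a: "a \<in> X" using X by auto
  have "- B \<le> (SUP a\<in>X. w i a)"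
    using cSUP_upper[OF a bdd_above_family, of i] bound[OF a, of i] by linarith
  moreover have "(SUP a\<in>X. w i a) \<le> B"
    using X bound by (intro cSUP_least) (auto simp: abs_le_iff)
  ultimately show ?thesis by simp
qed

lemma bounded_INF: "bounded (range (\<lambda>i. INF a\<in>X. w i a))"
  unfolding bounded_range_iff_abs using INF_in by (intro exI[of _ B]) (auto simp: abs_le_iff minus_le_iff)

lemma bounded_SUP: "bounded (range (\<lambda>i. SUP a\<in>X. w i a))"
  unfolding bounded_range_iff_abs using SUP_in by (intro exI[of _ B]) (auto simp: abs_le_iff minus_le_iff)

lemma limsup_choice_in:
  assumes "c \<in> (\<Pi> i\<in>UNIV. X)"
  shows "real_limsup F (\<lambda>i. w i (c i)) \<in> {-B..B}"
proof -
  have "\<bar>real_limsup F (\<lambda>i. w i (c i))\<bar> \<le> B"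
    using assms bound by (intro real_limsup_abs_le F) auto
  then show ?thesis by (auto simp: abs_le_iff minus_le_iff)
qed

lemma choice_nonempty: "(\<Pi> i\<in>(UNIV::'i set). X) \<noteq> {}"
  using X by auto

text \<open>A near-minimiser is chosen at every index with the same error \<open>eps\<close>, so
  quantifying over sequences amounts to quantifying index by index.\<close>

lemma INF_choice:
  "(INF c\<in>(\<Pi> i\<in>UNIV. X). real_limsup F (\<lambda>i. w i (c i))) = real_limsup F (\<lambda>i. INF a\<in>X. w i a)"
proof (rule antisym)
  have bdd: "bdd_below ((\<lambda>c. real_limsup F (\<lambda>i. w i (c i))) ` (\<Pi> i\<in>UNIV. X))"
    using limsup_choice_in by (intro bdd_belowI2[where m="-B"]) auto
  show "(INF c\<in>(\<Pi> i\<in>UNIV. X). real_limsup F (\<lambda>i. w i (c i))) \<le> real_limsup F (\<lambda>i. INF a\<in>X. w i a)"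
  proof (rule field_le_epsilon)
    fix eps :: real assume "eps > 0"
    then have "\<exists>a\<in>X. w i a < (INF a\<in>X. w i a) + eps" for i
      using cINF_less_iff[OF X bdd_below_family, of i "(INF a\<in>X. w i a) + eps"] by simp
    then obtain c where c: "\<And>i. c i \<in> X" "\<And>i. w i (c i) < (INF a\<in>X. w i a) + eps" by metis
    then have "(INF c\<in>(\<Pi> i\<in>UNIV. X). real_limsup F (\<lambda>i. w i (c i))) \<le> real_limsup F (\<lambda>i. w i (c i))"
      by (intro cINF_lower[OF bdd]) auto
    also have "\<dots> \<le> real_limsup F (\<lambda>i. INF a\<in>X. w i a) + eps"
      using c by (intro real_limsup_le_add F bounded_choice bounded_INF always_eventually allI) (auto intro: less_imp_le)
    finally show "(INF c\<in>(\<Pi> i\<in>UNIV. X). real_limsup F (\<lambda>i. w i (c i)))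
        \<le> real_limsup F (\<lambda>i. INF a\<in>X. w i a) + eps" .
  qed
  show "real_limsup F (\<lambda>i. INF a\<in>X. w i a) \<le> (INF c\<in>(\<Pi> i\<in>UNIV. X). real_limsup F (\<lambda>i. w i (c i)))"
    by (intro cINF_greatest choice_nonempty real_limsup_mono F bounded_INF bounded_choice
        always_eventually allI cINF_lower bdd_below_family) auto
qed

lemma SUP_choice:
  "(SUP c\<in>(\<Pi> i\<in>UNIV. X). real_limsup F (\<lambda>i. w i (c i))) = real_limsup F (\<lambda>i. SUP a\<in>X. w i a)"
proof (rule antisym)
  have bdd: "bdd_above ((\<lambda>c. real_limsup F (\<lambda>i. w i (c i))) ` (\<Pi> i\<in>UNIV. X))"
    using limsup_choice_in by (intro bdd_aboveI2[where M=B]) auto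
  show "real_limsup F (\<lambda>i. SUP a\<in>X. w i a) \<le> (SUP c\<in>(\<Pi> i\<in>UNIV. X). real_limsup F (\<lambda>i. w i (c i)))"
  proof (rule field_le_epsilon)
    fix eps :: real assume "eps > 0"
    then have "\<exists>a\<in>X. (SUP a\<in>X. w i a) - eps < w i a" for i
      using less_cSUP_iff[OF X bdd_above_family, of "(SUP a\<in>X. w i a) - eps" i] by simp
    then obtain c where c: "\<And>i. c i \<in> X" "\<And>i. (SUP a\<in>X. w i a) - eps < w i (c i)" by metis
    have "real_limsup F (\<lambda>i. SUP a\<in>X. w i a) \<le> real_limsup F (\<lambda>i. w i (c i)) + eps"
      using c by (intro real_limsup_le_add F bounded_choice bounded_SUP always_eventually allI)
        (auto intro: less_imp_le simp: less_diff_eq diff_less_eq)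
    also have "real_limsup F (\<lambda>i. w i (c i)) \<le> (SUP c\<in>(\<Pi> i\<in>UNIV. X). real_limsup F (\<lambda>i. w i (c i)))"
      using c by (intro cSUP_upper bdd) auto
    finally show "real_limsup F (\<lambda>i. SUP a\<in>X. w i a)
        \<le> (SUP c\<in>(\<Pi> i\<in>UNIV. X). real_limsup F (\<lambda>i. w i (c i))) + eps" by simp
  qed
  show "(SUP c\<in>(\<Pi> i\<in>UNIV. X). real_limsup F (\<lambda>i. w i (c i))) \<le> real_limsup F (\<lambda>i. SUP a\<in>X. w i a)"
    by (intro cSUP_least choice_nonempty real_limsup_mono F bounded_SUP bounded_choice
        always_eventually allI cSUP_upper bdd_above_family) auto
qed

end

text \<open>For antitone \<open>D\<close>, applying \<open>D\<close> to a limit superior gives a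
  limit inferior, so its lower bounds hold eventually and combine with the frequent lower bound on
  \<open>v\<close>. Conversely, near-maximisers of the supremum are used where that supremum is
  large, and near-minimisers of \<open>w\<close> elsewhere.\<close>

lemma (in bounded_family) max_INF_SUP_choice:
  fixes v :: "'i \<Rightarrow> 'a \<Rightarrow> real"
  assumes "\<And>i a. a \<in> X \<Longrightarrow> \<bar>v i a\<bar> \<le> B'"
    and D: "continuous_on UNIV D" "antimono D" "D \<Delta> = \<Delta>"
  shows "max (INF c\<in>(\<Pi> i\<in>UNIV. X). real_limsup F (\<lambda>i. w i (c i)))
      (SUP c\<in>(\<Pi> i\<in>UNIV. X). min (D (real_limsup F (\<lambda>i. w i (c i))))
        (min \<Delta> (real_limsup F (\<lambda>i. v i (c i))))) =
    real_limsup F (\<lambda>i. max (INF a\<in>X. w i a) (SUP a\<in>X. min (D (w i a)) (min \<Delta> (v i a))))"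
    (is "max ?I ?S = ?R")
proof -
  let ?m = "\<lambda>i a. min (D (w i a)) (min \<Delta> (v i a))"
  let ?inf = "\<lambda>i. INF a\<in>X. w i a" and ?sup = "\<lambda>i. SUP a\<in>X. ?m i a"
  interpret v: bounded_family F X v B'
    using assms(1) F X by unfold_locales auto
  have "compact (D ` {- B..B})"
    using D(1) by (intro compact_continuous_image) (auto intro: continuous_on_subset)
  then obtain BD where BD: "\<And>t. t \<in> {-B..B} \<Longrightarrow> \<bar>D t\<bar> \<le> BD"
    using compact_imp_bounded bounded_iff by (metis image_eqI real_norm_def)
  have BDw: "\<bar>D (w i a)\<bar> \<le> BD" if "a \<in> X" for i a
    using bound[OF that, of i] by (intro BD) (auto simp: abs_le_iff)
  have mb: "\<bar>?m i a\<bar> \<le> max BD (max \<bar>\<Delta>\<bar> B')" if "a \<in> X" for i a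
    using BDw[OF that, of i] assms(1)[OF that, of i] by (auto simp: min_def max_def)
  interpret m: bounded_family F X ?m "max BD (max \<bar>\<Delta>\<bar> B')"
    using mb F X by unfold_locales auto
  have R: "?R = max (real_limsup F ?inf) (real_limsup F ?sup)"
    by (intro real_limsup_max F bounded_INF m.bounded_SUP)
  have I: "?I = real_limsup F ?inf" by (rule INF_choice)
  have Dantimono: "s \<le> t \<Longrightarrow> D t \<le> D s" for s t using D(2) by (rule antimonoD)
  have Dlim: "D (real_limsup F u) = - real_limsup F (\<lambda>i. - D (u i))" if "bounded (range u)" for u
  proof -
    have "mono (\<lambda>t. - D t)" using Dantimono by (intro monoI) simp
    with real_limsup_mono_continuous[OF F that continuous_on_minus[OF D(1)]] show ?thesis by simp
  qed
  have Sbdd: "min (D (real_limsup F (\<lambda>i. w i (c i)))) (min \<Delta> (real_limsup F (\<lambda>i. v i (c i)))) \<le> \<Delta>" for c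
    by simp
  have "?S \<le> real_limsup F ?sup"
  proof (rule cSUP_least[OF choice_nonempty])
    fix c assume c: "c \<in> (\<Pi> i\<in>(UNIV::'i set). X)"
    then have cX: "c i \<in> X" for i by auto
    let ?r = "min (D (real_limsup F (\<lambda>i. w i (c i)))) (min \<Delta> (real_limsup F (\<lambda>i. v i (c i))))"
    show "?r \<le> real_limsup F ?sup"
    proof (rule dense_le)
      fix s assume s: "s < ?r"
      have Db: "bounded (range (\<lambda>i. - D (w i (c i))))"
        using BDw[OF cX] unfolding bounded_range_iff_abs by auto
      have "real_limsup F (\<lambda>i. - D (w i (c i))) < - s"
        using s Dlim[OF bounded_choice[OF c]] by simp
      then have "eventually (\<lambda>i. - D (w i (c i)) < - s) F"
        by (rule real_limsup_less_eventually[OF F Db])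
      moreover have "frequently (\<lambda>i. s < v i (c i)) F"
        using s by (intro real_limsup_greater_frequently F v.bounded_choice c) simp
      ultimately have "frequently (\<lambda>i. - D (w i (c i)) < - s \<and> s < v i (c i)) F"
        by (rule frequently_eventually_conj[rotated])
      then have "frequently (\<lambda>i. s \<le> ?sup i) F"
      proof (rule frequently_elim1)
        fix i assume "- D (w i (c i)) < - s \<and> s < v i (c i)"
        then have "s \<le> ?m i (c i)" using s by simp
        also have "\<dots> \<le> ?sup i" by (rule cSUP_upper[OF cX m.bdd_above_family])
        finally show "s \<le> ?sup i" .
      qed
      then show "s \<le> real_limsup F ?sup" by (rule real_limsup_geI[OF F m.bounded_SUP])
    qed
  qed
  \<comment> \<open>If the infima have the larger limit superior, \<open>?I\<close> alone dominates.
    Otherwise that limit superior lies strictly below \<open>\<Delta>\<close>, which leaves a gap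
    for near-minimisers.\<close>
  moreover have "real_limsup F ?sup \<le> max ?I ?S"
  proof (cases "real_limsup F ?sup \<le> real_limsup F ?inf")
    case False
    let ?\<alpha> = "real_limsup F ?inf"
    have sup_le: "?sup i \<le> \<Delta>" for i using X by (intro cSUP_least) auto
    then have "real_limsup F ?sup \<le> \<Delta>" by (intro real_limsup_leI F m.bounded_SUP) auto
    with False have \<alpha>: "?\<alpha> < \<Delta>" by simp
    have bS: "bdd_above ((\<lambda>c. min (D (real_limsup F (\<lambda>i. w i (c i))))
        (min \<Delta> (real_limsup F (\<lambda>i. v i (c i))))) ` (\<Pi> i\<in>UNIV. X))"
      using Sbdd by (intro bdd_aboveI2[where M=\<Delta>])
    have "real_limsup F ?sup \<le> ?S"
    proof (rule dense_le)
      fix s assume s: "s < real_limsup F ?sup"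
      \<comment> \<open>Half of the gap is slack for the minimiser, the other half for the infimum
        exceeding its limit superior \<open>?\<alpha>\<close>; together they keep
        \<open>w i (c i)\<close> below \<open>\<Delta>\<close> eventually.\<close>
      have "\<exists>a. a \<in> X \<and> (s < ?sup i \<longrightarrow> s < ?m i a) \<and>
          (\<not> s < ?sup i \<longrightarrow> w i a < ?inf i + (\<Delta> - ?\<alpha>) / 2)" for i
      proof (cases "s < ?sup i")
        case True
        then show ?thesis using less_cSUP_iff[OF X m.bdd_above_family, of s i] by auto
      next
        case False
        then show ?thesis
          using cINF_less_iff[OF X bdd_below_family, of i "?inf i + (\<Delta> - ?\<alpha>) / 2"] \<alpha> by auto
      qed
      then obtain c where c_all: "\<forall>i. c i \<in> X \<and> (s < ?sup i \<longrightarrow> s < ?m i (c i)) \<and>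
          (\<not> s < ?sup i \<longrightarrow> w i (c i) < ?inf i + (\<Delta> - ?\<alpha>) / 2)"
        using choice[of "\<lambda>i a. a \<in> X \<and> (s < ?sup i \<longrightarrow> s < ?m i a) \<and>
          (\<not> s < ?sup i \<longrightarrow> w i a < ?inf i + (\<Delta> - ?\<alpha>) / 2)"] by blast
      from c_all have cX: "c i \<in> X" for i by blast
      from c_all have cP: "s < ?m i (c i)" if "s < ?sup i" for i using that by blast
      from c_all have cQ: "w i (c i) < ?inf i + (\<Delta> - ?\<alpha>) / 2" if "\<not> s < ?sup i" for i
        using that by blast
      have c: "c \<in> (\<Pi> i\<in>UNIV. X)" using cX by auto
      have freq: "frequently (\<lambda>i. s < ?sup i) F"
        by (rule real_limsup_greater_frequently[OF F m.bounded_SUP s])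
      have "s \<le> real_limsup F (\<lambda>i. v i (c i))"
        by (intro real_limsup_geI F v.bounded_choice c frequently_elim1[OF freq])
          (use cP in \<open>fastforce intro: less_imp_le\<close>)
      moreover have s\<Delta>: "s \<le> \<Delta>" using s \<open>real_limsup F ?sup \<le> \<Delta>\<close> by simp
      moreover have "s \<le> D (real_limsup F (\<lambda>i. w i (c i)))"
      proof -
        have "eventually (\<lambda>i. ?inf i < (?\<alpha> + \<Delta>) / 2) F"
          using \<alpha> by (intro real_limsup_less_eventually F bounded_INF) simp
        then have "eventually (\<lambda>i. - D (w i (c i)) \<le> - s) F"
        proof eventually_elim
          case (elim i)
          show ?case
          proof (cases "s < ?sup i")
            case True
            then show ?thesis using cP[OF True] by simp
          next
            case False
            \<comment> \<open>Here the fixed point is used: \<open>w i (c i) \<le> \<Delta>\<close>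
              yields \<open>D (w i (c i)) \<ge> D \<Delta> = \<Delta> \<ge> s\<close>.\<close>
            then have "w i (c i) \<le> \<Delta>" using cQ[OF False] elim by (simp add: field_simps)
            then show ?thesis using Dantimono[of "w i (c i)" \<Delta>] D(3) s\<Delta> by simp
          qed
        qed
        moreover have "bounded (range (\<lambda>i. - D (w i (c i))))"
          using BDw[OF cX] unfolding bounded_range_iff_abs by auto
        ultimately have "real_limsup F (\<lambda>i. - D (w i (c i))) \<le> - s"
          by (intro real_limsup_leI F)
        then show ?thesis using Dlim[OF bounded_choice[OF c]] by simp
      qed
      ultimately have "s \<le> min (D (real_limsup F (\<lambda>i. w i (c i)))) (min \<Delta> (real_limsup F (\<lambda>i. v i (c i))))"
        by simp
      also have "\<dots> \<le> ?S" by (rule cSUP_upper[OF c bS])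
      finally show "s \<le> ?S" .
    qed
    then show ?thesis by simp
  qed (simp add: I)
  ultimately show ?thesis unfolding R I by simp
qed

section \<open>Values of formulas\<close>

text \<open>Just enough for quantifiers to take suprema and infima over nonempty bounded sets of
  values; the given structures and their reduced powers both satisfy it.\<close>

definition bounded_struct :: "('f, 'p) metric_sig \<Rightarrow> ('f, 'p, 'a) metric_struct \<Rightarrow> bool" where
  "bounded_struct L S \<longleftrightarrow> Dom S \<noteq> {} \<and>
     (\<exists>B. \<forall>a\<in>Dom S. \<forall>b\<in>Dom S. \<bar>Met S a b\<bar> \<le> B) \<and>
     (\<forall>f\<in>FunSyms L. \<forall>as\<in>tuples (Dom S) (FunArity L f). FunI S f as \<in> Dom S) \<and>
     (\<forall>p\<in>PredSyms L. \<exists>B. \<forall>as\<in>tuples (Dom S) (PredArity L p). \<bar>PredI S p as\<bar> \<le> B)"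

lemma L_structure_bounded:
  assumes "L_structure L S"
  shows "bounded_struct L S"
proof -
  interpret Metric_space "Dom S" "Met S" using assms by (simp add: L_structure_def)
  have "\<bar>Met S a b\<bar> \<le> DistBound L" if "a \<in> Dom S" "b \<in> Dom S" for a b
    using assms that by (simp add: L_structure_def)
  moreover have "Dom S \<noteq> {}" using assms by (simp add: L_structure_def)
  moreover have "FunI S f as \<in> Dom S" if "f \<in> FunSyms L" "as \<in> tuples (Dom S) (FunArity L f)" for f as
    using assms that by (simp add: L_structure_def)
  moreover have "\<bar>PredI S p as\<bar> \<le> PredBound L p"
    if "p \<in> PredSyms L" "as \<in> tuples (Dom S) (PredArity L p)" for p as
    using assms that by (simp add: L_structure_def)
  ultimately show ?thesis unfolding bounded_struct_def by blast
qed

lemma trm_val_in_Dom: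
  assumes "bounded_struct L S" and "\<And>x. e x \<in> Dom S"
  shows "wf_trm L t \<Longrightarrow> trm_val S e t \<in> Dom S"
proof (induction t)
  case (App f ts)
  then have "map (trm_val S e) ts \<in> tuples (Dom S) (FunArity L f)"
    by (auto simp: tuples_def)
  then show ?case using App.prems assms(1) by (auto simp: bounded_struct_def)
qed (use assms in auto)

lemma trm_val_cong: "(\<And>x. x \<in> fv_trm t \<Longrightarrow> e x = e' x) \<Longrightarrow> trm_val S e t = trm_val S e' t"
proof (induction t)
  case (App f ts)
  have "trm_val S e t = trm_val S e' t" if "t \<in> set ts" for t
    using that App.prems by (intro App.IH) auto
  then show ?case by (simp cong: map_cong)
qed simp

lemma fm_val_cong: "(\<And>x. x \<in> fv_fm \<phi> \<Longrightarrow> e x = e' x) \<Longrightarrow> fm_val S e \<phi> = fm_val S e' \<phi>"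
proof (induction \<phi> arbitrary: e e')
  case (DistF s t)
  have "trm_val S e s = trm_val S e' s" "trm_val S e t = trm_val S e' t"
    using DistF by (auto intro!: trm_val_cong)
  then show ?case by simp
next
  case (PredF p ts)
  have "trm_val S e t = trm_val S e' t" if "t \<in> set ts" for t
    using that PredF by (intro trm_val_cong) auto
  then show ?case by (simp cong: map_cong)
next
  case (Conn C \<phi>s)
  have "fm_val S e \<phi> = fm_val S e' \<phi>" if "\<phi> \<in> set \<phi>s" for \<phi>
    using that Conn.prems by (intro Conn.IH) auto
  then show ?case by (simp cong: map_cong)
next
  case (SupF x \<phi>)
  have "fm_val S (e(x := a)) \<phi> = fm_val S (e'(x := a)) \<phi>" for a
    using SupF.prems by (intro SupF.IH) auto
  then show ?case by simp
next
  case (InfF x \<phi>)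
  have "fm_val S (e(x := a)) \<phi> = fm_val S (e'(x := a)) \<phi>" for a
    using InfF.prems by (intro InfF.IH) auto
  then show ?case by simp
qed

lemma sentence_val_eq: "fv_fm \<phi> = {} \<Longrightarrow> fm_val S e \<phi> = sentence_val S \<phi>"
  unfolding sentence_val_def by (rule fm_val_cong) simp

lemma finite_fv_trm: "finite (fv_trm t)"
  by (induction t) auto

lemma finite_fv_fm: "finite (fv_fm \<phi>)"
  by (induction \<phi>) (auto simp: finite_fv_trm)

section \<open>Compactness of cubes and bounds for formula values\<close>

lemma connective_bounded:
  assumes "continuous_map (powertop_real {..<n}) euclideanreal C"
  shows "\<exists>B'. \<forall>v\<in>({..<n} \<rightarrow>\<^sub>E {-B..B}). \<bar>C v\<bar> \<le> B'"
proof -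
  have "compactin (powertop_real {..<n}) ({..<n} \<rightarrow>\<^sub>E {-B..B})"
    by (simp add: compactin_PiE)
  then have "compactin euclideanreal (C ` ({..<n} \<rightarrow>\<^sub>E {-B..B}))"
    using assms by (rule image_compactin)
  then have "bounded (C ` ({..<n} \<rightarrow>\<^sub>E {-B..B}))"
    by (simp add: compact_imp_bounded)
  then show ?thesis by (auto simp: bounded_iff)
qed

text \<open>The metric on functions weights the coordinates by powers of 1/2, whose sum is
  2.\<close>

lemma dist_fun_less:
  fixes v w :: "nat \<Rightarrow> real"
  assumes "\<And>k. \<bar>v k - w k\<bar> \<le> \<delta>"
  shows "dist v w \<le> 2 * \<delta>"
proof -
  have half: "(\<lambda>k. (1/2)^k * \<delta>) sums (2 * \<delta>)" for \<delta> :: real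
    using sums_mult2[OF geometric_sums[of "1/2 :: real"], of \<delta>] by simp
  have le: "(1/2)^k * min (dist (v (from_nat k)) (w (from_nat k))) 1 \<le> (1/2)^k * \<delta>" for k
    using assms[of "from_nat k"] by (intro mult_left_mono) (auto simp: dist_real_def)
  have "summable (\<lambda>k. (1/2)^k * min (dist (v (from_nat k)) (w (from_nat k))) (1::real))"
    by (rule summable_comparison_test'[OF sums_summable[OF half[of \<delta>]]]) (use le in auto)
  then show ?thesis
    unfolding dist_fun_def using suminf_le[OF le _ sums_summable[OF half]] sums_unique[OF half, of \<delta>]
    by simp
qed

text \<open>Uniform continuity is a metric notion, whereas \<open>C\<close> lives on a product of
  topological spaces over \<open>{..<n}\<close>. Composing with restriction gives a continuous
  \<open>g\<close> on all sequences, where the product topology is metrised, and the cube becomes a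
  compact set \<open>K\<close>, padded with zeros.\<close>

lemma connective_uniformly_continuous:
  fixes n :: nat
  assumes C: "continuous_map (powertop_real {..<n}) euclideanreal C" and "eps > 0"
  shows "\<exists>\<delta>>0. \<forall>v\<in>({..<n} \<rightarrow>\<^sub>E {-B..B}). \<forall>w\<in>({..<n} \<rightarrow>\<^sub>E {-B..B}).
    (\<forall>k<n. \<bar>v k - w k\<bar> < \<delta>) \<longrightarrow> \<bar>C v - C w\<bar> < eps"
proof -
  define g where "g v = C (restrict v {..<n})" for v :: "nat \<Rightarrow> real"
  have "continuous_map (powertop_real UNIV) (powertop_real {..<n}) (\<lambda>v. restrict v {..<n})"
    by (auto simp: continuous_map_componentwise intro: continuous_map_product_projection)
  then have "continuous_map (powertop_real UNIV) euclideanreal g"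
    unfolding g_def using continuous_map_compose[OF _ C] by (simp add: o_def)
  then have g: "continuous_on UNIV g"
    by (simp add: euclidean_product_topology)
  define K where "K = (\<Pi>\<^sub>E k\<in>UNIV. if k < n then {-B..B} else {0::real})"
  have "compactin (powertop_real UNIV) K"
    unfolding K_def by (subst compactin_PiE) auto
  then have "compact K" by (simp add: euclidean_product_topology)
  then have "uniformly_continuous_on K g"
    using g by (intro compact_uniformly_continuous) (auto intro: continuous_on_subset)
  then obtain \<eta> where "\<eta> > 0" and \<eta>: "\<And>v w. v \<in> K \<Longrightarrow> w \<in> K \<Longrightarrow> dist w v < \<eta> \<Longrightarrow> dist (g w) (g v) < eps"
    using \<open>eps > 0\<close> unfolding uniformly_continuous_on_def by metis
  show ?thesis
  \<comment> \<open>\<open>dist_fun_less\<close> loses a factor 2, so a third of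
    \<open>\<eta>\<close> stays strictly below \<open>\<eta>\<close>.\<close>
  proof (intro exI[of _ "\<eta> / 3"] conjI ballI impI)
    fix v w assume vw: "v \<in> {..<n} \<rightarrow>\<^sub>E {-B..B}" "w \<in> {..<n} \<rightarrow>\<^sub>E {-B..B}"
      and close: "\<forall>k<n. \<bar>v k - w k\<bar> < \<eta> / 3"
    define ext where "ext u = (\<lambda>k. if k < n then u k else (0::real))" for u
    have gext: "g (ext u) = C u" if "u \<in> {..<n} \<rightarrow>\<^sub>E {-B..B}" for u
    proof -
      have "restrict (ext u) {..<n} = u"
        using that by (intro ext) (auto simp: ext_def PiE_def extensional_def)
      then show ?thesis by (simp add: g_def)
    qed
    have "ext v \<in> K" "ext w \<in> K" using vw by (auto simp: K_def ext_def PiE_def Pi_def)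
    moreover have "dist (ext w) (ext v) \<le> 2 * (\<eta> / 3)"
      using close \<open>\<eta> > 0\<close>
      by (intro dist_fun_less) (auto simp: ext_def abs_minus_commute intro: less_imp_le)
    ultimately have "dist (g (ext w)) (g (ext v)) < eps"
      using \<eta>[of "ext v" "ext w"] \<open>\<eta> > 0\<close> by simp
    then show "\<bar>C v - C w\<bar> < eps" using gext vw by (simp add: dist_real_def abs_minus_commute)
  qed (use \<open>\<eta> > 0\<close> in simp)
qed

lemma SUP_abs_le:
  fixes f :: "'a \<Rightarrow> real"
  assumes "A \<noteq> {}" and "\<And>a. a \<in> A \<Longrightarrow> \<bar>f a\<bar> \<le> B"
  shows "\<bar>SUP a\<in>A. f a\<bar> \<le> B"
proof -
  \<comment> \<open>With a single index the bounds of the locale become bounds on a plain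
    supremum.\<close>
  interpret bounded_family "principal {()}" A "\<lambda>_. f" B
    using assms by unfold_locales (auto simp: principal_eq_bot_iff)
  show ?thesis using SUP_in by (auto simp: abs_le_iff)
qed

lemma INF_abs_le:
  fixes f :: "'a \<Rightarrow> real"
  assumes "A \<noteq> {}" and "\<And>a. a \<in> A \<Longrightarrow> \<bar>f a\<bar> \<le> B"
  shows "\<bar>INF a\<in>A. f a\<bar> \<le> B"
proof -
  interpret bounded_family "principal {()}" A "\<lambda>_. f" B
    using assms by unfold_locales (auto simp: principal_eq_bot_iff)
  show ?thesis using INF_in by (auto simp: abs_le_iff)
qed

lemma finite_common_bound:
  assumes "finite A" and "\<And>a. a \<in> A \<Longrightarrow> \<exists>B. \<forall>e\<in>E. \<bar>f e a :: real\<bar> \<le> B"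
  shows "\<exists>B. \<forall>a\<in>A. \<forall>e\<in>E. \<bar>f e a\<bar> \<le> B"
  using assms
proof (induction A rule: finite_induct)
  case (insert a A)
  obtain B where B: "\<forall>a\<in>A. \<forall>e\<in>E. \<bar>f e a\<bar> \<le> B" using insert by auto
  obtain B' where "\<forall>e\<in>E. \<bar>f e a\<bar> \<le> B'" using insert.prems by blast
  with B have "\<forall>a\<in>insert a A. \<forall>e\<in>E. \<bar>f e a\<bar> \<le> max B B'" by (auto simp: le_max_iff_disj)
  then show ?case by blast
qed simp

text \<open>The bound has to be uniform in the assignment, because a limit superior evaluates the
  formula under a different assignment at every index.\<close>

lemma fm_val_bounded:
  assumes S: "bounded_struct L S"
  shows "wf_fm L \<phi> \<Longrightarrow> \<exists>B. \<forall>e. (\<forall>x. e x \<in> Dom S) \<longrightarrow> \<bar>fm_val S e \<phi>\<bar> \<le> B"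
proof (induction \<phi>)
  case (DistF s t)
  obtain B where "\<And>a b. a \<in> Dom S \<Longrightarrow> b \<in> Dom S \<Longrightarrow> \<bar>Met S a b\<bar> \<le> B"
    using S unfolding bounded_struct_def by blast
  then show ?case using DistF trm_val_in_Dom[OF S] by (intro exI[of _ B]) simp
next
  case (PredF p ts)
  then obtain B where B: "\<And>as. as \<in> tuples (Dom S) (PredArity L p) \<Longrightarrow> \<bar>PredI S p as\<bar> \<le> B"
    using S unfolding bounded_struct_def by (metis wf_fm.simps(2))
  have "map (trm_val S e) ts \<in> tuples (Dom S) (PredArity L p)" if "\<forall>x. e x \<in> Dom S" for e
    using PredF trm_val_in_Dom[OF S] that by (auto simp: tuples_def)
  then show ?case using B by (intro exI[of _ B]) simp
next
  case (Conn C \<phi>s)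
  have "\<exists>B0. \<forall>\<phi>\<in>set \<phi>s. \<forall>e\<in>{e. \<forall>x. e x \<in> Dom S}. \<bar>fm_val S e \<phi>\<bar> \<le> B0"
    using Conn by (intro finite_common_bound) auto
  then obtain B0 where B0: "\<And>\<phi> e. \<phi> \<in> set \<phi>s \<Longrightarrow> \<forall>x. e x \<in> Dom S \<Longrightarrow> \<bar>fm_val S e \<phi>\<bar> \<le> B0"
    by blast
  obtain B' where B': "\<And>v. v \<in> {..<length \<phi>s} \<rightarrow>\<^sub>E {-B0..B0} \<Longrightarrow> \<bar>C v\<bar> \<le> B'"
    using Conn.prems connective_bounded[of "length \<phi>s" C B0] by auto
  show ?case
  proof (intro exI[of _ B'] allI impI)
    fix e :: "nat \<Rightarrow> 'c" assume "\<forall>x. e x \<in> Dom S"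
    then have "\<bar>fm_val S e (\<phi>s ! k)\<bar> \<le> B0" if "k < length \<phi>s" for k
      using that by (intro B0) auto
    then have "(\<lambda>k\<in>{..<length \<phi>s}. map (fm_val S e) \<phi>s ! k) \<in> {..<length \<phi>s} \<rightarrow>\<^sub>E {-B0..B0}"
      by (auto simp: abs_le_iff minus_le_iff)
    then show "\<bar>fm_val S e (Conn C \<phi>s)\<bar> \<le> B'" unfolding fm_val.simps by (rule B')
  qed
next
  case (SupF x \<phi>)
  then obtain B where B: "\<And>e. \<forall>x. e x \<in> Dom S \<Longrightarrow> \<bar>fm_val S e \<phi>\<bar> \<le> B" by auto
  have "Dom S \<noteq> {}" using S by (simp add: bounded_struct_def)
  then show ?case using B by (intro exI[of _ B]) (auto intro!: SUP_abs_le)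
next
  case (InfF x \<phi>)
  then obtain B where B: "\<And>e. \<forall>x. e x \<in> Dom S \<Longrightarrow> \<bar>fm_val S e \<phi>\<bar> \<le> B" by auto
  have "Dom S \<noteq> {}" using S by (simp add: bounded_struct_def)
  then show ?case using B by (intro exI[of _ B]) (auto intro!: INF_abs_le)
qed

lemma fm_val_Conn1 [simp]: "fm_val S e (Conn1 C \<phi>) = C (fm_val S e \<phi>)"
  by (simp add: Conn1_def)

lemma fm_val_ConstF [simp]: "fm_val S e (ConstF c) = c"
  by (simp add: ConstF_def)

lemma fm_val_MaxF [simp]: "fm_val S e (MaxF \<phi> \<psi>) = max (fm_val S e \<phi>) (fm_val S e \<psi>)"
  by (simp add: MaxF_def)

lemma fm_val_MinF [simp]: "fm_val S e (MinF \<phi> \<psi>) = min (fm_val S e \<phi>) (fm_val S e \<psi>)"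
  by (simp add: MinF_def)

lemma fv_connectives [simp]:
  "fv_fm (Conn1 C \<phi>) = fv_fm \<phi>" "fv_fm (ConstF c) = {}"
  "fv_fm (MaxF \<phi> \<psi>) = fv_fm \<phi> \<union> fv_fm \<psi>" "fv_fm (MinF \<phi> \<psi>) = fv_fm \<phi> \<union> fv_fm \<psi>"
  by (simp_all add: Conn1_def ConstF_def MaxF_def MinF_def)

lemma wf_Conn1:
  assumes "wf_fm L \<phi>" and "continuous_on UNIV C"
  shows "wf_fm L (Conn1 C \<phi>)"
proof -
  have "continuous_map (powertop_real {..<Suc 0}) euclideanreal (\<lambda>v. v 0)"
    by (intro continuous_map_product_projection) simp
  moreover have "continuous_map euclideanreal euclideanreal C" using assms(2) by simp
  ultimately have "continuous_map (powertop_real {..<Suc 0}) euclideanreal (C \<circ> (\<lambda>v. v 0))"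
    by (rule continuous_map_compose)
  then show ?thesis using assms(1) by (simp add: Conn1_def o_def)
qed

lemma wf_MaxF: "wf_fm L \<phi> \<Longrightarrow> wf_fm L \<psi> \<Longrightarrow> wf_fm L (MaxF \<phi> \<psi>)"
  by (auto simp: MaxF_def intro!: continuous_map_real_max continuous_map_product_projection)

lemma wf_MinF: "wf_fm L \<phi> \<Longrightarrow> wf_fm L \<psi> \<Longrightarrow> wf_fm L (MinF \<phi> \<psi>)"
  by (auto simp: MinF_def intro!: continuous_map_real_min continuous_map_product_projection)

lemma palyutin_wf: "palyutin L \<phi> \<Longrightarrow> wf_fm L \<phi>"
  by (induction rule: palyutin.induct)
    (auto intro!: wf_Conn1 wf_MaxF wf_MinF simp: ConstF_def)

lemma isomorphic_fm_val:
  assumes M: "bounded_struct L M" and h: "bij_betw h (Dom M) (Dom N)"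
    "\<And>a b. a \<in> Dom M \<Longrightarrow> b \<in> Dom M \<Longrightarrow> Met N (h a) (h b) = Met M a b"
    "\<And>f as. f \<in> FunSyms L \<Longrightarrow> as \<in> tuples (Dom M) (FunArity L f) \<Longrightarrow>
      FunI N f (map h as) = h (FunI M f as)"
    "\<And>p as. p \<in> PredSyms L \<Longrightarrow> as \<in> tuples (Dom M) (PredArity L p) \<Longrightarrow>
      PredI N p (map h as) = PredI M p as"
  shows "wf_fm L \<phi> \<Longrightarrow> (\<And>x. e x \<in> Dom M) \<Longrightarrow> fm_val N (\<lambda>x. h (e x)) \<phi> = fm_val M e \<phi>"
proof -
  have trm: "trm_val N (\<lambda>x. h (e x)) t = h (trm_val M e t)"
    if "wf_trm L t" "\<And>x. e x \<in> Dom M" for e t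
    using that(1)
  proof (induction t)
    case (App f ts)
    have "map (trm_val N (\<lambda>x. h (e x))) ts = map h (map (trm_val M e) ts)" using App by simp
    moreover have "map (trm_val M e) ts \<in> tuples (Dom M) (FunArity L f)"
      using App.prems trm_val_in_Dom[OF M] that(2) by (auto simp: tuples_def)
    ultimately show ?case using h(3) App.prems by (simp del: map_map)
  qed simp
  have quantifier: "(\<lambda>b. fm_val N ((\<lambda>y. h (e y))(x := b)) \<phi>) ` Dom N = (\<lambda>a. fm_val M (e(x := a)) \<phi>) ` Dom M"
    if IH: "\<And>e. (\<And>x. e x \<in> Dom M) \<Longrightarrow> fm_val N (\<lambda>x. h (e x)) \<phi> = fm_val M e \<phi>"
      and e: "\<And>x. e x \<in> Dom M" for \<phi> x e
  proof -
    have "fm_val N ((\<lambda>y. h (e y))(x := h a)) \<phi> = fm_val M (e(x := a)) \<phi>" if "a \<in> Dom M" for a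
      using IH[of "e(x := a)"] e that by (simp add: fun_upd_def if_distrib)
    then show ?thesis by (simp flip: bij_betw_imp_surj_on[OF h(1)] add: image_image)
  qed
  show "wf_fm L \<phi> \<Longrightarrow> (\<And>x. e x \<in> Dom M) \<Longrightarrow> fm_val N (\<lambda>x. h (e x)) \<phi> = fm_val M e \<phi>"
  proof (induction \<phi> arbitrary: e)
    case (DistF s t)
    then show ?case using trm h(2) trm_val_in_Dom[OF M] by simp
  next
    case (PredF p ts)
    have "map (trm_val N (\<lambda>x. h (e x))) ts = map h (map (trm_val M e) ts)"
      using PredF trm by simp
    moreover have "map (trm_val M e) ts \<in> tuples (Dom M) (PredArity L p)"
      using PredF trm_val_in_Dom[OF M] by (auto simp: tuples_def)
    ultimately show ?case using h(4) PredF.prems by (simp del: map_map)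
  next
    case (Conn C \<phi>s)
    then have "map (fm_val N (\<lambda>x. h (e x))) \<phi>s = map (fm_val M e) \<phi>s" by simp
    then show ?case by (simp only: fm_val.simps)
  next
    case (SupF x \<phi>)
    then show ?case using quantifier[where \<phi>=\<phi> and x=x and e=e] by simp
  next
    case (InfF x \<phi>)
    then show ?case using quantifier[where \<phi>=\<phi> and x=x and e=e] by simp
  qed
qed

section \<open>Reduced powers\<close>

locale structure_power =
  fixes L :: "('f, 'p) metric_sig" and M :: "('f, 'p, 'a) metric_struct" and F :: "'i filter"
  assumes M: "L_structure L M" and F: "F \<noteq> bot"
begin

abbreviation "Seqs \<equiv> \<Pi> i\<in>(UNIV :: 'i set). Dom M"
abbreviation "Rel \<equiv> prod_rel (\<lambda>_. M) F"
abbreviation "P \<equiv> reduced_power M F"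

lemma in_Seqs [simp]: "a \<in> Seqs \<longleftrightarrow> (\<forall>i. a i \<in> Dom M)"
  by auto

definition cl :: "('i \<Rightarrow> 'a) \<Rightarrow> ('i \<Rightarrow> 'a) set" where
  "cl a = Rel `` {a}"

abbreviation "pval e \<equiv> fm_val P (\<lambda>x. cl (e x))"

sublocale Metric_space "Dom M" "Met M"
  using M by (simp add: L_structure_def)

lemma bounded_M: "bounded_struct L M"
  using M by (rule L_structure_bounded)

lemma Met_le: "a \<in> Dom M \<Longrightarrow> b \<in> Dom M \<Longrightarrow> Met M a b \<le> DistBound L"
  using M by (simp add: L_structure_def)

lemma bounded_Met:
  assumes "a \<in> Seqs" and "b \<in> Seqs"
  shows "bounded (range (\<lambda>i. Met M (a i) (b i)))"
  unfolding bounded_range_iff_abs using assms Met_le by (intro exI[of _ "DistBound L"]) auto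

lemma Rel_iff:
  "(a, b) \<in> Rel \<longleftrightarrow> a \<in> Seqs \<and> b \<in> Seqs \<and> (\<forall>eps>0. eventually (\<lambda>i. Met M (a i) (b i) < eps) F)"
proof -
  have "prod_dist (\<lambda>_. M) F a b = 0 \<longleftrightarrow> (\<forall>eps>0. eventually (\<lambda>i. Met M (a i) (b i) < eps) F)"
    if ab: "a \<in> Seqs" "b \<in> Seqs"
  proof -
    have "0 \<le> prod_dist (\<lambda>_. M) F a b"
      unfolding prod_dist_def
      by (intro real_limsup_geI F bounded_Met ab) (auto simp: eventually_frequently F)
    then show ?thesis
      using real_limsup_le_iff[OF F bounded_Met[OF ab], of 0] unfolding prod_dist_def by auto
  qed
  then show ?thesis unfolding prod_rel_def by auto
qed

lemma equiv_Rel: "equiv Seqs Rel"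
proof (rule equivI)
  show "Rel \<subseteq> Seqs \<times> Seqs" by (auto simp: prod_rel_def)
  show "refl_on Seqs Rel"
    by (auto simp: refl_on_def Rel_iff)
  show "sym Rel" by (auto simp: sym_def Rel_iff commute)
  show "trans Rel"
  proof (rule transI)
    fix a b c assume ab: "(a, b) \<in> Rel" and bc: "(b, c) \<in> Rel"
    have "eventually (\<lambda>i. Met M (a i) (c i) < eps) F" if "eps > 0" for eps
    proof -
      have "eventually (\<lambda>i. Met M (a i) (b i) < eps / 2) F" "eventually (\<lambda>i. Met M (b i) (c i) < eps / 2) F"
        using ab bc that unfolding Rel_iff by (meson half_gt_zero)+
      then show ?thesis
      proof eventually_elim
        case (elim i)
        have "Met M (a i) (c i) \<le> Met M (a i) (b i) + Met M (b i) (c i)"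
          using ab bc by (intro triangle) (auto simp: Rel_iff)
        with elim show ?case by simp
      qed
    qed
    with ab bc show "(a, c) \<in> Rel" by (auto simp: Rel_iff)
  qed
qed

lemma Dom_P: "Dom P = cl ` Seqs"
  by (auto simp: reduced_power_def reduced_product_def quotient_def cl_def)

lemma cl_eq_iff: "a \<in> Seqs \<Longrightarrow> b \<in> Seqs \<Longrightarrow> cl a = cl b \<longleftrightarrow> (a, b) \<in> Rel"
  unfolding cl_def using equiv_Rel by (rule eq_equiv_class_iff)

lemma rep_cl: "a \<in> Seqs \<Longrightarrow> (a, rep (cl a)) \<in> Rel"
proof -
  assume "a \<in> Seqs"
  then have "a \<in> cl a" unfolding cl_def by (rule equiv_class_self[OF equiv_Rel])
  then have "rep (cl a) \<in> cl a" unfolding rep_def by (rule someI[where P="\<lambda>a'. a' \<in> cl a"])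
  then show ?thesis by (simp add: cl_def)
qed

lemma
  assumes "A \<in> Dom P"
  shows rep_in: "rep A \<in> Seqs" and cl_rep: "cl (rep A) = A"
proof -
  obtain a where A: "A = cl a" and a: "a \<in> Seqs" using assms unfolding Dom_P by blast
  have r: "(a, rep A) \<in> Rel" unfolding A using a by (rule rep_cl)
  then show "rep A \<in> Seqs" by (simp add: Rel_iff)
  with r a show "cl (rep A) = A" unfolding A by (metis cl_eq_iff)
qed

text \<open>Passing to the chosen representatives changes the distance by at most \<open>eps\<close>
  on a member of the filter, by the triangle inequality.\<close>

lemma Met_P:
  assumes "a \<in> Seqs" and "b \<in> Seqs"
  shows "Met P (cl a) (cl b) = real_limsup F (\<lambda>i. Met M (a i) (b i))"
proof -
  have in_P: "cl a \<in> Seqs // Rel" "cl b \<in> Seqs // Rel"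
    using assms by (auto simp: cl_def quotientI)
  have r: "(a, rep (cl a)) \<in> Rel" "(b, rep (cl b)) \<in> Rel" using assms rep_cl by auto
  then have rS: "rep (cl a) \<in> Seqs" "rep (cl b) \<in> Seqs" by (auto simp: Rel_iff)
  have "real_limsup F (\<lambda>i. Met M (rep (cl a) i) (rep (cl b) i)) = real_limsup F (\<lambda>i. Met M (a i) (b i))"
  proof (intro real_limsup_close F bounded_Met assms rS)
    fix eps :: real assume "eps > 0"
    then have "eventually (\<lambda>i. Met M (a i) (rep (cl a) i) < eps / 2) F"
      "eventually (\<lambda>i. Met M (b i) (rep (cl b) i) < eps / 2) F"
      using r unfolding Rel_iff by (meson half_gt_zero)+
    then show "eventually (\<lambda>i. \<bar>Met M (rep (cl a) i) (rep (cl b) i) - Met M (a i) (b i)\<bar> \<le> eps) F"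
    proof eventually_elim
      case (elim i)
      have D: "a i \<in> Dom M" "b i \<in> Dom M" "rep (cl a) i \<in> Dom M" "rep (cl b) i \<in> Dom M"
        using assms rS by auto
      show ?case
        using triangle[OF D(1) D(3) D(2)] triangle[OF D(3) D(4) D(2)]
          triangle[OF D(3) D(1) D(4)] triangle[OF D(1) D(2) D(4)] elim
          commute[of "a i" "rep (cl a) i"] commute[of "b i" "rep (cl b) i"]
        by linarith
    qed
  qed
  then show ?thesis
    using in_P by (simp add: reduced_power_def reduced_product_def prod_dist_def)
qed

lemma FunI_close:
  assumes "f \<in> FunSyms L" and "as \<in> tuples (Dom M) (FunArity L f)" and "bs \<in> tuples (Dom M) (FunArity L f)"
    and "eps > 0" and "\<And>k. k < FunArity L f \<Longrightarrow> Met M (as ! k) (bs ! k) < FunModulus L f eps"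
  shows "Met M (FunI M f as) (FunI M f bs) \<le> eps"
  using M assms by (simp add: L_structure_def)

lemma PredI_close:
  assumes "p \<in> PredSyms L" and "as \<in> tuples (Dom M) (PredArity L p)" and "bs \<in> tuples (Dom M) (PredArity L p)"
    and "eps > 0" and "\<And>k. k < PredArity L p \<Longrightarrow> Met M (as ! k) (bs ! k) < PredModulus L p eps"
  shows "\<bar>PredI M p as - PredI M p bs\<bar> \<le> eps"
  using M assms by (simp add: L_structure_def)

lemma Met_P_eq_0_iff:
  assumes "A \<in> Dom P" and "B \<in> Dom P"
  shows "Met P A B = 0 \<longleftrightarrow> A = B"
proof -
  obtain a b where "A = cl a" "B = cl b" "a \<in> Seqs" "b \<in> Seqs"
    using assms unfolding Dom_P by blast
  then show ?thesis by (simp add: Met_P cl_eq_iff prod_rel_def prod_dist_def)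
qed

lemma rep_tuples:
  assumes "set as \<subseteq> Seqs"
  shows "map (\<lambda>a. rep (cl a) i) as \<in> tuples (Dom M) (length as)"
    and "map (\<lambda>a. a i) as \<in> tuples (Dom M) (length as)"
  using assms rep_cl by (auto simp: tuples_def Rel_iff)

lemma eventually_rep_close:
  assumes "set as \<subseteq> Seqs" and "\<delta> > 0"
  shows "eventually (\<lambda>i. \<forall>a\<in>set as. Met M (a i) (rep (cl a) i) < \<delta>) F"
  using assms rep_cl by (auto simp: eventually_ball_finite_distrib Rel_iff)

text \<open>The modulus depends on the symbol and not on the index, so one bound serves everywhere,
  and finitely many arguments are simultaneously that close to their representatives on a member of
  the filter.\<close>

lemma FunI_P:
  assumes f: "f \<in> FunSyms L" and as: "set as \<subseteq> Seqs" "length as = FunArity L f" and L: "metric_signature L"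
  shows "FunI P f (map cl as) = cl (\<lambda>i. FunI M f (map (\<lambda>a. a i) as))"
proof -
  let ?a = "\<lambda>i. FunI M f (map (\<lambda>a. rep (cl a) i) as)" and ?b = "\<lambda>i. FunI M f (map (\<lambda>a. a i) as)"
  note t = rep_tuples[OF as(1), unfolded as(2)]
  have closed: "?a \<in> Seqs" "?b \<in> Seqs" using t M f by (auto simp: L_structure_def)
  have "eventually (\<lambda>i. Met M (?b i) (?a i) < eps) F" if "eps > 0" for eps
  proof -
    \<comment> \<open>Half of \<open>eps\<close>, since moduli give weak inequalities and a strict
      one is wanted.\<close>
    have pos: "FunModulus L f (eps / 2) > 0" using L f that by (simp add: metric_signature_def)
    show ?thesis using eventually_rep_close[OF as(1) pos]
    proof eventually_elim
      case (elim i)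
      have "Met M (?b i) (?a i) \<le> eps / 2"
        using that elim as(2) by (intro FunI_close f t) (auto simp: nth_mem)
      then show ?case using that by simp
    qed
  qed
  then have "(?b, ?a) \<in> Rel" using closed by (simp add: Rel_iff)
  then have "cl ?a = cl ?b" using cl_eq_iff[OF closed(2,1)] by simp
  then show ?thesis
    by (simp add: reduced_power_def reduced_product_def cl_def o_def)
qed

lemma PredI_P:
  assumes p: "p \<in> PredSyms L" and as: "set as \<subseteq> Seqs" "length as = PredArity L p" and L: "metric_signature L"
  shows "PredI P p (map cl as) = real_limsup F (\<lambda>i. PredI M p (map (\<lambda>a. a i) as))"
proof -
  let ?a = "\<lambda>i. PredI M p (map (\<lambda>a. rep (cl a) i) as)" and ?b = "\<lambda>i. PredI M p (map (\<lambda>a. a i) as)"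
  note t = rep_tuples[OF as(1), unfolded as(2)]
  have "\<bar>?a i\<bar> \<le> PredBound L p" "\<bar>?b i\<bar> \<le> PredBound L p" for i
    using t M p by (auto simp: L_structure_def)
  then have bdd: "bounded (range ?a)" "bounded (range ?b)"
    unfolding bounded_range_iff_abs by blast+
  have "real_limsup F ?a = real_limsup F ?b"
  proof (rule real_limsup_close[OF F bdd])
    fix eps :: real assume "eps > 0"
    then have pos: "PredModulus L p eps > 0" using L p by (simp add: metric_signature_def)
    show "eventually (\<lambda>i. \<bar>?a i - ?b i\<bar> \<le> eps) F" using eventually_rep_close[OF as(1) pos]
    proof eventually_elim
      case (elim i)
      have "\<bar>?b i - ?a i\<bar> \<le> eps"
        using \<open>eps > 0\<close> elim as(2) by (intro PredI_close p t) (auto simp: nth_mem)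
      then show ?case by (simp add: abs_minus_commute)
    qed
  qed
  then show ?thesis
    by (simp add: reduced_power_def reduced_product_def o_def)
qed

end

section \<open>Values of Palyutin formulas in reduced powers\<close>

locale signature_power = structure_power +
  assumes L: "metric_signature L"
begin

lemma trm_seq:
  assumes "wf_trm L t" and "\<And>x. e x \<in> Seqs"
  shows "(\<lambda>i. trm_val M (\<lambda>x. e x i) t) \<in> Seqs"
  using assms by (auto intro!: trm_val_in_Dom[OF bounded_M])

lemma trm_val_P:
  assumes "\<And>x. e x \<in> Seqs"
  shows "wf_trm L t \<Longrightarrow> trm_val P (\<lambda>x. cl (e x)) t = cl (\<lambda>i. trm_val M (\<lambda>x. e x i) t)"
proof (induction t)
  case (App f ts)
  let ?as = "map (\<lambda>t i. trm_val M (\<lambda>x. e x i) t) ts"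
  have eq: "map (trm_val P (\<lambda>x. cl (e x))) ts = map cl ?as" using App by simp
  have "FunI P f (map cl ?as) = cl (\<lambda>i. FunI M f (map (\<lambda>a. a i) ?as))"
    using App.prems assms trm_seq by (intro FunI_P L) auto
  then show ?case unfolding trm_val.simps eq by (simp add: o_def)
qed simp

lemma bounded_P: "bounded_struct L P"
proof -
  have list: "As = map cl (map rep As) \<and> set (map rep As) \<subseteq> Seqs" if "set As \<subseteq> Dom P" for As
    using that cl_rep rep_in by (fastforce intro!: map_idI[symmetric])
  obtain a where "a \<in> Dom M" using M by (auto simp: L_structure_def)
  then have "Dom P \<noteq> {}" unfolding Dom_P by (auto intro!: image_eqI[of _ _ "\<lambda>_. a"])
  moreover have "\<bar>Met P A B\<bar> \<le> DistBound L" if AB: "A \<in> Dom P" "B \<in> Dom P" for A B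
  proof -
    obtain a b where eq: "A = cl a" "B = cl b" and ab: "a \<in> Seqs" "b \<in> Seqs"
      using AB unfolding Dom_P by blast
    then show ?thesis
      unfolding eq Met_P[OF ab] using Met_le by (intro real_limsup_abs_le F) simp
  qed
  moreover have "FunI P f As \<in> Dom P" if f: "f \<in> FunSyms L" and As: "As \<in> tuples (Dom P) (FunArity L f)" for f As
  proof -
    define as where "as = map rep As"
    have eq: "As = map cl as" "set as \<subseteq> Seqs" "length as = FunArity L f"
      using list[of As] As by (auto simp: as_def tuples_def)
    then have "map (\<lambda>a. a i) as \<in> tuples (Dom M) (FunArity L f)" for i by (auto simp: tuples_def)
    then have "(\<lambda>i. FunI M f (map (\<lambda>a. a i) as)) \<in> Seqs" using M f by (auto simp: L_structure_def)
    then show ?thesis using FunI_P[OF f eq(2,3) L] eq(1) by (auto simp: Dom_P)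
  qed
  moreover have "\<bar>PredI P p As\<bar> \<le> PredBound L p"
    if p: "p \<in> PredSyms L" and As: "As \<in> tuples (Dom P) (PredArity L p)" for p As
  proof -
    define as where "as = map rep As"
    have eq: "As = map cl as" "set as \<subseteq> Seqs" "length as = PredArity L p"
      using list[of As] As by (auto simp: as_def tuples_def)
    then have "map (\<lambda>a. a i) as \<in> tuples (Dom M) (PredArity L p)" for i by (auto simp: tuples_def)
    then show ?thesis
      unfolding eq(1) PredI_P[OF p eq(2,3) L] using M p
      by (intro real_limsup_abs_le F) (simp add: L_structure_def)
  qed
  ultimately show ?thesis unfolding bounded_struct_def by blast
qed

lemma bounded_fm_val:
  assumes "wf_fm L \<phi>" and "\<And>x. e x \<in> Seqs"
  shows "bounded (range (\<lambda>i. fm_val M (\<lambda>x. e x i) \<phi>))"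
  using fm_val_bounded[OF bounded_M assms(1)] assms(2)
  unfolding bounded_range_iff_abs by (fastforce simp: Pi_iff)

lemma cl_upd: "(\<lambda>y. cl (e y))(x := cl c) = (\<lambda>y. cl ((e(x := c)) y))"
  by (intro ext) simp

lemma upd_apply: "(\<lambda>y. (e(x := c)) y i) = (\<lambda>y. e y i)(x := c i)"
  by auto

lemma palyutin_family:
  assumes "palyutin L \<phi>" and "\<And>x. e x \<in> Seqs"
  shows "\<exists>B. bounded_family F (Dom M) (\<lambda>i a. fm_val M ((\<lambda>y. e y i)(x := a)) \<phi>) B"
proof -
  obtain B where B: "\<And>e. \<forall>x. e x \<in> Dom M \<Longrightarrow> \<bar>fm_val M e \<phi>\<bar> \<le> B"
    using fm_val_bounded[OF bounded_M palyutin_wf[OF assms(1)]] by blast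
  have "bounded_family F (Dom M) (\<lambda>i a. fm_val M ((\<lambda>y. e y i)(x := a)) \<phi>) B"
    using M F B assms(2) by unfold_locales (auto simp: L_structure_def)
  then show ?thesis ..
qed

text \<open>The Palyutin counterpart of Los's theorem, for an arbitrary proper filter. Each clause
  of the definition commutes with limits superior; in the quantifier clauses \<open>Dom_P\<close>
  replaces elements of the power by sequences, and clause (5) is
  \<open>max_INF_SUP_choice\<close>.\<close>

theorem palyutin_fm_val:
  "palyutin L \<phi> \<Longrightarrow> (\<And>x. e x \<in> Seqs) \<Longrightarrow>
    pval e \<phi> = real_limsup F (\<lambda>i. fm_val M (\<lambda>x. e x i) \<phi>)"
proof (induction arbitrary: e rule: palyutin.induct)
  case (dist s t)
  then show ?case by (simp add: trm_val_P Met_P trm_val_in_Dom[OF bounded_M])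
next
  case (pred p ts)
  let ?as = "map (\<lambda>t i. trm_val M (\<lambda>x. e x i) t) ts"
  have eq: "map (trm_val P (\<lambda>x. cl (e x))) ts = map cl ?as" using pred by (simp add: trm_val_P)
  have "PredI P p (map cl ?as) = real_limsup F (\<lambda>i. PredI M p (map (\<lambda>a. a i) ?as))"
    using pred trm_seq by (intro PredI_P L) auto
  then show ?case unfolding fm_val.simps eq by (simp add: o_def)
next
  case (conn \<phi> C)
  then show ?case
    by (simp add: real_limsup_mono_continuous[OF F bounded_fm_val] palyutin_wf)
next
  case (max \<phi> \<psi>)
  then show ?case by (simp add: real_limsup_max[OF F bounded_fm_val bounded_fm_val] palyutin_wf)
next
  case (inf \<phi> x)
  obtain B where "bounded_family F (Dom M) (\<lambda>i a. fm_val M ((\<lambda>y. e y i)(x := a)) \<phi>) B"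
    using palyutin_family[OF inf.hyps inf.prems] ..
  then interpret bounded_family F "Dom M" "\<lambda>i a. fm_val M ((\<lambda>y. e y i)(x := a)) \<phi>" B .
  have "pval e (InfF x \<phi>) =
      (INF c\<in>Seqs. fm_val P ((\<lambda>y. cl (e y))(x := cl c)) \<phi>)"
    by (simp add: Dom_P image_image)
  also have "\<dots> = (INF c\<in>Seqs. real_limsup F (\<lambda>i. fm_val M ((\<lambda>y. e y i)(x := c i)) \<phi>))"
    unfolding cl_upd using inf.IH inf.prems by (intro INF_cong) (auto simp flip: upd_apply)
  finally show ?case unfolding INF_choice by simp
next
  case (sup \<phi> x)
  obtain B where "bounded_family F (Dom M) (\<lambda>i a. fm_val M ((\<lambda>y. e y i)(x := a)) \<phi>) B"
    using palyutin_family[OF sup.hyps sup.prems] ..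
  then interpret bounded_family F "Dom M" "\<lambda>i a. fm_val M ((\<lambda>y. e y i)(x := a)) \<phi>" B .
  have "pval e (SupF x \<phi>) =
      (SUP c\<in>Seqs. fm_val P ((\<lambda>y. cl (e y))(x := cl c)) \<phi>)"
    by (simp add: Dom_P image_image)
  also have "\<dots> = (SUP c\<in>Seqs. real_limsup F (\<lambda>i. fm_val M ((\<lambda>y. e y i)(x := c i)) \<phi>))"
    unfolding cl_upd using sup.IH sup.prems by (intro SUP_cong) (auto simp flip: upd_apply)
  finally show ?case unfolding SUP_choice by simp
next
  case (pal \<phi> \<psi> D \<Delta> x)
  let ?w = "\<lambda>i a. fm_val M ((\<lambda>y. e y i)(x := a)) \<phi>" and ?v = "\<lambda>i a. fm_val M ((\<lambda>y. e y i)(x := a)) \<psi>"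
  obtain B B' where "bounded_family F (Dom M) ?w B" and v: "bounded_family F (Dom M) ?v B'"
    using palyutin_family[where e=e and x=x, OF pal.hyps(1) pal.prems]
      palyutin_family[where e=e and x=x, OF pal.hyps(2) pal.prems] by blast
  then interpret bounded_family F "Dom M" ?w B by simp
  have eq: "fm_val P ((\<lambda>y. cl (e y))(x := cl c)) \<phi> = real_limsup F (\<lambda>i. ?w i (c i))"
    "fm_val P ((\<lambda>y. cl (e y))(x := cl c)) \<psi> = real_limsup F (\<lambda>i. ?v i (c i))" if "c \<in> Seqs" for c
    unfolding cl_upd using pal.IH(1)[of "e(x := c)"] pal.IH(2)[of "e(x := c)"] pal.prems that
    by (auto simp flip: upd_apply)
  have "pval e (MaxF (InfF x \<phi>) (SupF x (MinF (Conn1 D \<phi>) (MinF (ConstF \<Delta>) \<psi>)))) =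
      max (INF c\<in>Seqs. fm_val P ((\<lambda>y. cl (e y))(x := cl c)) \<phi>)
        (SUP c\<in>Seqs. min (D (fm_val P ((\<lambda>y. cl (e y))(x := cl c)) \<phi>))
          (min \<Delta> (fm_val P ((\<lambda>y. cl (e y))(x := cl c)) \<psi>)))"
    by (simp add: Dom_P image_image)
  also have "\<dots> = max (INF c\<in>Seqs. real_limsup F (\<lambda>i. ?w i (c i)))
      (SUP c\<in>Seqs. min (D (real_limsup F (\<lambda>i. ?w i (c i)))) (min \<Delta> (real_limsup F (\<lambda>i. ?v i (c i)))))"
    by (simp add: eq cong: INF_cong_simp SUP_cong_simp)
  also have "\<dots> = real_limsup F (\<lambda>i. max (INF a\<in>Dom M. ?w i a)
      (SUP a\<in>Dom M. min (D (?w i a)) (min \<Delta> (?v i a))))"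
    using bounded_family.bound[OF v] pal.hyps by (intro max_INF_SUP_choice)
  finally show ?case by simp
qed

lemma palyutin_sentence_val:
  assumes "palyutin L \<phi>" and "fv_fm \<phi> = {}"
  shows "sentence_val P \<phi> = sentence_val M \<phi>"
proof -
  obtain a where "a \<in> Dom M" using M by (auto simp: L_structure_def)
  then have "\<And>i. a \<in> Dom M" by simp
  then have "fm_val P (\<lambda>x. cl (\<lambda>i. a)) \<phi> = real_limsup F (\<lambda>i. fm_val M (\<lambda>x. a) \<phi>)"
    by (intro palyutin_fm_val assms(1)) auto
  also have "\<dots> = fm_val M (\<lambda>x. a) \<phi>" by (rule real_limsup_const[OF F])
  finally show ?thesis unfolding sentence_val_eq[OF assms(2)] .
qed

end

text \<open>Each structure agrees with its own reduced power on Palyutin sentences, as seen on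
  constant sequences, so elementary equivalence of the powers passes down.\<close>

lemma elem_equiv_reduced_power_imp_palyutin_equiv:
  assumes L: "metric_signature L" "L_structure L M" "L_structure L N" and F: "F \<noteq> bot"
    and eq: "elem_equiv L (reduced_power M F) (reduced_power N F)"
  shows "palyutin_equiv L M N"
proof -
  interpret M: signature_power L M F by unfold_locales (use L F in auto)
  interpret N: signature_power L N F by unfold_locales (use L F in auto)
  show ?thesis
    using eq M.palyutin_sentence_val N.palyutin_sentence_val palyutin_wf
    unfolding palyutin_equiv_def elem_equiv_def by metis
qed

lemma isomorphic_imp_elem_equiv:
  assumes M: "bounded_struct L M" and iso: "isomorphic L M N"
  shows "elem_equiv L M N"
proof -
  obtain h where h: "bij_betw h (Dom M) (Dom N)"
    "\<And>a b. a \<in> Dom M \<Longrightarrow> b \<in> Dom M \<Longrightarrow> Met N (h a) (h b) = Met M a b"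
    "\<And>f as. f \<in> FunSyms L \<Longrightarrow> as \<in> tuples (Dom M) (FunArity L f) \<Longrightarrow>
      FunI N f (map h as) = h (FunI M f as)"
    "\<And>p as. p \<in> PredSyms L \<Longrightarrow> as \<in> tuples (Dom M) (PredArity L p) \<Longrightarrow>
      PredI N p (map h as) = PredI M p as"
    using iso unfolding isomorphic_def by blast
  obtain a where "a \<in> Dom M" using M by (auto simp: bounded_struct_def)
  then have "fm_val N (\<lambda>_. h a) \<phi> = fm_val M (\<lambda>_. a) \<phi>" if "wf_fm L \<phi>" for \<phi>
    using that by (intro isomorphic_fm_val[OF M h]) auto
  then show ?thesis unfolding elem_equiv_def using sentence_val_eq by metis
qed

lemma isomorphic_reduced_power_imp_palyutin_equiv:
  assumes "metric_signature L" "L_structure L M" "L_structure L N" and "F \<noteq> bot"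
    and "isomorphic L (reduced_power M F) (reduced_power N F)"
  shows "palyutin_equiv L M N"
proof -
  interpret signature_power L M F by unfold_locales (use assms in auto)
  show ?thesis
    using assms isomorphic_imp_elem_equiv[OF bounded_P] elem_equiv_reduced_power_imp_palyutin_equiv
    by blast
qed

section \<open>Cardinalities\<close>

lemma lepoll_iff_ordLeq: "A \<lesssim> B \<longleftrightarrow> (card_of A, card_of B) \<in> ordLeq"
  unfolding lepoll_def by (rule card_of_ordLeq)

lemma lepoll_UN:
  assumes "infinite C" and "I \<lesssim> C" and "\<And>i. i \<in> I \<Longrightarrow> A i \<lesssim> C"
  shows "(\<Union>i\<in>I. A i) \<lesssim> C"
  using assms card_of_UNION_ordLeq_infinite unfolding lepoll_iff_ordLeq by blast

lemma lepoll_Times: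
  assumes "infinite C" and "A \<lesssim> C" and "B \<lesssim> C"
  shows "A \<times> B \<lesssim> C"
proof -
  have "A \<times> B \<lesssim> C \<times> C" using assms by (intro times_lepoll_mono)
  also have "C \<times> C \<approx> C"
    using card_of_Times_same_infinite[OF assms(1)] by (simp add: eqpoll_iff_card_of_ordIso)
  finally show ?thesis .
qed

lemma lepoll_Un:
  assumes "infinite C" and "A \<lesssim> C" and "B \<lesssim> C"
  shows "A \<union> B \<lesssim> C"
proof -
  have "(\<Union>X\<in>{A, B}. X) \<lesssim> C"
  proof (rule lepoll_UN[OF assms(1)])
    show "{A, B} \<lesssim> C" using assms(1) by (intro lesspoll_imp_lepoll finite_lesspoll_infinite) auto
  qed (use assms in auto)
  then show ?thesis by simp
qed

lemma lepoll_insert: "infinite C \<Longrightarrow> A \<lesssim> C \<Longrightarrow> insert x A \<lesssim> C"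
  using lepoll_Un[of C "{x}" A] finite_lesspoll_infinite[of C "{x}"] lesspoll_imp_lepoll by fastforce

lemma lepoll_lists_infinite:
  assumes C: "infinite C" and A: "A \<lesssim> C"
  shows "lists A \<lesssim> C"
proof -
  have "{xs \<in> lists A. length xs = n} \<lesssim> C" for n
  proof (induction n)
    case 0
    have "finite {xs \<in> lists A. length xs = 0}" by (rule finite_subset[of _ "{[]}"]) auto
    then show ?case using C by (intro lesspoll_imp_lepoll finite_lesspoll_infinite)
  next
    case (Suc n)
    have "{xs \<in> lists A. length xs = Suc n} \<subseteq> (\<lambda>(x, xs). x # xs) ` (A \<times> {xs \<in> lists A. length xs = n})"
      by (fastforce simp: length_Suc_conv)
    then have "{xs \<in> lists A. length xs = Suc n} \<lesssim> A \<times> {xs \<in> lists A. length xs = n}"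
      by (rule subset_image_lepoll)
    also have "\<dots> \<lesssim> C" by (rule lepoll_Times[OF C A Suc])
    finally show ?case .
  qed
  then have "(\<Union>n. {xs \<in> lists A. length xs = n}) \<lesssim> C"
    using C infinite_le_lepoll by (intro lepoll_UN) auto
  moreover have "(\<Union>n. {xs \<in> lists A. length xs = n}) = lists A" by auto
  ultimately show ?thesis by simp
qed

lemma lepoll_finite_subsets:
  assumes "infinite C" and "A \<lesssim> C"
  shows "{X. finite X \<and> X \<subseteq> A} \<lesssim> C"
proof -
  have "{X. finite X \<and> X \<subseteq> A} \<subseteq> set ` lists A"
  proof
    fix X assume "X \<in> {X. finite X \<and> X \<subseteq> A}"
    then have "finite X" "X \<subseteq> A" by auto
    then obtain xs where "set xs = X" using finite_list by auto
    moreover from this have "xs \<in> lists A" using \<open>X \<subseteq> A\<close> by auto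
    ultimately show "X \<in> set ` lists A" by blast
  qed
  then have "{X. finite X \<and> X \<subseteq> A} \<lesssim> lists A" by (rule subset_image_lepoll)
  then show ?thesis using lepoll_lists_infinite[OF assms] by (rule lepoll_trans)
qed

lemma lepoll_sets:
  assumes "(UNIV :: 'u set) \<lesssim> (UNIV :: 't set)"
  shows "(UNIV :: 'u set set) \<lesssim> (UNIV :: 't set set)"
proof -
  obtain e :: "'u \<Rightarrow> 't" where "inj e" using assms by (auto simp: lepoll_def)
  then have "inj ((`) e)" by (simp add: inj_image_eq_iff inj_on_def)
  then show ?thesis unfolding lepoll_def by blast
qed

text \<open>Currying: a family of sets indexed by \<open>'u\<close> is a subset of a product of
  \<open>'u\<close> with \<open>'t\<close>.\<close>

lemma lepoll_set_functions:
  assumes inf: "infinite (UNIV :: 't set)" and le: "(UNIV :: 'u set) \<lesssim> (UNIV :: 't set)"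
  shows "(UNIV :: ('u \<Rightarrow> 't set) set) \<lesssim> (UNIV :: 't set set)"
proof -
  have "(UNIV :: ('u \<Rightarrow> 't set) set) \<lesssim> (UNIV :: ('u \<times> 't) set set)"
    unfolding lepoll_def
    by (intro exI[of _ "\<lambda>g. {(u, t). t \<in> g u}"]) (auto simp: inj_on_def fun_eq_iff set_eq_iff)
  also have "\<dots> \<lesssim> (UNIV :: 't set set)"
    using lepoll_Times[OF inf le lepoll_refl] by (intro lepoll_sets) simp
  finally show ?thesis .
qed

lemma lepoll_functions:
  assumes inf: "infinite (UNIV :: 't set)" and u: "(UNIV :: 'u set) \<lesssim> (UNIV :: 't set)"
    and v: "(UNIV :: 'v set) \<lesssim> (UNIV :: 't set)"
  shows "(UNIV :: ('u \<Rightarrow> 'v) set) \<lesssim> (UNIV :: 't set set)"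
proof -
  obtain e :: "'v \<Rightarrow> 't" where e: "inj e" using v by (auto simp: lepoll_def)
  have "(UNIV :: ('u \<Rightarrow> 'v) set) \<lesssim> (UNIV :: ('u \<Rightarrow> 't set) set)"
    unfolding lepoll_def
    by (intro exI[of _ "\<lambda>g u. {e (g u)}"]) (use e in \<open>auto simp: inj_on_def fun_eq_iff\<close>)
  also have "\<dots> \<lesssim> (UNIV :: 't set set)" by (rule lepoll_set_functions[OF inf u])
  finally show ?thesis .
qed

text \<open>The order is that of the cardinal of the type, all of whose proper initial segments are
  smaller. In a recursion along it the objects already treated are always fewer than those
  available.\<close>

lemma small_wellorder:
  "\<exists>R :: ('z \<times> 'z) set. wf R \<and> trans R \<and> total R \<and> (\<forall>x. {y. (y, x) \<in> R} \<prec> (UNIV :: 'z set))"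
proof -
  define r where "r = card_of (UNIV :: 'z set)"
  have r: "card_order_on UNIV r" unfolding r_def by (rule card_of_card_order_on)
  then have wo: "well_order_on UNIV r" by (simp add: card_order_on_def)
  have "wf (r - Id)" using wo by (simp add: well_order_on_def)
  moreover have "trans (r - Id)"
    using wo by (intro trans_diff_Id) (auto simp: order_on_defs)
  moreover have "total (r - Id)" using wo by (auto simp: order_on_defs total_on_def)
  moreover have "{y. (y, x) \<in> r - Id} \<prec> (UNIV :: 'z set)" for x
  proof -
    have "Card_order r" "x \<in> Field r"
      using card_of_Card_order by (auto simp only: r_def Field_card_of)
    then have "(card_of (underS r x), card_of (UNIV :: 'z set)) \<in> ordLess"
      using card_of_underS r_def by metis
    moreover have "underS r x = {y. (y, x) \<in> r - Id}" by (auto simp: underS_def)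
    ultimately have "\<not> (UNIV :: 'z set) \<lesssim> {y. (y, x) \<in> r - Id}"
      by (metis card_of_Well_order lepoll_iff_ordLeq not_ordLeq_iff_ordLess)
    then show ?thesis
      by (metis eqpoll_imp_lepoll eqpoll_sym lepoll_iff_leqpoll subset_UNIV subset_imp_lepoll)
  qed
  ultimately show ?thesis by blast
qed

lemma lesspoll_Plus:
  assumes "infinite C" and "A \<prec> C" and "B \<prec> C"
  shows "A <+> B \<prec> C"
proof -
  have less: "X \<prec> Y \<longleftrightarrow> (card_of X, card_of Y) \<in> ordLess" for X :: "'x set" and Y :: "'y set"
    unfolding lesspoll_def lepoll_iff_ordLeq eqpoll_iff_card_of_ordIso
    using ordLeq_iff_ordLess_or_ordIso not_ordLess_ordIso by blast
  show ?thesis using assms card_of_Plus_ordLess_infinite unfolding less by blast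
qed

section \<open>Independent families of functions\<close>

text \<open>
  An index \<open>i\<close> codes a map \<open>s\<close> from \<open>'t\<close> to \<open>'t set\<close>, whose range is used to separate the
  members of a small family \<open>J\<close> of subsets of \<open>'t set\<close>, together with a partial function \<open>(q, v)\<close>
  on the traces of these subsets on the range of \<open>s\<close>.
\<close>

lemma independent_functions_exist:
  assumes inf: "infinite (UNIV :: 't set)"
  shows "\<exists>f :: 't set set \<Rightarrow> 't set \<Rightarrow> 't.
    \<forall>J p. J \<lesssim> (UNIV :: 't set) \<longrightarrow> (\<exists>i. \<forall>j\<in>J. f j i = p j)"
proof -
  let ?C = "UNIV :: (('t \<Rightarrow> 't set) \<times> ('t \<Rightarrow> 't set) \<times> ('t \<Rightarrow> 't)) set"
  have le: "(UNIV :: ('t \<Rightarrow> 't set) set) \<lesssim> (UNIV :: 't set set)"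
    "(UNIV :: ('t \<Rightarrow> 't) set) \<lesssim> (UNIV :: 't set set)"
    using lepoll_set_functions[OF inf] lepoll_functions[OF inf] by auto
  have inf2: "infinite (UNIV :: 't set set)" using inf by (simp add: Finite_Set.finite_set)
  have "?C \<lesssim> (UNIV :: 't set set)"
    using lepoll_Times[OF inf2 le(1) lepoll_Times[OF inf2 le]] by simp
  then obtain dec :: "'t set \<Rightarrow> ('t \<Rightarrow> 't set) \<times> ('t \<Rightarrow> 't set) \<times> ('t \<Rightarrow> 't)" where dec: "surj dec"
    unfolding lepoll_iff by (metis UNIV_I subsetI subset_antisym)
  \<comment> \<open>The choice looks for a \<open>t\<close> whose coded trace is that of
    \<open>j\<close>; \<open>v\<close> then returns the coded value.\<close>
  define f where "f j i = (case dec i of (s, q, v) \<Rightarrow> v (SOME t. q t = {t'. s t' \<in> j}))"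
    for j :: "'t set set" and i
  have "\<exists>i. \<forall>j\<in>J. f j i = p j" if J: "J \<lesssim> (UNIV :: 't set)" for J p
  proof (cases "J = {}")
    case False
    then obtain e :: "'t \<Rightarrow> 't set set" where e: "range e = J"
      using J by (metis lepoll_def inj_on_iff_surj)
    obtain pr :: "'t \<times> 't \<Rightarrow> 't" where pr: "inj pr"
      using lepoll_Times[OF inf lepoll_refl lepoll_refl] by (auto simp: lepoll_def)
    \<comment> \<open>The argument codes a pair, and \<open>s\<close> picks a point at which the two
      sets differ. Hence the traces on the range of \<open>s\<close> separate the members of
      \<open>J\<close>.\<close>
    define s where "s x = (case inv pr x of (t, u) \<Rightarrow> SOME a. (a \<in> e t) \<noteq> (a \<in> e u))" for x
    define q where "q t = {t'. s t' \<in> e t}" for t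
    have sep: "e t = e u" if "q t = q u" for t u
    proof (rule ccontr)
      assume "e t \<noteq> e u"
      then have "\<exists>a. (a \<in> e t) \<noteq> (a \<in> e u)" by blast
      then have "(s (pr (t, u)) \<in> e t) \<noteq> (s (pr (t, u)) \<in> e u)"
        unfolding s_def inv_f_f[OF pr] prod.case by (rule someI_ex)
      with that show False by (auto simp: q_def)
    qed
    obtain i where i: "dec i = (s, q, \<lambda>t. p (e t))" using dec by (metis surj_def)
    have "f j i = p j" if j: "j \<in> J" for j
    proof -
      obtain t where t: "j = e t" using e j by auto
      \<comment> \<open>The chosen element may differ from \<open>t\<close>, but by
        \<open>sep\<close> it names the same set and so yields the same value of
        \<open>p\<close>.\<close>
      have "q (SOME t'. q t' = {t'. s t' \<in> j}) = {t'. s t' \<in> j}"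
        by (rule someI[of _ t]) (simp add: t q_def)
      then have "e (SOME t'. q t' = {t'. s t' \<in> j}) = e t"
        by (intro sep) (simp add: t q_def)
      then show ?thesis by (simp add: f_def i t)
    qed
    then show ?thesis by blast
  qed simp
  then show ?thesis by blast
qed

locale independent_functions =
  fixes f :: "'z \<Rightarrow> 'i \<Rightarrow> 't"
  assumes inf: "infinite (UNIV :: 't set)"
    and independent: "A \<lesssim> (UNIV :: 't set) \<Longrightarrow> \<exists>i. \<forall>j\<in>A. f j i = q j"
begin

text \<open>Independence relative to \<open>H\<close>, in the spirit of families independent modulo
  a filter: \<open>H\<close> meets every prescription of values for at most \<open>'t\<close> many
  functions of \<open>J\<close>. In the recursion \<open>J\<close> collects the functions not yet
  spent.\<close>

definition generic :: "'z set \<Rightarrow> 'i set \<Rightarrow> bool" where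
  "generic J H \<longleftrightarrow> (\<forall>A q. A \<subseteq> J \<and> A \<lesssim> (UNIV :: 't set) \<longrightarrow> (\<exists>i\<in>H. \<forall>j\<in>A. f j i = q j))"

lemma generic_nonempty:
  assumes "generic J H"
  shows "H \<noteq> {}"
  using assms spec[of _ "{} :: 'z set"] unfolding generic_def by fastforce

lemma generic_mono: "generic J H \<Longrightarrow> J' \<subseteq> J \<Longrightarrow> H \<subseteq> H' \<Longrightarrow> generic J' H'"
  unfolding generic_def by (meson subset_eq order_trans)

text \<open>
  Otherwise one could find disjointly supported failures \<open>F t\<close>, one for each value \<open>t\<close>, and
  prescribe \<open>f j = t\<close> for the function \<open>j\<close> of \<open>F t\<close>: at a point realising all this,
  the failure belonging to the value of \<open>g\<close> there is refuted.
\<close>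

lemma generic_avoid:
  assumes J: "generic J H"
  shows "\<exists>W. W \<lesssim> (UNIV :: 't set) \<and> (\<forall>j\<in>J - W. generic (J - W - {j}) (H \<inter> {i. f j i = g i}))"
proof (rule ccontr)
  define supp :: "'z \<times> 'z set \<times> ('z \<Rightarrow> 't) \<Rightarrow> 'z set" where "supp = (\<lambda>(j, A, q). insert j A)"
  \<comment> \<open>A failure outside \<open>W\<close>: on \<open>H\<close>, the equation
    \<open>f j i = g i\<close> excludes the prescription \<open>q\<close> on
    \<open>A\<close>.\<close>
  define bad where "bad W = (\<lambda>(j, A, q). j \<in> J - W \<and> A \<subseteq> J - W - {j} \<and> A \<lesssim> (UNIV :: 't set) \<and>
    (\<forall>i\<in>H. f j i = g i \<longrightarrow> \<not> (\<forall>k\<in>A. f k i = q k)))" for W :: "'z set"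
  assume neg: "\<not> ?thesis"
  have ex: "\<exists>r. bad W r" if W: "W \<lesssim> (UNIV :: 't set)" for W
  proof -
    obtain j where j: "j \<in> J - W" "\<not> generic (J - W - {j}) (H \<inter> {i. f j i = g i})"
      using neg W by blast
    then obtain A q where "A \<subseteq> J - W - {j}" "A \<lesssim> (UNIV :: 't set)"
      "\<not> (\<exists>i\<in>H \<inter> {i. f j i = g i}. \<forall>k\<in>A. f k i = q k)" unfolding generic_def by blast
    then have "bad W (j, A, q)" using j by (auto simp: bad_def)
    then show ?thesis by blast
  qed
  from small_wellorder obtain R :: "('t \<times> 't) set"
    where R: "wf R" "total R"
    by (elim exE conjE) (rule that; assumption)
  have supp_le: "supp r \<lesssim> (UNIV :: 't set)" if "bad W r" for W r
    using that by (auto simp: bad_def supp_def intro: lepoll_insert[OF inf])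
  have supp_J: "supp r \<subseteq> J - W" if "bad W r" for W r
    using that by (cases r) (auto simp: bad_def supp_def)
  \<comment> \<open>The supports chosen earlier form a union of at most \<open>'t\<close> many sets
    of at most that size, so this union is itself small enough to be avoided by the next
    failure.\<close>
  have "\<exists>F. \<forall>t. bad (\<Union>s\<in>{s. (s, t) \<in> R}. supp (F s)) (F t)"
  proof (rule dependent_wf_choice[OF R(1)])
    fix F G :: "'t \<Rightarrow> 'z \<times> 'z set \<times> ('z \<Rightarrow> 't)" and t r
    assume "\<And>s. (s, t) \<in> R \<Longrightarrow> F s = G s"
    then show "bad (\<Union>s\<in>{s. (s, t) \<in> R}. supp (F s)) r = bad (\<Union>s\<in>{s. (s, t) \<in> R}. supp (G s)) r"
      by simp
  next
    fix t and F :: "'t \<Rightarrow> 'z \<times> 'z set \<times> ('z \<Rightarrow> 't)"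
    assume *: "\<And>s. (s, t) \<in> R \<Longrightarrow> bad (\<Union>s'\<in>{s'. (s', s) \<in> R}. supp (F s')) (F s)"
    have "(\<Union>s\<in>{s. (s, t) \<in> R}. supp (F s)) \<lesssim> (UNIV :: 't set)"
    proof (rule lepoll_UN[OF inf])
      show "{s. (s, t) \<in> R} \<lesssim> (UNIV :: 't set)" by (rule subset_imp_lepoll) simp
      show "supp (F s) \<lesssim> (UNIV :: 't set)" if "s \<in> {s. (s, t) \<in> R}" for s
        using * that by (intro supp_le) simp
    qed
    then show "\<exists>r. bad (\<Union>s\<in>{s. (s, t) \<in> R}. supp (F s)) r" by (rule ex)
  qed
  then obtain F where F: "\<And>t. bad (\<Union>s\<in>{s. (s, t) \<in> R}. supp (F s)) (F t)" by blast
  have disj: "supp (F s) \<inter> supp (F t) = {}" if "(s, t) \<in> R" for s t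
  proof -
    have "supp (F t) \<subseteq> J - (\<Union>s\<in>{s. (s, t) \<in> R}. supp (F s))" using F by (rule supp_J)
    then show ?thesis using that by blast
  qed
  have unique: "s = t" if "k \<in> supp (F s)" "k \<in> supp (F t)" for s t k
    using that disj[of s t] disj[of t s] R(2) unfolding total_on_def by blast
  define A where "A = (\<Union>t. supp (F t))"
  have AJ: "A \<subseteq> J" using supp_J[OF F] unfolding A_def by blast
  have A_le: "A \<lesssim> (UNIV :: 't set)"
    unfolding A_def by (rule lepoll_UN[OF inf lepoll_refl]) (rule supp_le[OF F])
  \<comment> \<open>Disjointness of the supports makes the \<open>THE\<close> unambiguous on
    \<open>A\<close>, so the prescriptions of all failures can be imposed at once.\<close>
  define q where "q k = (let t = THE t. k \<in> supp (F t) in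
    if k = fst (F t) then t else snd (snd (F t)) k)" for k
  obtain i where i: "i \<in> H" "\<And>k. k \<in> A \<Longrightarrow> f k i = q k"
    using J AJ A_le unfolding generic_def by meson
  obtain j A' q' where Ft: "F (g i) = (j, A', q')" by (cases "F (g i)") auto
  have bad: "bad (\<Union>s\<in>{s. (s, g i) \<in> R}. supp (F s)) (j, A', q')" using F[of "g i"] Ft by simp
  have the: "(THE t. k \<in> supp (F t)) = g i" if "k \<in> insert j A'" for k
    using that unique by (intro the_equality) (auto simp: Ft supp_def)
  have "k \<in> A" if "k \<in> insert j A'" for k
    using that Ft unfolding A_def supp_def by (intro UN_I[of "g i"]) auto
  then have val: "f k i = (if k = j then g i else q' k)" if "k \<in> insert j A'" for k
    using that i(2)[of k] the[of k] Ft by (auto simp: q_def Let_def)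
  have "f j i = g i" using val[of j] by simp
  moreover have "\<forall>k\<in>A'. f k i = q' k" using val bad by (auto simp: bad_def)
  ultimately show False using bad i(1) by (auto simp: bad_def)
qed

text \<open>Finite intersections form a base of the filter to be generated, so genericity is asked
  of them.\<close>

definition consistent :: "'z set \<Rightarrow> 'i set set \<Rightarrow> bool" where
  "consistent J \<E> \<longleftrightarrow> (\<forall>E. finite E \<and> E \<subseteq> \<E> \<longrightarrow> generic J (\<Inter>E))"

end

text \<open>
  In the application the points are pairs of elements of the two structures, and a demand
  prescribes one component of such a pair.
\<close>

locale extension_system = independent_functions f
  for f :: "'t set set \<Rightarrow> 't set \<Rightarrow> 't" +
  fixes X :: "'p set" and conds :: "nat \<Rightarrow> ('p list \<Rightarrow> bool) set" and demands :: "'p set set"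
  assumes X_le: "(UNIV :: 'p set) \<lesssim> (UNIV :: 't set)"
    and base: "Q \<in> conds 0 \<Longrightarrow> Q []"
    and rename: "Q \<in> conds n \<Longrightarrow> (\<And>k. k < n \<Longrightarrow> \<rho> k < m) \<Longrightarrow>
      \<exists>Q'\<in>conds m. \<forall>ps. length ps = m \<longrightarrow> Q' ps = Q (map (\<lambda>k. ps ! \<rho> k) [0..<n])"
    and extend: "finite \<Q> \<Longrightarrow> \<Q> \<subseteq> conds (Suc n) \<Longrightarrow>
      \<exists>\<Q>'. finite \<Q>' \<and> \<Q>' \<subseteq> conds n \<and> (\<forall>ps\<in>lists X. length ps = n \<longrightarrow> (\<forall>Q\<in>\<Q>'. Q ps) \<longrightarrow>
        (\<forall>d\<in>demands. \<exists>x\<in>d. \<forall>Q\<in>\<Q>. Q (ps @ [x])))"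
    and demands: "d \<in> demands \<Longrightarrow> d \<subseteq> X" "d \<in> demands \<Longrightarrow> d \<noteq> {}"
begin

text \<open>A test keeps the condition and the names of its points rather than the resulting event:
  events become known only when the points are chosen, while the tests can be counted
  beforehand.\<close>

definition tests :: "'t set set set \<Rightarrow> (('p list \<Rightarrow> bool) \<times> 't set set list) set" where
  "tests B = {(Q, zs). zs \<in> lists B \<and> Q \<in> conds (length zs)}"

definition event :: "('t set set \<Rightarrow> 't set \<Rightarrow> 'p) \<Rightarrow> ('p list \<Rightarrow> bool) \<times> 't set set list \<Rightarrow> 't set set" where
  "event p = (\<lambda>(Q, zs). {i. Q (map (\<lambda>z. p z i) zs)})"

lemma event_cong: "\<T> \<subseteq> tests B \<Longrightarrow> (\<And>z. z \<in> B \<Longrightarrow> p z = p' z) \<Longrightarrow> event p ` \<T> = event p' ` \<T>"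
proof (rule image_cong)
  fix t assume "t \<in> \<T>" "\<T> \<subseteq> tests B" and eq: "\<And>z. z \<in> B \<Longrightarrow> p z = p' z"
  then have "t \<in> tests B" by blast
  then obtain Q zs where t: "t = (Q, zs)" "zs \<in> lists B" unfolding tests_def by blast
  then have "p z = p' z" if "z \<in> set zs" for z using that eq by auto
  then show "event p t = event p' t" by (simp add: t event_def cong: map_cong)
qed simp

text \<open>Lists of points fit into \<open>'t\<close>, so predicates on them are at most as many as
  the elements of \<open>'t set\<close>.\<close>

lemma tests_lepoll:
  assumes "infinite K" and "(UNIV :: 't set set) \<lesssim> K" and "B \<lesssim> K"
  shows "tests B \<lesssim> K"
proof -
  have "(UNIV :: 'p list set) \<lesssim> (UNIV :: 't set)"
    using lepoll_lists_infinite[OF inf X_le] by simp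
  then have "(UNIV :: 'p list set set) \<lesssim> K" using lepoll_sets assms(2) lepoll_trans by blast
  moreover have "(UNIV :: ('p list \<Rightarrow> bool) set) \<lesssim> (UNIV :: 'p list set set)"
    unfolding lepoll_def by (intro exI[of _ Collect]) (auto simp: inj_on_def)
  ultimately have "(UNIV :: ('p list \<Rightarrow> bool) set) \<lesssim> K" using lepoll_trans by blast
  then have "(UNIV :: ('p list \<Rightarrow> bool) set) \<times> lists B \<lesssim> K"
    using assms by (intro lepoll_Times lepoll_lists_infinite)
  moreover have "tests B \<subseteq> UNIV \<times> lists B" by (auto simp: tests_def)
  ultimately show ?thesis using subset_imp_lepoll lepoll_trans by blast
qed

text \<open>Finitely many tests mention finitely many points. Renaming puts all of them on the
  common list \<open>ys @ [z]\<close> with the new point last, which is the shape that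
  \<open>extend\<close> handles.\<close>

lemma combine_tests:
  assumes fin: "finite \<T>" and \<T>: "\<T> \<subseteq> tests (insert z B)" and "z \<notin> B"
    and p: "\<And>y i. y \<in> B \<Longrightarrow> p y i \<in> X"
  shows "\<exists>\<T>'. finite \<T>' \<and> \<T>' \<subseteq> tests B \<and> (\<forall>i\<in>\<Inter>(event p ` \<T>'). \<forall>d\<in>demands. \<exists>x\<in>d.
    \<forall>(Q, zs)\<in>\<T>. Q (map ((\<lambda>y. p y i)(z := x)) zs))"
proof -
  define B0 where "B0 = (\<Union>t\<in>\<T>. set (snd t)) - {z}"
  have "finite B0" using fin by (auto simp: B0_def)
  then obtain ys where ys: "set ys = B0" using finite_list by blast
  have B0: "B0 \<subseteq> B" using \<T> by (fastforce simp: B0_def tests_def)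
  have ysB: "ys \<in> lists B" using ys B0 by auto
  have "\<exists>Q'\<in>conds (Suc (length ys)). \<forall>h. Q' (map h (ys @ [z])) = Q (map h zs)" if t: "(Q, zs) \<in> \<T>" for Q zs
  proof -
    have sub: "set zs \<subseteq> set (ys @ [z])" using t by (force simp: ys B0_def)
    have "\<exists>t<Suc (length ys). (ys @ [z]) ! t = zs ! k" if "k < length zs" for k
    proof -
      have "zs ! k \<in> set (ys @ [z])" using sub nth_mem[OF that] by blast
      then show ?thesis by (metis in_set_conv_nth length_append_singleton)
    qed
    then obtain \<rho> where \<rho>: "\<And>k. k < length zs \<Longrightarrow> \<rho> k < Suc (length ys) \<and> (ys @ [z]) ! \<rho> k = zs ! k"
      by metis
    have "Q \<in> conds (length zs)" using t \<T> by (auto simp: tests_def)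
    then obtain Q' where Q': "Q' \<in> conds (Suc (length ys))"
      "\<And>ps. length ps = Suc (length ys) \<Longrightarrow> Q' ps = Q (map (\<lambda>k. ps ! \<rho> k) [0..<length zs])"
      using rename[of Q "length zs" \<rho> "Suc (length ys)"] \<rho> by blast
    have "Q' (map h (ys @ [z])) = Q (map h zs)" for h
    proof -
      have "map (\<lambda>k. map h (ys @ [z]) ! \<rho> k) [0..<length zs] = map h zs"
        using \<rho> by (intro nth_equalityI) (auto simp del: map_append)
      then show ?thesis using Q'(2)[of "map h (ys @ [z])"] by simp
    qed
    with Q'(1) show ?thesis by blast
  qed
  then have "\<forall>t\<in>\<T>. \<exists>Q'. Q' \<in> conds (Suc (length ys)) \<and> (\<forall>h. Q' (map h (ys @ [z])) = fst t (map h (snd t)))"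
    by (metis prod.collapse)
  then obtain Qf where Qf: "\<And>t. t \<in> \<T> \<Longrightarrow> Qf t \<in> conds (Suc (length ys))"
    "\<And>t h. t \<in> \<T> \<Longrightarrow> Qf t (map h (ys @ [z])) = fst t (map h (snd t))" by metis
  have "finite (Qf ` \<T>)" "Qf ` \<T> \<subseteq> conds (Suc (length ys))" using fin Qf(1) by auto
  from extend[OF this] obtain \<Q> where \<Q>: "finite \<Q>" "\<Q> \<subseteq> conds (length ys)"
    "\<forall>ps\<in>lists X. length ps = length ys \<longrightarrow> (\<forall>Q\<in>\<Q>. Q ps) \<longrightarrow>
      (\<forall>d\<in>demands. \<exists>x\<in>d. \<forall>Q\<in>Qf ` \<T>. Q (ps @ [x]))"
    by (elim exE conjE) (rule that; assumption)
  show ?thesis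
  proof (intro exI[of _ "(\<lambda>Q. (Q, ys)) ` \<Q>"] conjI ballI)
    show "finite ((\<lambda>Q. (Q, ys)) ` \<Q>)" using \<Q>(1) by simp
    show "(\<lambda>Q. (Q, ys)) ` \<Q> \<subseteq> tests B" using \<Q>(2) ysB by (auto simp: tests_def)
    fix i d assume i: "i \<in> \<Inter>(event p ` (\<lambda>Q. (Q, ys)) ` \<Q>)" and d: "d \<in> demands"
    have "map (\<lambda>y. p y i) ys \<in> lists X" using p ysB by auto
    moreover have "\<forall>Q\<in>\<Q>. Q (map (\<lambda>y. p y i) ys)" using i by (auto simp: event_def)
    ultimately have "\<exists>x\<in>d. \<forall>Q\<in>Qf ` \<T>. Q (map (\<lambda>y. p y i) ys @ [x])"
      using bspec[OF \<Q>(3), of "map (\<lambda>y. p y i) ys"] d by simp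
    then obtain x where x: "x \<in> d" "\<And>t. t \<in> \<T> \<Longrightarrow> Qf t (map (\<lambda>y. p y i) ys @ [x])"
      by auto
    \<comment> \<open>Hence the update at \<open>z\<close> affects the last entry only.\<close>
    have "z \<notin> set ys" using ys B0 \<open>z \<notin> B\<close> by blast
    then have eq: "map ((\<lambda>y. p y i)(z := x)) (ys @ [z]) = map (\<lambda>y. p y i) ys @ [x]" by auto
    have "fst t (map ((\<lambda>y. p y i)(z := x)) (snd t))" if "t \<in> \<T>" for t
      using Qf(2)[OF that, of "(\<lambda>y. p y i)(z := x)"] x(2)[OF that] unfolding eq by simp
    then have "\<forall>(Q, zs)\<in>\<T>. Q (map ((\<lambda>y. p y i)(z := x)) zs)" by fastforce
    with x(1) show "\<exists>x\<in>d. \<forall>(Q, zs)\<in>\<T>. Q (map ((\<lambda>y. p y i)(z := x)) zs)" by blast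
  qed
qed

text \<open>For every finite set \<open>\<T>\<close> of new tests, \<open>g \<T>\<close> codes a
  partner that meets them wherever possible. By \<open>generic_avoid\<close>, outside a small
  exceptional set, any \<open>f j\<close> may be made equal to \<open>g \<T>\<close> without losing
  genericity. There are at most \<open>K\<close> many pairs of finite sets of tests, so one
  \<open>j\<close> avoids all the exceptional sets, and decoding this \<open>f j\<close> serves all
  the pairs at once.\<close>

lemma extension_step:
  fixes K :: "'k set"
  assumes cons: "consistent J (event p ` tests B)" and z: "z \<notin> B" and BK: "B \<lesssim> K"
    and TK: "(UNIV :: 't set set) \<lesssim> K" and JK: "\<not> J \<lesssim> K"
    and p: "\<And>y i. y \<in> B \<Longrightarrow> p y i \<in> X" and D: "\<And>i. D i \<in> demands"
  shows "\<exists>pz S. (\<forall>i. pz i \<in> D i) \<and> S \<lesssim> K \<and> consistent (J - S) (event (p(z := pz)) ` tests (insert z B))"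
proof -
  have "infinite (UNIV :: 't set set)" using inf by (simp add: Finite_Set.finite_set)
  then have K: "infinite K" using TK by (meson infinite_le_lepoll lepoll_trans)
  have "(UNIV :: 't set) \<lesssim> (UNIV :: 't set set)" using lepoll_Pow_self[of "UNIV :: 't set"] by simp
  then have T1K: "(UNIV :: 't set) \<lesssim> K" using TK lepoll_trans by blast
  obtain e :: "'p \<Rightarrow> 't" where e: "inj e" using X_le by (auto simp: lepoll_def)
  define good where "good \<T> i x \<longleftrightarrow> x \<in> D i \<and> (\<forall>(Q, zs)\<in>\<T>. Q (map ((\<lambda>y. p y i)(z := x)) zs))" for \<T> i x
  define g where "g \<T> i = e (SOME x. good \<T> i x)" for \<T> i
  define fin where "fin B' = {\<T>. finite \<T> \<and> \<T> \<subseteq> tests B'}" for B'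
  have gen: "generic J (\<Inter>(event p ` \<T>'))" if "\<T>' \<in> fin B" for \<T>'
    using cons that unfolding consistent_def fin_def by blast
  define av where "av \<T>' \<T> W \<longleftrightarrow> W \<lesssim> (UNIV :: 't set) \<and>
      (\<forall>j\<in>J - W. generic (J - W - {j}) (\<Inter>(event p ` \<T>') \<inter> {i. f j i = g \<T> i}))" for \<T>' \<T> W
  define w where "w \<T>' \<T> = (SOME W. av \<T>' \<T> W)" for \<T>' \<T>
  have "av \<T>' \<T> (w \<T>' \<T>)" if "\<T>' \<in> fin B" for \<T>' \<T>
    unfolding w_def by (rule someI_ex) (use gen[OF that] in \<open>unfold av_def, rule generic_avoid\<close>)
  then have w: "\<And>\<T>' \<T>. \<T>' \<in> fin B \<Longrightarrow> w \<T>' \<T> \<lesssim> (UNIV :: 't set)"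
    "\<And>\<T>' \<T> j. \<T>' \<in> fin B \<Longrightarrow> j \<in> J - w \<T>' \<T> \<Longrightarrow>
      generic (J - w \<T>' \<T> - {j}) (\<Inter>(event p ` \<T>') \<inter> {i. f j i = g \<T> i})"
    unfolding av_def by blast+
  define W where "W = (\<Union>(\<T>', \<T>)\<in>fin B \<times> fin (insert z B). w \<T>' \<T>)"
  have finK: "fin B' \<lesssim> K" if "B' \<lesssim> K" for B'
    unfolding fin_def by (rule lepoll_finite_subsets[OF K tests_lepoll[OF K TK that]])
  have WK: "W \<lesssim> K"
    unfolding W_def
  proof (rule lepoll_UN[OF K])
    show "fin B \<times> fin (insert z B) \<lesssim> K"
      by (intro lepoll_Times K finK BK lepoll_insert)
    show "(case t of (\<T>', \<T>) \<Rightarrow> w \<T>' \<T>) \<lesssim> K" if "t \<in> fin B \<times> fin (insert z B)" for t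
      using that w(1) T1K by (auto intro: lepoll_trans)
  qed
  have "\<not> J \<subseteq> W" using JK WK lepoll_trans[OF subset_imp_lepoll WK] by blast
  then obtain j where j: "j \<in> J" "j \<notin> W" by blast
  \<comment> \<open>Where \<open>f j i\<close> codes nothing in the demand, an arbitrary element is
    taken, so the demand is met at every index. Where the tests of \<open>\<T>'\<close> hold and
    \<open>f j i = g \<T> i\<close>, the decoded value is already good.\<close>
  define pz where "pz i = (if inv e (f j i) \<in> D i then inv e (f j i) else SOME x. x \<in> D i)" for i
  have pz: "pz i \<in> D i" for i
    using demands(2)[OF D[of i]] by (auto simp: pz_def some_in_eq)
  have "generic (J - insert j W) (\<Inter>E)" if E: "finite E" "E \<subseteq> event (p(z := pz)) ` tests (insert z B)" for E
  proof -
    obtain \<T> where \<T>: "\<T> \<subseteq> tests (insert z B)" "finite \<T>" "E = event (p(z := pz)) ` \<T>"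
      using finite_subset_image[OF E] by blast
    have "\<exists>\<T>'. finite \<T>' \<and> \<T>' \<subseteq> tests B \<and> (\<forall>i\<in>\<Inter>(event p ` \<T>'). \<forall>d\<in>demands. \<exists>x\<in>d.
        \<forall>(Q, zs)\<in>\<T>. Q (map ((\<lambda>y. p y i)(z := x)) zs))"
      by (rule combine_tests[OF \<T>(2,1) z p])
    then obtain \<T>' where \<T>': "finite \<T>'" "\<T>' \<subseteq> tests B" "\<forall>i\<in>\<Inter>(event p ` \<T>'). \<forall>d\<in>demands. \<exists>x\<in>d.
        \<forall>(Q, zs)\<in>\<T>. Q (map ((\<lambda>y. p y i)(z := x)) zs)"
      by (elim exE conjE) (rule that; assumption)
    have f1: "\<T>' \<in> fin B" and f2: "\<T> \<in> fin (insert z B)" using \<T> \<T>' by (auto simp: fin_def)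
    then have sub: "w \<T>' \<T> \<subseteq> W" by (auto simp: W_def)
    have "i \<in> \<Inter>E" if i: "i \<in> \<Inter>(event p ` \<T>') \<inter> {i. f j i = g \<T> i}" for i
    proof -
      have "\<exists>x\<in>D i. \<forall>(Q, zs)\<in>\<T>. Q (map ((\<lambda>y. p y i)(z := x)) zs)"
        using bspec[OF bspec[OF \<T>'(3)] D[of i], of i] i by simp
      then have "\<exists>x. good \<T> i x" unfolding good_def by (elim bexE) (intro exI conjI)
      then have good: "good \<T> i (SOME x. good \<T> i x)" by (rule someI_ex)
      have "inv e (f j i) = (SOME x. good \<T> i x)" using i e by (simp add: g_def)
      with good have "pz i = (SOME x. good \<T> i x)" by (simp add: pz_def good_def)
      with good have "good \<T> i (pz i)" by simp
      moreover have "(\<lambda>y. (p(z := pz)) y i) = (\<lambda>y. p y i)(z := pz i)" by auto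
      ultimately show ?thesis unfolding \<T>(3) by (auto simp: good_def event_def)
    qed
    moreover have "generic (J - w \<T>' \<T> - {j}) (\<Inter>(event p ` \<T>') \<inter> {i. f j i = g \<T> i})"
      using j sub by (intro w(2) f1) auto
    ultimately show ?thesis using sub by (auto intro: generic_mono)
  qed
  then have "consistent (J - insert j W) (event (p(z := pz)) ` tests (insert z B))"
    by (simp add: consistent_def)
  then show ?thesis using pz lepoll_insert[OF K WK] by blast
qed

text \<open>Finitely many points have an \<open>R\<close>-largest one \<open>y\<close>, and tests on
  them belong to the stage of \<open>y\<close>. The other alternative arises when no point is
  mentioned: such tests hold everywhere by \<open>base\<close>.\<close>

lemma finite_events_bounded:
  assumes E: "finite E" "E \<subseteq> event p ` tests B" and R: "trans R" "total R"
  shows "\<Inter>E = UNIV \<or> (\<exists>y\<in>B. E \<subseteq> event p ` tests (insert y {x. (x, y) \<in> R}))"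
proof -
  obtain \<T> where \<T>: "\<T> \<subseteq> tests B" "finite \<T>" "E = event p ` \<T>"
    using finite_subset_image[OF E] by blast
  have tot: "(x, y) \<in> R \<or> (y, x) \<in> R" if "x \<noteq> y" for x y
    using R(2) that by (simp add: total_on_def)
  define Y where "Y = (\<Union>t\<in>\<T>. set (snd t))"
  have Y: "finite Y" "Y \<subseteq> B" using \<T> by (fastforce simp: Y_def tests_def)+
  show ?thesis
  proof (cases "Y = {}")
    case True
    have "event p t = UNIV" if t: "t \<in> \<T>" for t
    proof -
      obtain Q zs where eq: "t = (Q, zs)" by (cases t)
      have "zs = []" using True t by (auto simp: Y_def eq)
      moreover have "Q \<in> conds (length zs)" using \<T>(1) t by (auto simp: eq tests_def)
      ultimately show ?thesis using base by (simp add: eq event_def)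
    qed
    then show ?thesis using \<T>(3) by auto
  next
    case False
    have "\<exists>y\<in>Y. \<forall>x\<in>Y. x = y \<or> (x, y) \<in> R" using Y(1) False
    proof (induction Y rule: finite_ne_induct)
      case (insert a Y)
      then obtain y where y: "y \<in> Y" "\<forall>x\<in>Y. x = y \<or> (x, y) \<in> R" by blast
      show ?case
      proof (cases "(a, y) \<in> R")
        case True
        then show ?thesis using y by blast
      next
        case False
        then have "(y, a) \<in> R" using tot[of a y] insert.hyps y(1) by blast
        then have "\<forall>x\<in>insert a Y. x = a \<or> (x, a) \<in> R" using y(2) by (auto dest: transD[OF R(1)])
        then show ?thesis by blast
      qed
    qed simp
    then obtain y where y: "y \<in> Y" "\<And>x. x \<in> Y \<Longrightarrow> x = y \<or> (x, y) \<in> R" by blast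
    have "\<T> \<subseteq> tests (insert y {x. (x, y) \<in> R})"
    proof
      fix t assume t: "t \<in> \<T>"
      then obtain Q zs where eq: "t = (Q, zs)" "Q \<in> conds (length zs)" using \<T>(1) by (auto simp: tests_def)
      have "set zs \<subseteq> Y" using t eq by (auto simp: Y_def)
      then have "zs \<in> lists (insert y {x. (x, y) \<in> R})" using y(2) by blast
      then show "t \<in> tests (insert y {x. (x, y) \<in> R})" using eq by (simp add: tests_def)
    qed
    then show ?thesis using \<T>(3) y(1) Y(2) by blast
  qed
qed

text \<open>Consistency concerns finitely many events at a time, and these already occur together at
  the stage of some \<open>y\<close>. This treats successor, limit and final stages alike.\<close>

lemma consistent_limit:
  assumes R: "trans R" "total R"
    and cons: "\<And>y. y \<in> B \<Longrightarrow> consistent (J' y) (event p ` tests (insert y {x. (x, y) \<in> R}))"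
    and J: "\<And>y. y \<in> B \<Longrightarrow> J \<subseteq> J' y"
  shows "consistent J (event p ` tests B)"
  unfolding consistent_def
proof (intro allI impI, elim conjE)
  fix E assume E: "finite E" "E \<subseteq> event p ` tests B"
  from finite_events_bounded[OF E R] show "generic J (\<Inter>E)"
  proof
    assume "\<Inter>E = UNIV"
    then show ?thesis using independent unfolding generic_def by blast
  next
    assume "\<exists>y\<in>B. E \<subseteq> event p ` tests (insert y {x. (x, y) \<in> R})"
    then obtain y where y: "y \<in> B" "E \<subseteq> event p ` tests (insert y {x. (x, y) \<in> R})" by blast
    have "generic (J' y) (\<Inter>E)" using cons[OF y(1)] E(1) y(2) unfolding consistent_def by blast
    then show ?thesis using J[OF y(1)] by (rule generic_mono) simp
  qed
qed

text \<open>Recursion along an order whose initial segments are smaller than the family of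
  functions. Before stage \<open>z\<close> at most \<open>K z\<close> many functions have been
  spent, so those remaining are still too many for \<open>K z\<close>, and
  \<open>extension_step\<close> applies.\<close>

theorem generic_points_exist:
  assumes D: "\<And>z i. D z i \<in> demands"
  obtains F :: "'t set filter" and p :: "'t set set \<Rightarrow> 't set \<Rightarrow> 'p" where
    "F \<noteq> bot" and "\<And>z i. p z i \<in> D z i"
    and "\<And>Q zs. Q \<in> conds (length zs) \<Longrightarrow> eventually (\<lambda>i. Q (map (\<lambda>z. p z i) zs)) F"
proof -
  from small_wellorder obtain R :: "('t set set \<times> 't set set) set" where R: "wf R" "trans R" "total R"
    "\<forall>x. {y. (y, x) \<in> R} \<prec> (UNIV :: 't set set set)"
    by (elim exE conjE) (rule that; assumption)
  define below where "below z = {y. (y, z) \<in> R}" for z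
  \<comment> \<open>A disjoint sum in place of a maximum: it bounds the number of earlier points as
    well as the number of indices.\<close>
  define K where "K z = below z <+> (UNIV :: 't set set)" for z
  have inf2: "infinite (UNIV :: 't set set)" and inf3: "infinite (UNIV :: 't set set set)"
    using inf by (simp_all add: Finite_Set.finite_set)
  have "(UNIV :: 't set set) \<prec> (UNIV :: 't set set set)"
    using lesspoll_Pow_self[of "UNIV :: 't set set"] by simp
  then have K_less: "K z \<prec> (UNIV :: 't set set set)" for z
    unfolding K_def by (intro lesspoll_Plus inf3) (simp_all add: below_def R(4))
  have K1: "below z \<lesssim> K z" and K2: "(UNIV :: 't set set) \<lesssim> K z" for z
    unfolding K_def lepoll_iff_ordLeq by (rule card_of_Plus1 card_of_Plus2)+
  have K_inf: "infinite (K z)" for z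
    using K2[of z] inf2 by (meson infinite_le_lepoll lepoll_trans)
  have below_trans: "below y \<subseteq> below z" if "y \<in> below z" for y z
    using that transD[OF R(2)] by (auto simp: below_def)
  have K_mono: "K y \<lesssim> K z" if "y \<in> below z" for y z
    unfolding K_def using below_trans[OF that] by (intro subset_imp_lepoll) auto
  \<comment> \<open>The recursion records at each name the point chosen there and the set of
    functions spent on it.\<close>
  define J where "J G A = - (\<Union>y\<in>A. snd (G y))" for G :: "'t set set \<Rightarrow> ('t set \<Rightarrow> 'p) \<times> 't set set set" and A
  \<comment> \<open>The candidate \<open>r\<close> overrides \<open>G\<close> at \<open>z\<close>,
    since the recursion principle asks for a property that depends on \<open>G\<close> only below
    \<open>z\<close>.\<close>
  define admissible where "admissible G z r \<longleftrightarrow> (\<forall>i. fst r i \<in> D z i) \<and> snd r \<lesssim> K z \<and>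
    consistent (J G (below z) - snd r) (event ((\<lambda>y. fst (G y))(z := fst r)) ` tests (insert z (below z)))"
    for G :: "'t set set \<Rightarrow> ('t set \<Rightarrow> 'p) \<times> 't set set set" and z r
  have irrefl: "z \<notin> below z" for z using R(1) by (auto simp: below_def)
  have "\<exists>G. \<forall>z. admissible G z (G z)"
  proof (rule dependent_wf_choice[OF R(1)])
    fix G G' :: "'t set set \<Rightarrow> ('t set \<Rightarrow> 'p) \<times> 't set set set" and z
      and r :: "('t set \<Rightarrow> 'p) \<times> 't set set set"
    assume eq: "\<And>y. (y, z) \<in> R \<Longrightarrow> G y = G' y"
    then have "J G (below z) = J G' (below z)" by (auto simp: J_def below_def)
    moreover have "event ((\<lambda>y. fst (G y))(z := fst r)) ` tests (insert z (below z)) =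
        event ((\<lambda>y. fst (G' y))(z := fst r)) ` tests (insert z (below z))"
      using eq by (intro event_cong[OF order_refl]) (auto simp: below_def)
    ultimately show "admissible G z r = admissible G' z r" by (simp add: admissible_def)
  next
    fix z and G :: "'t set set \<Rightarrow> ('t set \<Rightarrow> 'p) \<times> 't set set set"
    assume "\<And>y. (y, z) \<in> R \<Longrightarrow> admissible G y (G y)"
    then have G: "admissible G y (G y)" if "y \<in> below z" for y using that by (simp add: below_def)
    have "consistent (J G (below z)) (event (\<lambda>y. fst (G y)) ` tests (below z))"
    proof (rule consistent_limit[OF R(2,3)])
      fix y assume y: "y \<in> below z"
      show "consistent (J G (below y) - snd (G y)) (event (\<lambda>y. fst (G y)) ` tests (insert y {x. (x, y) \<in> R}))"
        using G[OF y] by (simp add: admissible_def fun_upd_idem below_def)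
      show "J G (below z) \<subseteq> J G (below y) - snd (G y)"
        using below_trans[OF y] y by (auto simp: J_def)
    qed
    moreover have "\<not> J G (below z) \<lesssim> K z"
    proof
      assume "J G (below z) \<lesssim> K z"
      moreover have "(\<Union>y\<in>below z. snd (G y)) \<lesssim> K z"
      proof (rule lepoll_UN[OF K_inf K1])
        show "snd (G y) \<lesssim> K z" if "y \<in> below z" for y
          using G[OF that] K_mono[OF that] by (auto simp: admissible_def intro: lepoll_trans)
      qed
      ultimately have "J G (below z) \<union> (\<Union>y\<in>below z. snd (G y)) \<lesssim> K z"
        by (intro lepoll_Un K_inf)
      moreover have "J G (below z) \<union> (\<Union>y\<in>below z. snd (G y)) = UNIV" by (auto simp: J_def)
      ultimately have "(UNIV :: 't set set set) \<lesssim> K z" by simp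
      then show False using K_less[of z] lesspoll_trans1 by blast
    qed
    moreover have "fst (G y) i \<in> X" if "y \<in> below z" for y i
      using G[OF that] demands(1)[OF D] by (auto simp: admissible_def)
    ultimately obtain pz S where "\<forall>i. pz i \<in> D z i" "S \<lesssim> K z"
      "consistent (J G (below z) - S) (event ((\<lambda>y. fst (G y))(z := pz)) ` tests (insert z (below z)))"
      using extension_step[of "J G (below z)" "\<lambda>y. fst (G y)" "below z" z "K z" "D z"]
        irrefl K1 K2 D by blast
    then have "admissible G z (pz, S)" by (simp add: admissible_def)
    then show "\<exists>r. admissible G z r" by blast
  qed
  then obtain G where G: "\<And>z. admissible G z (G z)" by blast
  define p where "p z = fst (G z)" for z
  define F where "F = (INF C\<in>event p ` tests UNIV. principal C)"
  \<comment> \<open>Genericity for the empty set of functions still makes finite intersections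
    nonempty, which is what a proper filter requires.\<close>
  have cons: "consistent {} (event p ` tests UNIV)"
  proof (rule consistent_limit[OF R(2,3)])
    fix y
    have p: "p = (\<lambda>z. fst (G z))" by (intro ext) (simp add: p_def)
    show "consistent (J G (below y) - snd (G y)) (event p ` tests (insert y {x. (x, y) \<in> R}))"
      using G[of y] by (simp add: admissible_def fun_upd_idem p below_def)
  qed simp
  have ne: "(INF C\<in>E. principal C) \<noteq> bot" if E: "E \<subseteq> event p ` tests UNIV" "finite E" for E
  proof -
    have "\<Inter>E \<noteq> {}" using cons E unfolding consistent_def by (intro generic_nonempty) blast
    then show ?thesis by (simp add: INF_principal_finite E(2) principal_eq_bot_iff)
  qed
  have "F \<noteq> bot" unfolding F_def by (rule INF_filter_not_bot[OF ne])
  moreover have "p z i \<in> D z i" for z i using G[of z] by (simp add: admissible_def p_def)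
  moreover have "eventually (\<lambda>i. Q (map (\<lambda>z. p z i) zs)) F" if "Q \<in> conds (length zs)" for Q zs
  proof -
    have t: "(Q, zs) \<in> tests UNIV" using that by (simp add: tests_def)
    have "F \<le> principal (event p (Q, zs))" unfolding F_def using t by (intro INF_lower) simp
    then show ?thesis by (simp add: le_principal event_def)
  qed
  ultimately show ?thesis by (rule that)
qed

end

section \<open>Back and forth for Palyutin formulas\<close>

text \<open>Round robin: an increasing sequence \<open>h\<close> visits the sets in turn, and
  \<open>g\<close> sends \<open>h m\<close> to the label of the set visited at step
  \<open>m\<close>.\<close>

lemma infinite_selection:
  fixes X :: "'s \<Rightarrow> nat set"
  assumes "finite S" and "\<And>s. s \<in> S \<Longrightarrow> infinite (X s)"
  shows "\<exists>g. \<forall>s\<in>S. infinite {n \<in> X s. g n = s}"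
proof (cases "S = {}")
  case False
  obtain l where l: "set l = S" using finite_list assms(1) by blast
  define k where "k = length l"
  have "k > 0" using l False by (auto simp: k_def)
  define s where "s m = l ! (m mod k)" for m
  have sS: "s m \<in> S" for m using \<open>k > 0\<close> l by (auto simp: s_def k_def intro!: nth_mem)
  have "\<exists>h. \<forall>m. h m \<in> X (s m) \<and> h m < h (Suc m)"
  proof (rule dependent_nat_choice)
    show "\<exists>n. n \<in> X (s 0)" using infinite_imp_nonempty[OF assms(2)[OF sS, of 0]] by blast
    show "\<exists>n'. n' \<in> X (s (Suc m)) \<and> n < n'" if "n \<in> X (s m)" for n m
      using assms(2)[OF sS, of "Suc m"] by (meson infinite_nat_iff_unbounded)
  qed
  then obtain h where h: "\<And>m. h m \<in> X (s m)" "\<And>m. h m < h (Suc m)" by blast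
  have "inj h" using h(2) by (intro strict_mono_imp_inj_on) (simp add: strict_mono_Suc_iff)
  have "infinite {n \<in> X t. s (inv h n) = t}" if t: "t \<in> S" for t
  proof -
    obtain j where j: "j < k" "t = l ! j" using t l by (metis in_set_conv_nth k_def)
    \<comment> \<open>All positions congruent to \<open>j\<close> modulo \<open>k\<close> carry the
      label \<open>t\<close>, and there are infinitely many of them.\<close>
    have "h (j + k * m) \<in> {n \<in> X t. s (inv h n) = t}" for m
      using h(1)[of "j + k * m"] j \<open>inj h\<close> by (simp add: s_def)
    then have "range (\<lambda>m. h (j + k * m)) \<subseteq> {n \<in> X t. s (inv h n) = t}" by blast
    moreover have "inj (\<lambda>m. h (j + k * m))"
      using \<open>k > 0\<close> by (intro injI) (auto dest!: injD[OF \<open>inj h\<close>])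
    then have "infinite (range (\<lambda>m. h (j + k * m)))" by (rule range_inj_infinite)
    ultimately show ?thesis using infinite_super by blast
  qed
  then show ?thesis by (intro exI[of _ "\<lambda>n. s (inv h n)"]) blast
qed simp

text \<open>For a Palyutin formula this is, by \<open>palyutin_fm_val\<close>, its value in the
  Frechet power at the classes of the sequences \<open>e x\<close>.\<close>

definition lim_val :: "('f, 'p, 'a) metric_struct \<Rightarrow> (nat \<Rightarrow> nat \<Rightarrow> 'a) \<Rightarrow> ('f, 'p) fm \<Rightarrow> real" where
  "lim_val M e \<phi> = real_limsup cofinite (\<lambda>n. fm_val M (\<lambda>x. e x n) \<phi>)"

text \<open>
  For a list \<open>\<psi>s\<close> and target values \<open>r\<close>, \<open>below_test\<close> measures whether some \<open>x\<close> makes all values at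
  most their targets, and \<open>attain_test\<close> whether some such \<open>x\<close> also makes \<open>\<psi>\<close> nearly attain its
  target. The latter is the mixed clause of Palyutin formulas for \<open>D t = 8 \<gamma> - t\<close>, with fixed
  point \<open>4 \<gamma>\<close>.
\<close>

definition excess :: "('f, 'p) fm list \<Rightarrow> (('f, 'p) fm \<Rightarrow> real) \<Rightarrow> ('f, 'p) fm" where
  "excess \<psi>s r = (let \<theta>s = map (\<lambda>\<psi>. Conn1 (\<lambda>t. t - r \<psi>) \<psi>) \<psi>s in foldr MaxF \<theta>s (hd \<theta>s))"

definition below_test :: "nat \<Rightarrow> ('f, 'p) fm list \<Rightarrow> (('f, 'p) fm \<Rightarrow> real) \<Rightarrow> ('f, 'p) fm" where
  "below_test x \<psi>s r = InfF x (excess \<psi>s r)"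

definition attain_test ::
    "nat \<Rightarrow> ('f, 'p) fm list \<Rightarrow> real \<Rightarrow> (('f, 'p) fm \<Rightarrow> real) \<Rightarrow> ('f, 'p) fm \<Rightarrow> ('f, 'p) fm" where
  "attain_test x \<psi>s \<gamma> r \<psi> = MaxF (InfF x (excess \<psi>s r))
    (SupF x (MinF (Conn1 (\<lambda>t. 8 * \<gamma> - t) (excess \<psi>s r))
      (MinF (ConstF (4 * \<gamma>)) (Conn1 (\<lambda>t. t - r \<psi> + 5 * \<gamma>) \<psi>))))"

text \<open>The head of the list starts the fold in place of a constant formula and so is counted
  twice, harmlessly for a maximum.\<close>

lemma excess_le_iff:
  fixes \<psi>s :: "('f, 'p) fm list"
  assumes "\<psi>s \<noteq> []"
  shows "fm_val S e (excess \<psi>s r) \<le> t \<longleftrightarrow> (\<forall>\<psi>\<in>set \<psi>s. fm_val S e \<psi> \<le> r \<psi> + t)"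
proof -
  have "fm_val S e (foldr MaxF \<theta>s \<theta>) \<le> t \<longleftrightarrow> fm_val S e \<theta> \<le> t \<and> (\<forall>\<theta>\<in>set \<theta>s. fm_val S e \<theta> \<le> t)"
    for \<theta>s and \<theta> :: "('f, 'p) fm"
    by (induction \<theta>s) auto
  then show ?thesis using assms
    by (cases \<psi>s) (auto simp: excess_def Let_def algebra_simps)
qed

lemma fv_excess:
  fixes \<psi>s :: "('f, 'p) fm list"
  shows "\<psi>s \<noteq> [] \<Longrightarrow> fv_fm (excess \<psi>s r) = (\<Union>\<psi>\<in>set \<psi>s. fv_fm \<psi>)"
proof -
  have "fv_fm (foldr MaxF \<theta>s \<theta>) = fv_fm \<theta> \<union> (\<Union>\<theta>\<in>set \<theta>s. fv_fm \<theta>)"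
    for \<theta>s and \<theta> :: "('f, 'p) fm"
    by (induction \<theta>s) auto
  then show "\<psi>s \<noteq> [] \<Longrightarrow> ?thesis" by (cases \<psi>s) (auto simp: excess_def Let_def)
qed

lemma palyutin_shift:
  assumes "palyutin L \<psi>"
  shows "palyutin L (Conn1 (\<lambda>t. t - r) \<psi>)" "palyutin L (Conn1 (\<lambda>t. t - r + s) \<psi>)"
  using assms by (auto intro!: palyutin.conn continuous_intros monoI)

lemma palyutin_excess:
  fixes \<psi>s :: "('f, 'p) fm list"
  assumes "\<psi>s \<noteq> []" and "\<And>\<psi>. \<psi> \<in> set \<psi>s \<Longrightarrow> palyutin L \<psi>"
  shows "palyutin L (excess \<psi>s r)"
proof -
  have fold: "palyutin L (foldr MaxF \<theta>s \<theta>)" if "palyutin L \<theta>" "\<And>\<theta>. \<theta> \<in> set \<theta>s \<Longrightarrow> palyutin L \<theta>"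
    for \<theta>s and \<theta> :: "('f, 'p) fm"
    using that by (induction \<theta>s) (auto intro: palyutin.max)
  then show ?thesis
    using assms by (cases \<psi>s) (auto simp: excess_def Let_def intro!: fold palyutin_shift palyutin.max)
qed

lemma palyutin_tests:
  assumes "\<psi>s \<noteq> []" and "\<And>\<psi>. \<psi> \<in> set \<psi>s \<Longrightarrow> palyutin L \<psi>"
  shows "palyutin L (below_test x \<psi>s r)" "\<psi> \<in> set \<psi>s \<Longrightarrow> palyutin L (attain_test x \<psi>s \<gamma> r \<psi>)"
proof -
  note exc = palyutin_excess[OF assms, of r]
  show "palyutin L (below_test x \<psi>s r)"
    unfolding below_test_def by (intro palyutin.inf exc)
  assume "\<psi> \<in> set \<psi>s"
  then have "palyutin L (Conn1 (\<lambda>t. t - r \<psi> + 5 * \<gamma>) \<psi>)" by (intro palyutin_shift assms)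
  then show "palyutin L (attain_test x \<psi>s \<gamma> r \<psi>)"
    unfolding attain_test_def
    by (intro palyutin.pal exc) (auto intro!: continuous_intros antimonoI)
qed

lemma fv_tests:
  assumes "\<psi>s \<noteq> []"
  shows "fv_fm (below_test x \<psi>s r) = (\<Union>\<psi>\<in>set \<psi>s. fv_fm \<psi>) - {x}"
    "\<psi> \<in> set \<psi>s \<Longrightarrow> fv_fm (attain_test x \<psi>s \<gamma> r \<psi>) = (\<Union>\<psi>\<in>set \<psi>s. fv_fm \<psi>) - {x}"
  using assms by (auto simp: below_test_def attain_test_def fv_excess)

lemma fm_val_range:
  assumes "bounded_struct L S" and "wf_fm L \<phi>" and "\<And>y. y \<noteq> x \<Longrightarrow> e y \<in> Dom S"
  shows "bdd_above ((\<lambda>a. fm_val S (e(x := a)) \<phi>) ` Dom S)"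
    "bdd_below ((\<lambda>a. fm_val S (e(x := a)) \<phi>) ` Dom S)"
proof -
  obtain B where "\<And>e. \<forall>y. e y \<in> Dom S \<Longrightarrow> \<bar>fm_val S e \<phi>\<bar> \<le> B"
    using fm_val_bounded[OF assms(1,2)] by blast
  then have "\<bar>fm_val S (e(x := a)) \<phi>\<bar> \<le> B" if "a \<in> Dom S" for a
    using that assms(3) by auto
  then show "bdd_above ((\<lambda>a. fm_val S (e(x := a)) \<phi>) ` Dom S)"
    "bdd_below ((\<lambda>a. fm_val S (e(x := a)) \<phi>) ` Dom S)"
    by (auto intro!: bdd_aboveI2[where M=B] bdd_belowI2[where m="-B"] simp: abs_le_iff minus_le_iff)
qed

text \<open>The values along \<open>c\<close> eventually exceed their targets by less than
  \<open>\<gamma> / 2\<close>, and each is frequently above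
  \<open>r \<psi> - 3 * \<gamma> / 2\<close>. At an index where both hold, the three terms of the
  minimum in the attaining test are at least \<open>15 * \<gamma> / 2\<close>,
  \<open>4 * \<gamma>\<close> and \<open>7 * \<gamma> / 2\<close>.\<close>

lemma lim_val_tests_lower:
  assumes L: "metric_signature L" and M: "L_structure L M"
    and \<psi>s: "\<psi>s \<noteq> []" "\<And>\<psi>. \<psi> \<in> set \<psi>s \<Longrightarrow> palyutin L \<psi>" and "\<gamma> > 0"
    and e: "\<And>y n. e y n \<in> Dom M" and c: "\<And>n. c n \<in> Dom M"
    and r: "\<And>\<psi>. \<psi> \<in> set \<psi>s \<Longrightarrow> lim_val M (e(x := c)) \<psi> \<le> r \<psi>"
      "\<And>\<psi>. \<psi> \<in> set \<psi>s \<Longrightarrow> r \<psi> \<le> lim_val M (e(x := c)) \<psi> + \<gamma>"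
  shows "lim_val M e (below_test x \<psi>s r) \<le> \<gamma> / 2"
    and "\<psi> \<in> set \<psi>s \<Longrightarrow> 7 * \<gamma> / 2 \<le> lim_val M e (attain_test x \<psi>s \<gamma> r \<psi>)"
proof -
  interpret signature_power L M "cofinite :: nat filter"
    using L M by unfold_locales auto
  have ec: "(e(x := c)) y \<in> Seqs" for y using e c by auto
  have bnd: "bounded (range (\<lambda>n. fm_val M ((\<lambda>y. e y n)(x := c n)) \<psi>))" if "\<psi> \<in> set \<psi>s" for \<psi>
    using bounded_fm_val[OF palyutin_wf[OF \<psi>s(2)[OF that]], of "e(x := c)"] ec unfolding upd_apply by blast
  have lim: "lim_val M (e(x := c)) \<psi> = real_limsup cofinite (\<lambda>n. fm_val M ((\<lambda>y. e y n)(x := c n)) \<psi>)" for \<psi>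
    unfolding lim_val_def upd_apply ..
  have wf_exc: "wf_fm L (excess \<psi>s r)" using palyutin_excess[OF \<psi>s] palyutin_wf by blast
  have "eventually (\<lambda>n. \<forall>\<psi>\<in>set \<psi>s. fm_val M ((\<lambda>y. e y n)(x := c n)) \<psi> < r \<psi> + \<gamma> / 2) cofinite"
  proof (rule eventually_ball_finite[OF _ ballI])
    fix \<psi> assume "\<psi> \<in> set \<psi>s"
    then show "eventually (\<lambda>n. fm_val M ((\<lambda>y. e y n)(x := c n)) \<psi> < r \<psi> + \<gamma> / 2) cofinite"
      using r(1)[of \<psi>] \<open>\<gamma> > 0\<close> lim by (intro real_limsup_less_eventually F bnd) simp_all
  qed simp
  then have exc: "eventually (\<lambda>n. fm_val M ((\<lambda>y. e y n)(x := c n)) (excess \<psi>s r) \<le> \<gamma> / 2) cofinite"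
    by eventually_elim (intro excess_le_iff[OF \<psi>s(1), THEN iffD2] ballI less_imp_le, blast)
  show "lim_val M e (below_test x \<psi>s r) \<le> \<gamma> / 2"
    unfolding lim_val_def
  proof (rule real_limsup_leI[OF F bounded_fm_val])
    show "eventually (\<lambda>n. fm_val M (\<lambda>x. e x n) (below_test x \<psi>s r) \<le> \<gamma> / 2) cofinite"
      using exc
    proof eventually_elim
      case (elim n)
      have "fm_val M (\<lambda>y. e y n) (below_test x \<psi>s r) \<le> fm_val M ((\<lambda>y. e y n)(x := c n)) (excess \<psi>s r)"
        unfolding below_test_def fm_val.simps
        using e c by (intro cINF_lower fm_val_range[OF bounded_M wf_exc])
      with elim show ?case by simp
    qed
  qed (use e \<psi>s in \<open>auto intro!: palyutin_wf palyutin_tests\<close>)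
  assume \<psi>: "\<psi> \<in> set \<psi>s"
  have wf_att: "wf_fm L (attain_test x \<psi>s \<gamma> r \<psi>)"
    by (rule palyutin_wf[OF palyutin_tests(2)[OF \<psi>s \<psi>]])
  show "7 * \<gamma> / 2 \<le> lim_val M e (attain_test x \<psi>s \<gamma> r \<psi>)"
    unfolding lim_val_def
  proof (rule real_limsup_geI[OF F bounded_fm_val[OF wf_att]])
    have "frequently (\<lambda>n. r \<psi> - \<gamma> - \<gamma> / 2 < fm_val M ((\<lambda>y. e y n)(x := c n)) \<psi>) cofinite"
      using r(2)[OF \<psi>] \<open>\<gamma> > 0\<close> lim by (intro real_limsup_greater_frequently F bnd \<psi>) simp
    from frequently_eventually_conj[OF this exc]
    show "frequently (\<lambda>n. 7 * \<gamma> / 2 \<le> fm_val M (\<lambda>x. e x n) (attain_test x \<psi>s \<gamma> r \<psi>)) cofinite"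
    proof (rule frequently_elim1)
      fix n
      let ?v = "\<lambda>\<phi> a. fm_val M ((\<lambda>y. e y n)(x := a)) \<phi>"
      let ?att = "\<lambda>a. min (8 * \<gamma> - ?v (excess \<psi>s r) a) (min (4 * \<gamma>) (?v \<psi> a - r \<psi> + 5 * \<gamma>))"
      assume n: "?v (excess \<psi>s r) (c n) \<le> \<gamma> / 2 \<and> r \<psi> - \<gamma> - \<gamma> / 2 < ?v \<psi> (c n)"
      then have "7 * \<gamma> / 2 \<le> ?att (c n)" using \<open>\<gamma> > 0\<close> by (simp add: field_simps)
      also have "\<dots> \<le> (SUP a\<in>Dom M. ?att a)"
        by (intro cSUP_upper c bdd_aboveI2[where M="4 * \<gamma>"]) auto
      also have "\<dots> \<le> fm_val M (\<lambda>x. e x n) (attain_test x \<psi>s \<gamma> r \<psi>)"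
        by (simp add: attain_test_def)
      finally show "7 * \<gamma> / 2 \<le> fm_val M (\<lambda>x. e x n) (attain_test x \<psi>s \<gamma> r \<psi>)" .
    qed
  qed (use e in auto)
qed

text \<open>A value of the attaining test above \<open>5 * \<gamma> / 2\<close> cannot stem from its
  infimum, which is eventually below \<open>3 * \<gamma> / 2\<close>. So it yields a point with
  excess below \<open>8 * \<gamma> - 5 * \<gamma> / 2 = 11 * \<gamma> / 2\<close> at which
  \<open>\<psi>\<close> is above \<open>r \<psi> - 5 * \<gamma> / 2\<close>. Upper bounds must hold
  eventually but each lower bound only infinitely often, so the formulas can share out the
  indices.\<close>

lemma lim_val_tests_realise:
  assumes L: "metric_signature L" and N: "L_structure L N"
    and \<psi>s: "\<psi>s \<noteq> []" "\<And>\<psi>. \<psi> \<in> set \<psi>s \<Longrightarrow> palyutin L \<psi>" and "\<gamma> > 0"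
    and e: "\<And>y n. e y n \<in> Dom N"
    and below: "lim_val N e (below_test x \<psi>s r) < 3 * \<gamma> / 2"
    and attain: "\<And>\<psi>. \<psi> \<in> set \<psi>s \<Longrightarrow> 5 * \<gamma> / 2 < lim_val N e (attain_test x \<psi>s \<gamma> r \<psi>)"
  shows "\<exists>d. (\<forall>n. d n \<in> Dom N) \<and> (\<forall>\<psi>\<in>set \<psi>s. lim_val N (e(x := d)) \<psi> \<le> r \<psi> + 11 * \<gamma> / 2 \<and>
    r \<psi> - 5 * \<gamma> / 2 \<le> lim_val N (e(x := d)) \<psi>)"
proof -
  interpret signature_power L N "cofinite :: nat filter"
    using L N by unfold_locales auto
  let ?v = "\<lambda>\<phi> n a. fm_val N ((\<lambda>y. e y n)(x := a)) \<phi>"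
  have ne: "Dom N \<noteq> {}" using N by (simp add: L_structure_def)
  have wf_exc: "wf_fm L (excess \<psi>s r)" using palyutin_excess[OF \<psi>s] palyutin_wf by blast
  have wf_bel: "wf_fm L (below_test x \<psi>s r)" using palyutin_tests(1)[OF \<psi>s] palyutin_wf by blast
  have bel: "eventually (\<lambda>n. (INF a\<in>Dom N. ?v (excess \<psi>s r) n a) < 3 * \<gamma> / 2) cofinite"
    using real_limsup_less_eventually[OF F bounded_fm_val[OF wf_bel] below[unfolded lim_val_def]] e
    by (simp add: below_test_def)
  have bel_ex: "\<exists>a\<in>Dom N. ?v (excess \<psi>s r) n a < 3 * \<gamma> / 2"
    if "(INF a\<in>Dom N. ?v (excess \<psi>s r) n a) < 3 * \<gamma> / 2" for n
    using that cINF_less_iff[OF ne fm_val_range(2)[OF bounded_M wf_exc], of x "\<lambda>y. e y n"] e by blast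
  define good where "good \<psi> n a \<longleftrightarrow> a \<in> Dom N \<and> ?v (excess \<psi>s r) n a \<le> 11 * \<gamma> / 2 \<and>
    r \<psi> - 5 * \<gamma> / 2 \<le> ?v \<psi> n a" for \<psi> n a
  have "infinite {n. \<exists>a. good \<psi> n a}" if \<psi>: "\<psi> \<in> set \<psi>s" for \<psi>
  proof -
    have wf_att: "wf_fm L (attain_test x \<psi>s \<gamma> r \<psi>)"
      by (rule palyutin_wf[OF palyutin_tests(2)[OF \<psi>s \<psi>]])
    have "frequently (\<lambda>n. 5 * \<gamma> / 2 < fm_val N (\<lambda>x. e x n) (attain_test x \<psi>s \<gamma> r \<psi>)) cofinite"
      using real_limsup_greater_frequently[OF F bounded_fm_val[OF wf_att] attain[OF \<psi>, unfolded lim_val_def]] e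
      by simp
    from frequently_eventually_conj[OF this bel]
    have "frequently (\<lambda>n. \<exists>a. good \<psi> n a) cofinite"
    proof (rule frequently_elim1)
      fix n
      let ?att = "\<lambda>a. min (8 * \<gamma> - ?v (excess \<psi>s r) n a) (min (4 * \<gamma>) (?v \<psi> n a - r \<psi> + 5 * \<gamma>))"
      assume "(INF a\<in>Dom N. ?v (excess \<psi>s r) n a) < 3 * \<gamma> / 2 \<and>
        5 * \<gamma> / 2 < fm_val N (\<lambda>x. e x n) (attain_test x \<psi>s \<gamma> r \<psi>)"
      then have "5 * \<gamma> / 2 < (SUP a\<in>Dom N. ?att a)"
        using \<open>\<gamma> > 0\<close> by (auto simp: attain_test_def less_max_iff_disj)
      then obtain a where "a \<in> Dom N" "5 * \<gamma> / 2 < ?att a"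
        using less_cSUP_iff[OF ne, of ?att "5 * \<gamma> / 2"] by (force intro: bdd_aboveI2[where M="4 * \<gamma>"])
      then have "good \<psi> n a" by (auto simp: good_def)
      then show "\<exists>a. good \<psi> n a" by blast
    qed
    then show ?thesis by (simp add: frequently_cofinite)
  qed
  then obtain g where g: "\<And>\<psi>. \<psi> \<in> set \<psi>s \<Longrightarrow> infinite {n \<in> {n. \<exists>a. good \<psi> n a}. g n = \<psi>}"
    using infinite_selection[of "set \<psi>s" "\<lambda>\<psi>. {n. \<exists>a. good \<psi> n a}"] by auto
  \<comment> \<open>Index \<open>n\<close> is reserved for the formula \<open>g n\<close>: its
    target is attained there if possible, and otherwise a point respecting the upper bounds is taken
    whenever the infimum permits.\<close>
  have "\<exists>a. a \<in> Dom N \<and> ((INF a\<in>Dom N. ?v (excess \<psi>s r) n a) < 3 * \<gamma> / 2 \<longrightarrow>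
      ?v (excess \<psi>s r) n a \<le> 11 * \<gamma> / 2) \<and> ((\<exists>a. good (g n) n a) \<longrightarrow> good (g n) n a)" for n
  proof (cases "\<exists>a. good (g n) n a")
    case True
    then show ?thesis by (auto simp: good_def)
  next
    case False
    then show ?thesis using bel_ex[of n] ne \<open>\<gamma> > 0\<close> by force
  qed
  then obtain d where d: "\<And>n. d n \<in> Dom N"
    "\<And>n. (INF a\<in>Dom N. ?v (excess \<psi>s r) n a) < 3 * \<gamma> / 2 \<Longrightarrow> ?v (excess \<psi>s r) n (d n) \<le> 11 * \<gamma> / 2"
    "\<And>n. \<exists>a. good (g n) n a \<Longrightarrow> good (g n) n (d n)" by metis
  have ed: "(e(x := d)) y \<in> Seqs" for y using e d(1) by auto
  have bnd: "bounded (range (\<lambda>n. ?v \<psi> n (d n)))" if "\<psi> \<in> set \<psi>s" for \<psi>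
    using bounded_fm_val[OF palyutin_wf[OF \<psi>s(2)[OF that]], of "e(x := d)"] ed unfolding upd_apply by blast
  have exc: "eventually (\<lambda>n. ?v (excess \<psi>s r) n (d n) \<le> 11 * \<gamma> / 2) cofinite"
    using bel by eventually_elim (rule d(2))
  have "lim_val N (e(x := d)) \<psi> \<le> r \<psi> + 11 * \<gamma> / 2 \<and> r \<psi> - 5 * \<gamma> / 2 \<le> lim_val N (e(x := d)) \<psi>"
    if \<psi>: "\<psi> \<in> set \<psi>s" for \<psi>
    unfolding lim_val_def upd_apply
  proof (intro conjI real_limsup_leI real_limsup_geI F bnd \<psi>)
    show "eventually (\<lambda>n. ?v \<psi> n (d n) \<le> r \<psi> + 11 * \<gamma> / 2) cofinite"
      using exc by eventually_elim (use \<psi> excess_le_iff[OF \<psi>s(1), THEN iffD1] in blast)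
    have "{n \<in> {n. \<exists>a. good \<psi> n a}. g n = \<psi>} \<subseteq> {n. r \<psi> - 5 * \<gamma> / 2 \<le> ?v \<psi> n (d n)}"
      using d(3) by (auto simp: good_def)
    then show "frequently (\<lambda>n. r \<psi> - 5 * \<gamma> / 2 \<le> ?v \<psi> n (d n)) cofinite"
      using g[OF \<psi>] infinite_super unfolding frequently_cofinite by blast
  qed
  then show ?thesis using d(1) by blast
qed

text \<open>The true values are rounded up to a finite grid, so that finitely many targets, hence
  finitely many tests, serve every \<open>c\<close>. Rounding costs at most \<open>\<gamma>\<close>
  and the realisation at most \<open>11 * \<gamma> / 2\<close>, which together stay below
  \<open>7 * \<gamma>\<close>.\<close>

lemma lim_val_forth:
  assumes L: "metric_signature L" "L_structure L M" "L_structure L N"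
    and \<psi>s: "\<psi>s \<noteq> []" "\<And>\<psi>. \<psi> \<in> set \<psi>s \<Longrightarrow> palyutin L \<psi>" and \<gamma>: "\<gamma> > 0"
    and e: "\<And>y n. e y n \<in> Dom M" "\<And>y n. e' y n \<in> Dom N" and c: "\<And>n. c n \<in> Dom M"
    and B: "\<And>\<psi> n. \<psi> \<in> set \<psi>s \<Longrightarrow> \<bar>lim_val M (e(x := c)) \<psi>\<bar> \<le> B"
    and grid: "grid = (\<lambda>k. \<gamma> * of_int k) ` {- \<lceil>B / \<gamma>\<rceil> - 1..\<lceil>B / \<gamma>\<rceil> + 1}"
    and agree: "\<And>r. r \<in> set \<psi>s \<rightarrow>\<^sub>E grid \<Longrightarrow>
        \<bar>lim_val M e (below_test x \<psi>s r) - lim_val N e' (below_test x \<psi>s r)\<bar> < \<gamma>"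
      "\<And>r \<psi>. r \<in> set \<psi>s \<rightarrow>\<^sub>E grid \<Longrightarrow> \<psi> \<in> set \<psi>s \<Longrightarrow>
        \<bar>lim_val M e (attain_test x \<psi>s \<gamma> r \<psi>) - lim_val N e' (attain_test x \<psi>s \<gamma> r \<psi>)\<bar> < \<gamma>"
  shows "\<exists>d. (\<forall>n. d n \<in> Dom N) \<and>
    (\<forall>\<psi>\<in>set \<psi>s. \<bar>lim_val M (e(x := c)) \<psi> - lim_val N (e'(x := d)) \<psi>\<bar> < 7 * \<gamma>)"
proof -
  let ?v = "lim_val M (e(x := c))"
  \<comment> \<open>Being extensional on \<open>set \<psi>s\<close>, the target function ranges over
    a finite set.\<close>
  define r where "r = (\<lambda>\<psi>\<in>set \<psi>s. \<gamma> * of_int \<lceil>?v \<psi> / \<gamma>\<rceil>)"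
  have r: "?v \<psi> \<le> r \<psi>" "r \<psi> \<le> ?v \<psi> + \<gamma>" if "\<psi> \<in> set \<psi>s" for \<psi>
  proof -
    have "?v \<psi> / \<gamma> \<le> of_int \<lceil>?v \<psi> / \<gamma>\<rceil>" "of_int \<lceil>?v \<psi> / \<gamma>\<rceil> \<le> ?v \<psi> / \<gamma> + 1" by linarith+
    then have "?v \<psi> \<le> of_int \<lceil>?v \<psi> / \<gamma>\<rceil> * \<gamma>" "of_int \<lceil>?v \<psi> / \<gamma>\<rceil> * \<gamma> \<le> ?v \<psi> + \<gamma>"
      using \<gamma> by (simp_all only: pos_divide_le_eq) (simp add: field_simps)
    then show "?v \<psi> \<le> r \<psi>" "r \<psi> \<le> ?v \<psi> + \<gamma>"
      using that by (simp_all add: r_def mult.commute)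
  qed
  have r_grid: "r \<in> set \<psi>s \<rightarrow>\<^sub>E grid"
  proof (rule PiE_I)
    fix \<psi> assume \<psi>: "\<psi> \<in> set \<psi>s"
    have "?v \<psi> / \<gamma> \<le> B / \<gamma>" "- B / \<gamma> \<le> ?v \<psi> / \<gamma>"
      using B[OF \<psi>] \<gamma> by (intro divide_right_mono; simp add: abs_le_iff minus_le_iff)+
    then have "\<lceil>?v \<psi> / \<gamma>\<rceil> \<in> {- \<lceil>B / \<gamma>\<rceil> - 1..\<lceil>B / \<gamma>\<rceil> + 1}" by simp linarith
    then have "\<gamma> * of_int \<lceil>?v \<psi> / \<gamma>\<rceil> \<in> grid" unfolding grid by (rule imageI)
    then show "r \<psi> \<in> grid" using \<psi> by (simp add: r_def)
  qed (simp add: r_def)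
  have low: "lim_val M e (below_test x \<psi>s r) \<le> \<gamma> / 2"
    "\<And>\<psi>. \<psi> \<in> set \<psi>s \<Longrightarrow> 7 * \<gamma> / 2 \<le> lim_val M e (attain_test x \<psi>s \<gamma> r \<psi>)"
    using lim_val_tests_lower[OF L(1,2) \<psi>s \<gamma> e(1) c r] by blast+
  have "lim_val N e' (below_test x \<psi>s r) < 3 * \<gamma> / 2"
    using agree(1)[OF r_grid] low(1) by linarith
  moreover have "5 * \<gamma> / 2 < lim_val N e' (attain_test x \<psi>s \<gamma> r \<psi>)" if "\<psi> \<in> set \<psi>s" for \<psi>
    using agree(2)[OF r_grid that] low(2)[OF that] by linarith
  ultimately obtain d where d: "\<And>n. d n \<in> Dom N"
    "\<And>\<psi>. \<psi> \<in> set \<psi>s \<Longrightarrow> lim_val N (e'(x := d)) \<psi> \<le> r \<psi> + 11 * \<gamma> / 2"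
    "\<And>\<psi>. \<psi> \<in> set \<psi>s \<Longrightarrow> r \<psi> - 5 * \<gamma> / 2 \<le> lim_val N (e'(x := d)) \<psi>"
    using lim_val_tests_realise[OF L(1,3) \<psi>s \<gamma>, of e' x r] e(2) by blast
  have "\<bar>?v \<psi> - lim_val N (e'(x := d)) \<psi>\<bar> < 7 * \<gamma>" if "\<psi> \<in> set \<psi>s" for \<psi>
    using r[OF that] d(2,3)[OF that] \<gamma> by (simp add: abs_less_iff)
  then show ?thesis using d(1) by blast
qed

abbreviation seq_env :: "('f, 'p, 'a) metric_struct \<Rightarrow> (nat \<Rightarrow> nat \<Rightarrow> 'a) \<Rightarrow> bool" where
  "seq_env S e \<equiv> \<forall>y n. e y n \<in> Dom S"

lemma lim_val_bounded:
  assumes "metric_signature L" "L_structure L M" and "wf_fm L \<phi>"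
  shows "\<exists>B. \<forall>e. seq_env M e \<longrightarrow> \<bar>lim_val M e \<phi>\<bar> \<le> B"
proof -
  interpret signature_power L M "cofinite :: nat filter"
    using assms by unfold_locales auto
  obtain B where B: "\<And>e. \<forall>y. e y \<in> Dom M \<Longrightarrow> \<bar>fm_val M e \<phi>\<bar> \<le> B"
    using fm_val_bounded[OF bounded_M assms(3)] by blast
  have "\<bar>lim_val M e \<phi>\<bar> \<le> B" if "seq_env M e" for e
    unfolding lim_val_def using that by (intro real_limsup_abs_le F B) simp
  then show ?thesis by blast
qed

definition lim_agree ::
    "('f, 'p, 'a) metric_struct \<Rightarrow> ('f, 'p, 'b) metric_struct \<Rightarrow> ('f, 'p) fm set \<Rightarrow> real \<Rightarrow>
      (nat \<Rightarrow> nat \<Rightarrow> 'a) \<Rightarrow> (nat \<Rightarrow> nat \<Rightarrow> 'b) \<Rightarrow> bool" where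
  "lim_agree M N \<Psi> \<delta> e e' \<longleftrightarrow> (\<forall>\<psi>\<in>\<Psi>. \<bar>lim_val M e \<psi> - lim_val N e' \<psi>\<bar> < \<delta>)"

lemma lim_agree_mono: "lim_agree M N \<Psi> \<delta> e e' \<Longrightarrow> \<Psi>' \<subseteq> \<Psi> \<Longrightarrow> \<delta> \<le> \<delta>' \<Longrightarrow> lim_agree M N \<Psi>' \<delta>' e e'"
  unfolding lim_agree_def by (meson less_le_trans subsetD)

lemma lim_agree_commute: "lim_agree M N \<Psi> \<delta> e e' \<longleftrightarrow> lim_agree N M \<Psi> \<delta> e' e"
  by (simp add: lim_agree_def abs_minus_commute)

definition extendable ::
    "('f, 'p, 'a) metric_struct \<Rightarrow> ('f, 'p, 'b) metric_struct \<Rightarrow> nat \<Rightarrow> ('f, 'p) fm set \<Rightarrow> real \<Rightarrow>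
      (nat \<Rightarrow> nat \<Rightarrow> 'a) \<Rightarrow> (nat \<Rightarrow> nat \<Rightarrow> 'b) \<Rightarrow> bool" where
  "extendable M N x \<Psi> eps e e' \<longleftrightarrow>
    (\<forall>c. (\<forall>n. c n \<in> Dom M) \<longrightarrow> (\<exists>d. (\<forall>n. d n \<in> Dom N) \<and> lim_agree M N \<Psi> eps (e(x := c)) (e'(x := d)))) \<and>
    (\<forall>d. (\<forall>n. d n \<in> Dom N) \<longrightarrow> (\<exists>c. (\<forall>n. c n \<in> Dom M) \<and> lim_agree M N \<Psi> eps (e(x := c)) (e'(x := d))))"

text \<open>The tests are determined by \<open>\<Psi>\<close>, \<open>eps\<close>, \<open>x\<close>
  and a bound common to both structures, independently of the sequences. So one finite set of tests
  works for all assignments and in both directions.\<close>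

lemma palyutin_back_and_forth:
  assumes L: "metric_signature L" "L_structure L M" "L_structure L N"
    and fin: "finite \<Psi>" and pal: "\<forall>\<psi>\<in>\<Psi>. palyutin L \<psi>" and "eps > 0"
  shows "\<exists>\<Psi>' \<delta>. finite \<Psi>' \<and> (\<forall>\<psi>\<in>\<Psi>'. palyutin L \<psi> \<and> fv_fm \<psi> \<subseteq> (\<Union>\<psi>\<in>\<Psi>. fv_fm \<psi>) - {x}) \<and> \<delta> > 0 \<and>
    (\<forall>e e'. seq_env M e \<longrightarrow> seq_env N e' \<longrightarrow> lim_agree M N \<Psi>' \<delta> e e' \<longrightarrow>
      extendable M N x \<Psi> eps e e')"
proof (cases "\<Psi> = {}")
  case True
  have "Dom M \<noteq> {}" "Dom N \<noteq> {}" using L by (simp_all add: L_structure_def)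
  then obtain a b where "a \<in> Dom M" "b \<in> Dom N" by blast
  then show ?thesis
    using True by (intro exI[of _ "{}"] exI[of _ 1]) (auto simp: lim_agree_def extendable_def)
next
  case False
  obtain \<psi>s where \<psi>s: "set \<psi>s = \<Psi>" using finite_list fin by blast
  then have ne: "\<psi>s \<noteq> []" using False by auto
  have pal': "\<And>\<psi>. \<psi> \<in> set \<psi>s \<Longrightarrow> palyutin L \<psi>" using pal \<psi>s by simp
  \<comment> \<open>The factor 7 is the loss in \<open>lim_val_forth\<close>.\<close>
  define \<gamma> where "\<gamma> = eps / 7"
  then have \<gamma>: "\<gamma> > 0" and eps: "eps = 7 * \<gamma>" using \<open>eps > 0\<close> by simp_all
  have "\<exists>B. \<forall>\<psi>\<in>\<Psi>. \<forall>e\<in>{e. seq_env M e}. \<bar>lim_val M e \<psi>\<bar> \<le> B"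
    using lim_val_bounded[OF L(1,2)] palyutin_wf pal by (intro finite_common_bound fin) blast
  moreover have "\<exists>B. \<forall>\<psi>\<in>\<Psi>. \<forall>e\<in>{e. seq_env N e}. \<bar>lim_val N e \<psi>\<bar> \<le> B"
    using lim_val_bounded[OF L(1,3)] palyutin_wf pal by (intro finite_common_bound fin) blast
  ultimately obtain B1 B2 where B12: "\<And>\<psi> e. \<psi> \<in> \<Psi> \<Longrightarrow> seq_env M e \<Longrightarrow> \<bar>lim_val M e \<psi>\<bar> \<le> B1"
    "\<And>\<psi> e. \<psi> \<in> \<Psi> \<Longrightarrow> seq_env N e \<Longrightarrow> \<bar>lim_val N e \<psi>\<bar> \<le> B2" by blast
  define B where "B = max B1 B2"
  have B: "\<And>\<psi> e. \<psi> \<in> \<Psi> \<Longrightarrow> seq_env M e \<Longrightarrow> \<bar>lim_val M e \<psi>\<bar> \<le> B"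
    "\<And>\<psi> e. \<psi> \<in> \<Psi> \<Longrightarrow> seq_env N e \<Longrightarrow> \<bar>lim_val N e \<psi>\<bar> \<le> B"
    using B12 unfolding B_def le_max_iff_disj by blast+
  define grid where "grid = (\<lambda>k. \<gamma> * of_int k) ` {- \<lceil>B / \<gamma>\<rceil> - 1..\<lceil>B / \<gamma>\<rceil> + 1}"
  define G where "G = set \<psi>s \<rightarrow>\<^sub>E grid"
  have "finite G" unfolding G_def grid_def by (intro finite_PiE) auto
  define \<Psi>' where "\<Psi>' = below_test x \<psi>s ` G \<union> (\<lambda>(r, \<psi>). attain_test x \<psi>s \<gamma> r \<psi>) ` (G \<times> set \<psi>s)"
  have mem: "\<And>r. r \<in> set \<psi>s \<rightarrow>\<^sub>E grid \<Longrightarrow> below_test x \<psi>s r \<in> \<Psi>'"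
    "\<And>r \<psi>. r \<in> set \<psi>s \<rightarrow>\<^sub>E grid \<Longrightarrow> \<psi> \<in> set \<psi>s \<Longrightarrow> attain_test x \<psi>s \<gamma> r \<psi> \<in> \<Psi>'"
    by (auto simp: \<Psi>'_def G_def)
  have "finite \<Psi>'" using \<open>finite G\<close> by (simp add: \<Psi>'_def)
  moreover have "palyutin L \<psi> \<and> fv_fm \<psi> \<subseteq> (\<Union>\<psi>\<in>\<Psi>. fv_fm \<psi>) - {x}" if "\<psi> \<in> \<Psi>'" for \<psi>
    using that palyutin_tests[OF ne pal'] fv_tests[OF ne] unfolding \<Psi>'_def \<psi>s[symmetric] by auto
  moreover have "(\<exists>d. (\<forall>n. d n \<in> Dom N) \<and> lim_agree M N \<Psi> eps (e(x := c)) (e'(x := d)))"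
    if e: "seq_env M e" "seq_env N e'" "lim_agree M N \<Psi>' \<gamma> e e'" and c: "\<forall>n. c n \<in> Dom M"
    for e e' c
  proof -
    have "seq_env M (e(x := c))" using e c by simp
    then show ?thesis
      using lim_val_forth[OF L ne pal' \<gamma> _ _ _ _ grid_def, of e e' c x] e c mem B(1)
      unfolding lim_agree_def eps \<psi>s by blast
  qed
  moreover have "(\<exists>c. (\<forall>n. c n \<in> Dom M) \<and> lim_agree M N \<Psi> eps (e(x := c)) (e'(x := d)))"
    if e: "seq_env M e" "seq_env N e'" "lim_agree M N \<Psi>' \<gamma> e e'" and d: "\<forall>n. d n \<in> Dom N"
    for e e' d
  proof -
    have "seq_env N (e'(x := d))" using e d by simp
    moreover have "lim_agree N M \<Psi>' \<gamma> e' e" using e lim_agree_commute by blast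
    ultimately show ?thesis
      using lim_val_forth[OF L(1,3,2) ne pal' \<gamma> _ _ _ _ grid_def, of e' e d x] e d mem B(2)
      unfolding lim_agree_commute[of M] unfolding lim_agree_def eps \<psi>s by blast
  qed
  ultimately show ?thesis using \<gamma> unfolding extendable_def by (intro exI[of _ \<Psi>'] exI[of _ \<gamma>]) blast
qed

section \<open>Elementary equivalence of the Frechet powers\<close>

lemma SUP_close:
  fixes f :: "'u \<Rightarrow> real" and g :: "'v \<Rightarrow> real"
  assumes "A \<noteq> {}" "B \<noteq> {}" and bdd: "bdd_above (f ` A)" "bdd_above (g ` B)"
    and "\<And>a. a \<in> A \<Longrightarrow> \<exists>b\<in>B. \<bar>f a - g b\<bar> \<le> eps" and "\<And>b. b \<in> B \<Longrightarrow> \<exists>a\<in>A. \<bar>f a - g b\<bar> \<le> eps"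
  shows "\<bar>(SUP a\<in>A. f a) - (SUP b\<in>B. g b)\<bar> \<le> eps"
proof -
  have "(SUP a\<in>A. f a) \<le> (SUP b\<in>B. g b) + eps"
  proof (rule cSUP_least[OF assms(1)])
    fix a assume "a \<in> A"
    then obtain b where "b \<in> B" "\<bar>f a - g b\<bar> \<le> eps" using assms(5) by blast
    moreover from this have "g b \<le> (SUP b\<in>B. g b)" by (intro cSUP_upper bdd)
    ultimately show "f a \<le> (SUP b\<in>B. g b) + eps" by linarith
  qed
  moreover have "(SUP b\<in>B. g b) \<le> (SUP a\<in>A. f a) + eps"
  proof (rule cSUP_least[OF assms(2)])
    fix b assume "b \<in> B"
    then obtain a where "a \<in> A" "\<bar>f a - g b\<bar> \<le> eps" using assms(6) by blast
    moreover from this have "f a \<le> (SUP a\<in>A. f a)" by (intro cSUP_upper bdd)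
    ultimately show "g b \<le> (SUP a\<in>A. f a) + eps" by linarith
  qed
  ultimately show ?thesis by linarith
qed

lemma INF_close:
  fixes f :: "'u \<Rightarrow> real" and g :: "'v \<Rightarrow> real"
  assumes "A \<noteq> {}" "B \<noteq> {}" and bdd: "bdd_below (f ` A)" "bdd_below (g ` B)"
    and "\<And>a. a \<in> A \<Longrightarrow> \<exists>b\<in>B. \<bar>f a - g b\<bar> \<le> eps" and "\<And>b. b \<in> B \<Longrightarrow> \<exists>a\<in>A. \<bar>f a - g b\<bar> \<le> eps"
  shows "\<bar>(INF a\<in>A. f a) - (INF b\<in>B. g b)\<bar> \<le> eps"
proof -
  have "bdd_above ((\<lambda>a. - f a) ` A)" "bdd_above ((\<lambda>b. - g b) ` B)"
    using bdd unfolding bdd_above_def bdd_below_def by (auto intro: le_imp_neg_le)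
  moreover have "\<bar>- s - - t\<bar> = \<bar>s - t\<bar>" for s t :: real by simp
  ultimately have "\<bar>(SUP a\<in>A. - f a) - (SUP b\<in>B. - g b)\<bar> \<le> eps"
    using assms by (intro SUP_close) simp_all
  then show ?thesis by (simp add: Inf_real_def image_image)
qed

locale structure_pair = M: signature_power L M "cofinite :: nat filter" +
  N: signature_power L N "cofinite :: nat filter"
  for L :: "('f, 'p) metric_sig" and M :: "('f, 'p, 'a) metric_struct" and N :: "('f, 'p, 'b) metric_struct"
begin

text \<open>A finitary way of saying that the values of arbitrary formulas in the two powers are
  governed by Palyutin formulas. The inclusion of free variables makes \<open>\<Psi>\<close> consist
  of sentences when \<open>\<phi>\<close> is one.\<close>

definition approximates :: "('f, 'p) fm \<Rightarrow> real \<Rightarrow> ('f, 'p) fm set \<Rightarrow> real \<Rightarrow> bool" where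
  "approximates \<phi> eps \<Psi> \<delta> \<longleftrightarrow> finite \<Psi> \<and> (\<forall>\<psi>\<in>\<Psi>. palyutin L \<psi> \<and> fv_fm \<psi> \<subseteq> fv_fm \<phi>) \<and> \<delta> > 0 \<and>
    (\<forall>e e'. seq_env M e \<longrightarrow> seq_env N e' \<longrightarrow> lim_agree M N \<Psi> \<delta> e e' \<longrightarrow>
      \<bar>M.pval e \<phi> - N.pval e' \<phi>\<bar> < eps)"

lemma approximates_palyutin:
  assumes "palyutin L \<phi>" and "eps > 0"
  shows "approximates \<phi> eps {\<phi>} eps"
  using assms M.palyutin_fm_val[OF assms(1)] N.palyutin_fm_val[OF assms(1)]
  by (simp add: approximates_def lim_agree_def lim_val_def)

text \<open>Every element of a power is the class of a sequence, so the back-and-forth matches the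
  two ranges of quantification up to \<open>eps / 2\<close>. The halving makes up for suprema and
  infima giving only weak inequalities.\<close>

lemma approximates_quantifier:
  assumes wf: "wf_fm L \<phi>" and "eps > 0" and ex: "\<exists>\<Psi> \<delta>. approximates \<phi> (eps / 2) \<Psi> \<delta>"
  shows "\<exists>\<Psi> \<delta>. approximates (SupF x \<phi>) eps \<Psi> \<delta> \<and> approximates (InfF x \<phi>) eps \<Psi> \<delta>"
proof -
  obtain \<Psi> \<delta> where ap: "approximates \<phi> (eps / 2) \<Psi> \<delta>" using ex by blast
  have \<Psi>: "finite \<Psi>" "\<forall>\<psi>\<in>\<Psi>. palyutin L \<psi>" "\<forall>\<psi>\<in>\<Psi>. fv_fm \<psi> \<subseteq> fv_fm \<phi>" "\<delta> > 0"
    using ap by (simp_all add: approximates_def)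
  have approx: "\<bar>M.pval e \<phi> - N.pval e' \<phi>\<bar> < eps / 2"
    if "seq_env M e" "seq_env N e'" "lim_agree M N \<Psi> \<delta> e e'" for e e'
    using ap that by (simp add: approximates_def)
  from palyutin_back_and_forth[OF M.L M.M N.M \<Psi>(1,2,4), of x]
  obtain \<Psi>' \<delta>' where \<Psi>': "finite \<Psi>'" "\<forall>\<psi>\<in>\<Psi>'. palyutin L \<psi> \<and> fv_fm \<psi> \<subseteq> (\<Union>\<psi>\<in>\<Psi>. fv_fm \<psi>) - {x}" "\<delta>' > 0"
    and bf: "\<forall>e e'. seq_env M e \<longrightarrow> seq_env N e' \<longrightarrow> lim_agree M N \<Psi>' \<delta>' e e' \<longrightarrow>
      extendable M N x \<Psi> \<delta> e e'"
    by (elim exE conjE) (rule that; assumption)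
  have fv: "\<forall>\<psi>\<in>\<Psi>'. palyutin L \<psi> \<and> fv_fm \<psi> \<subseteq> fv_fm \<phi> - {x}"
    using \<Psi>'(2) \<Psi>(3) by blast
  have close: "\<bar>M.pval e (SupF x \<phi>) - N.pval e' (SupF x \<phi>)\<bar> \<le> eps / 2 \<and>
      \<bar>M.pval e (InfF x \<phi>) - N.pval e' (InfF x \<phi>)\<bar> \<le> eps / 2"
    if e: "seq_env M e" "seq_env N e'" and agree: "lim_agree M N \<Psi>' \<delta>' e e'" for e e'
  proof -
    let ?v = "\<lambda>A. fm_val M.P ((\<lambda>y. M.cl (e y))(x := A)) \<phi>"
    let ?w = "\<lambda>B. fm_val N.P ((\<lambda>y. N.cl (e' y))(x := B)) \<phi>"
    have ext: "extendable M N x \<Psi> \<delta> e e'" using bf e agree by blast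
    have eq: "\<bar>?v (M.cl c) - ?w (N.cl d)\<bar> \<le> eps / 2"
      if "\<forall>n. c n \<in> Dom M" "\<forall>n. d n \<in> Dom N" "lim_agree M N \<Psi> \<delta> (e(x := c)) (e'(x := d))" for c d
      unfolding M.cl_upd N.cl_upd using e that approx[of "e(x := c)" "e'(x := d)"]
      by (simp add: less_imp_le)
    have forth: "\<exists>B\<in>Dom N.P. \<bar>?v A - ?w B\<bar> \<le> eps / 2" if A: "A \<in> Dom M.P" for A
    proof -
      obtain c where c: "A = M.cl c" "\<forall>n. c n \<in> Dom M" using A unfolding M.Dom_P by auto
      then obtain d where d: "\<forall>n. d n \<in> Dom N" "lim_agree M N \<Psi> \<delta> (e(x := c)) (e'(x := d))"
        using ext unfolding extendable_def by blast
      have "N.cl d \<in> Dom N.P" using d(1) unfolding N.Dom_P by auto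
      then show ?thesis using eq[OF c(2) d] unfolding c(1) by blast
    qed
    have backward: "\<exists>A\<in>Dom M.P. \<bar>?v A - ?w B\<bar> \<le> eps / 2" if B: "B \<in> Dom N.P" for B
    proof -
      obtain d where d: "B = N.cl d" "\<forall>n. d n \<in> Dom N" using B unfolding N.Dom_P by auto
      then obtain c where c: "\<forall>n. c n \<in> Dom M" "lim_agree M N \<Psi> \<delta> (e(x := c)) (e'(x := d))"
        using ext unfolding extendable_def by blast
      have "M.cl c \<in> Dom M.P" using c(1) unfolding M.Dom_P by auto
      then show ?thesis using eq[OF c(1) d(2) c(2)] unfolding d(1) by blast
    qed
    have ne: "Dom M.P \<noteq> {}" "Dom N.P \<noteq> {}"
      using M.bounded_P N.bounded_P by (simp_all add: bounded_struct_def)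
    have in_P: "M.cl (e y) \<in> Dom M.P" "N.cl (e' y) \<in> Dom N.P" for y
      using e unfolding M.Dom_P N.Dom_P by auto
    note range = fm_val_range[OF M.bounded_P wf in_P(1)] fm_val_range[OF N.bounded_P wf in_P(2)]
    show ?thesis
      unfolding fm_val.simps by (intro conjI SUP_close INF_close ne range forth backward)
  qed
  have "approximates \<theta> eps \<Psi>' \<delta>'" if "\<theta> = SupF x \<phi> \<or> \<theta> = InfF x \<phi>" for \<theta>
    unfolding approximates_def
  proof (intro conjI allI impI)
    have "fv_fm \<theta> = fv_fm \<phi> - {x}" using that by auto
    then show "\<forall>\<psi>\<in>\<Psi>'. palyutin L \<psi> \<and> fv_fm \<psi> \<subseteq> fv_fm \<theta>" using fv by simp
    fix e e' assume "seq_env M e" "seq_env N e'" "lim_agree M N \<Psi>' \<delta>' e e'"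
    from close[OF this] show "\<bar>M.pval e \<theta> - N.pval e' \<theta>\<bar> < eps"
      using that \<open>eps > 0\<close> by auto
  qed (use \<Psi>' in simp_all)
  then show ?thesis by blast
qed

lemma approximates_exists:
  "wf_fm L \<phi> \<Longrightarrow> eps > 0 \<Longrightarrow> \<exists>\<Psi> \<delta>. approximates \<phi> eps \<Psi> \<delta>"
proof (induction \<phi> arbitrary: eps)
  case (DistF s t)
  then show ?case using approximates_palyutin[OF palyutin.dist[OF DistF.prems(1)] DistF.prems(2)] by blast
next
  case (PredF p ts)
  then show ?case using approximates_palyutin[OF palyutin.pred[OF PredF.prems(1)] PredF.prems(2)] by blast
next
  case (Conn C \<phi>s)
  have wf: "\<And>\<phi>. \<phi> \<in> set \<phi>s \<Longrightarrow> wf_fm L \<phi>" using Conn.prems by simp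
  have "\<exists>B. \<forall>\<phi>\<in>set \<phi>s. \<forall>e\<in>{e. \<forall>x. e x \<in> Dom M.P}. \<bar>fm_val M.P e \<phi>\<bar> \<le> B"
    using fm_val_bounded[OF M.bounded_P] wf by (intro finite_common_bound) auto
  moreover have "\<exists>B. \<forall>\<phi>\<in>set \<phi>s. \<forall>e\<in>{e. \<forall>x. e x \<in> Dom N.P}. \<bar>fm_val N.P e \<phi>\<bar> \<le> B"
    using fm_val_bounded[OF N.bounded_P] wf by (intro finite_common_bound) auto
  ultimately obtain B1 B2 where B12: "\<And>\<phi> e. \<phi> \<in> set \<phi>s \<Longrightarrow> \<forall>x. e x \<in> Dom M.P \<Longrightarrow> \<bar>fm_val M.P e \<phi>\<bar> \<le> B1"
    "\<And>\<phi> e. \<phi> \<in> set \<phi>s \<Longrightarrow> \<forall>x. e x \<in> Dom N.P \<Longrightarrow> \<bar>fm_val N.P e \<phi>\<bar> \<le> B2" by blast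
  define B where "B = max B1 B2"
  have B: "\<And>\<phi> e. \<phi> \<in> set \<phi>s \<Longrightarrow> \<forall>x. e x \<in> Dom M.P \<Longrightarrow> \<bar>fm_val M.P e \<phi>\<bar> \<le> B"
    "\<And>\<phi> e. \<phi> \<in> set \<phi>s \<Longrightarrow> \<forall>x. e x \<in> Dom N.P \<Longrightarrow> \<bar>fm_val N.P e \<phi>\<bar> \<le> B"
    using B12 unfolding B_def le_max_iff_disj by blast+
  \<comment> \<open>All argument values in both powers lie in one cube, on which \<open>C\<close> is
    uniformly continuous.\<close>
  obtain \<eta> where "\<eta> > 0" and \<eta>: "\<forall>v\<in>{..<length \<phi>s} \<rightarrow>\<^sub>E {-B..B}. \<forall>w\<in>{..<length \<phi>s} \<rightarrow>\<^sub>E {-B..B}.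
      (\<forall>k<length \<phi>s. \<bar>v k - w k\<bar> < \<eta>) \<longrightarrow> \<bar>C v - C w\<bar> < eps"
    using connective_uniformly_continuous[of "length \<phi>s" C eps B] Conn.prems by auto
  have "\<forall>\<phi>\<in>set \<phi>s. \<exists>\<Psi> \<delta>. approximates \<phi> \<eta> \<Psi> \<delta>" using Conn \<open>\<eta> > 0\<close> by simp
  then obtain \<Psi> \<delta> where \<Psi>: "\<And>\<phi>. \<phi> \<in> set \<phi>s \<Longrightarrow> approximates \<phi> \<eta> (\<Psi> \<phi>) (\<delta> \<phi>)" by metis
  define \<Psi>0 where "\<Psi>0 = (\<Union>\<phi>\<in>set \<phi>s. \<Psi> \<phi>)"
  \<comment> \<open>The element 1 keeps the set nonempty for connectives without arguments.\<close>
  define \<delta>0 where "\<delta>0 = Min (insert 1 (\<delta> ` set \<phi>s))"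
  have "\<delta>0 > 0" using \<Psi> by (auto simp: \<delta>0_def approximates_def)
  moreover have "finite \<Psi>0" using \<Psi> by (auto simp: \<Psi>0_def approximates_def)
  moreover have "palyutin L \<psi> \<and> fv_fm \<psi> \<subseteq> fv_fm (Conn C \<phi>s)" if "\<psi> \<in> \<Psi>0" for \<psi>
    using that \<Psi> by (fastforce simp: \<Psi>0_def approximates_def)
  moreover have "\<bar>M.pval e (Conn C \<phi>s) - N.pval e' (Conn C \<phi>s)\<bar> < eps"
    if e: "seq_env M e" "seq_env N e'" "lim_agree M N \<Psi>0 \<delta>0 e e'" for e e'
  proof -
    let ?v = "\<lambda>k\<in>{..<length \<phi>s}. map (fm_val M.P (\<lambda>x. M.cl (e x))) \<phi>s ! k"
    let ?w = "\<lambda>k\<in>{..<length \<phi>s}. map (fm_val N.P (\<lambda>x. N.cl (e' x))) \<phi>s ! k"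
    have in_P: "\<forall>x. M.cl (e x) \<in> Dom M.P" "\<forall>x. N.cl (e' x) \<in> Dom N.P"
      using e unfolding M.Dom_P N.Dom_P by auto
    have "?v \<in> {..<length \<phi>s} \<rightarrow>\<^sub>E {-B..B}" "?w \<in> {..<length \<phi>s} \<rightarrow>\<^sub>E {-B..B}"
      using B(1)[OF nth_mem in_P(1)] B(2)[OF nth_mem in_P(2)] by (auto simp: abs_le_iff minus_le_iff)
    moreover have "\<bar>?v k - ?w k\<bar> < \<eta>" if k: "k < length \<phi>s" for k
    proof -
      have mem: "\<phi>s ! k \<in> set \<phi>s" using k by simp
      have "lim_agree M N (\<Psi> (\<phi>s ! k)) (\<delta> (\<phi>s ! k)) e e'"
        by (rule lim_agree_mono[OF e(3)]) (use mem in \<open>auto simp: \<Psi>0_def \<delta>0_def\<close>)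
      then have "\<bar>M.pval e (\<phi>s ! k) - N.pval e' (\<phi>s ! k)\<bar> < \<eta>"
        using \<Psi>[OF mem] e unfolding approximates_def by blast
      then show ?thesis using k by simp
    qed
    ultimately show ?thesis unfolding fm_val.simps using \<eta> by blast
  qed
  ultimately have "approximates (Conn C \<phi>s) eps \<Psi>0 \<delta>0" unfolding approximates_def by blast
  then show ?case by blast
next
  case (SupF x \<phi>)
  then show ?case using approximates_quantifier[OF _ _ SupF.IH, of eps x] by auto
next
  case (InfF x \<phi>)
  then show ?case using approximates_quantifier[OF _ _ InfF.IH, of eps x] by auto
qed

lemma lim_val_sentence: "fv_fm \<phi> = {} \<Longrightarrow> lim_val M e \<phi> = sentence_val M \<phi>"
  "fv_fm \<phi> = {} \<Longrightarrow> lim_val N e' \<phi> = sentence_val N \<phi>"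
  by (simp_all add: lim_val_def sentence_val_eq real_limsup_const M.F)

text \<open>For a sentence the controlling Palyutin formulas are sentences too. They agree exactly
  by hypothesis, so the values in the two powers differ by less than every
  \<open>eps\<close>.\<close>

theorem palyutin_equiv_imp_elem_equiv:
  assumes eq: "palyutin_equiv L M N"
  shows "elem_equiv L M.P N.P"
  unfolding elem_equiv_def
proof (intro allI impI, elim conjE)
  fix \<phi> assume wf: "wf_fm L \<phi>" and fv: "fv_fm \<phi> = {}"
  obtain a b where "a \<in> Dom M" "b \<in> Dom N" using M.M N.M by (auto simp: L_structure_def)
  let ?e = "\<lambda>(_ :: nat) (_ :: nat). a" and ?e' = "\<lambda>(_ :: nat) (_ :: nat). b"
  have "\<bar>sentence_val M.P \<phi> - sentence_val N.P \<phi>\<bar> < eps" if "eps > 0" for eps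
  proof -
    obtain \<Psi> \<delta> where "approximates \<phi> eps \<Psi> \<delta>" using approximates_exists[OF wf \<open>eps > 0\<close>] by blast
    then have \<Psi>: "\<forall>\<psi>\<in>\<Psi>. palyutin L \<psi> \<and> fv_fm \<psi> = {}" "\<delta> > 0"
      and close: "lim_agree M N \<Psi> \<delta> ?e ?e' \<Longrightarrow>
        \<bar>M.pval ?e \<phi> - N.pval ?e' \<phi>\<bar> < eps"
      using \<open>a \<in> Dom M\<close> \<open>b \<in> Dom N\<close> unfolding approximates_def fv by auto
    have "lim_agree M N \<Psi> \<delta> ?e ?e'"
      using \<Psi> eq by (simp add: lim_agree_def lim_val_sentence palyutin_equiv_def)
    from close[OF this] show ?thesis by (simp add: sentence_val_eq[OF fv])
  qed
  from this[of "\<bar>sentence_val M.P \<phi> - sentence_val N.P \<phi>\<bar>"]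
  show "sentence_val M.P \<phi> = sentence_val N.P \<phi>" by auto
qed

end

section \<open>Renaming of variables\<close>

fun rename_trm :: "(nat \<Rightarrow> nat) \<Rightarrow> 'f trm \<Rightarrow> 'f trm" where
  "rename_trm \<rho> (Var x) = Var (\<rho> x)"
| "rename_trm \<rho> (App f ts) = App f (map (rename_trm \<rho>) ts)"

lemma trm_val_rename: "trm_val S e (rename_trm \<rho> t) = trm_val S (\<lambda>x. e (\<rho> x)) t"
  by (induction t) (simp_all add: o_def cong: map_cong)

lemma wf_rename_trm: "wf_trm L t \<Longrightarrow> wf_trm L (rename_trm \<rho> t)"
  by (induction t) auto

lemma fv_rename_trm: "fv_trm (rename_trm \<rho> t) = \<rho> ` fv_trm t"
  by (induction t) auto

lemma fresh_variable:
  fixes \<rho> :: "nat \<Rightarrow> nat"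
  shows "\<exists>y. y \<notin> \<rho> ` (fv_fm \<phi> - {x}) \<and> y \<notin> \<rho> ` (fv_fm \<psi> - {x})"
proof -
  have "finite (\<rho> ` (fv_fm \<phi> - {x}) \<union> \<rho> ` (fv_fm \<psi> - {x}))"
    by (simp add: finite_fv_fm)
  from ex_new_if_finite[OF infinite_UNIV_nat this] show ?thesis by blast
qed

text \<open>Two structures are needed since a HOL predicate cannot quantify over types.\<close>

definition renaming ::
    "('f, 'p, 'a) metric_struct \<Rightarrow> ('f, 'p, 'b) metric_struct \<Rightarrow> (nat \<Rightarrow> nat) \<Rightarrow>
      ('f, 'p) fm \<Rightarrow> ('f, 'p) fm \<Rightarrow> bool" where
  "renaming M N \<rho> \<phi> \<phi>' \<longleftrightarrow> fv_fm \<phi>' \<subseteq> \<rho> ` fv_fm \<phi> \<and>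
    (\<forall>e. fm_val M e \<phi>' = fm_val M (\<lambda>x. e (\<rho> x)) \<phi>) \<and> (\<forall>e. fm_val N e \<phi>' = fm_val N (\<lambda>x. e (\<rho> x)) \<phi>)"

text \<open>Freshness of \<open>y\<close> prevents renamed free variables from being
  captured.\<close>

lemma renaming_binder:
  assumes r: "renaming M N (\<rho>(x := y)) \<phi> \<phi>'" and y: "y \<notin> \<rho> ` (fv_fm \<phi> - {x})"
  shows "fv_fm \<phi>' - {y} \<subseteq> \<rho> ` (fv_fm \<phi> - {x})"
    and "fm_val M (e(y := a)) \<phi>' = fm_val M ((\<lambda>z. e (\<rho> z))(x := a)) \<phi>"
    and "fm_val N (e'(y := b)) \<phi>' = fm_val N ((\<lambda>z. e' (\<rho> z))(x := b)) \<phi>"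
proof -
  have upd: "fm_val S (\<lambda>z. (e(y := a)) ((\<rho>(x := y)) z)) \<phi> = fm_val S ((\<lambda>z. e (\<rho> z))(x := a)) \<phi>"
    for S e and a :: 'z
    by (rule fm_val_cong) (use y in auto)
  show "fv_fm \<phi>' - {y} \<subseteq> \<rho> ` (fv_fm \<phi> - {x})" using r by (auto simp: renaming_def)
  show "fm_val M (e(y := a)) \<phi>' = fm_val M ((\<lambda>z. e (\<rho> z))(x := a)) \<phi>"
    "fm_val N (e'(y := b)) \<phi>' = fm_val N ((\<lambda>z. e' (\<rho> z))(x := b)) \<phi>"
    using r unfolding renaming_def upd[symmetric] by blast+
qed

text \<open>This puts tests about different lists of points on a common list. As
  \<open>\<rho>\<close> may identify variables, each binder receives a fresh variable; in clause (5)
  it has to be fresh for both subformulas.\<close>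

lemma palyutin_rename:
  "palyutin L \<phi> \<Longrightarrow> \<exists>\<phi>'. palyutin L \<phi>' \<and> renaming M N \<rho> \<phi> \<phi>'"
proof (induction arbitrary: \<rho> rule: palyutin.induct)
  case (dist s t)
  then show ?case
    by (intro exI[of _ "DistF (rename_trm \<rho> s) (rename_trm \<rho> t)"])
      (auto intro!: palyutin.dist simp: renaming_def wf_rename_trm trm_val_rename fv_rename_trm)
next
  case (pred p ts)
  then show ?case
    by (intro exI[of _ "PredF p (map (rename_trm \<rho>) ts)"])
      (auto intro!: palyutin.pred simp: renaming_def wf_rename_trm trm_val_rename fv_rename_trm o_def)
next
  case (conn \<phi> C)
  obtain \<phi>' where "palyutin L \<phi>'" "renaming M N \<rho> \<phi> \<phi>'" using conn.IH by blast
  then show ?case using conn.hyps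
    by (intro exI[of _ "Conn1 C \<phi>'"]) (auto intro: palyutin.conn simp: renaming_def)
next
  case (max \<phi> \<psi>)
  obtain \<phi>' where \<phi>': "palyutin L \<phi>'" "renaming M N \<rho> \<phi> \<phi>'" using max.IH(1) by blast
  obtain \<psi>' where \<psi>': "palyutin L \<psi>'" "renaming M N \<rho> \<psi> \<psi>'" using max.IH(2) by blast
  have "palyutin L (MaxF \<phi>' \<psi>')" using \<phi>'(1) \<psi>'(1) by (rule palyutin.max)
  moreover have "renaming M N \<rho> (MaxF \<phi> \<psi>) (MaxF \<phi>' \<psi>')" using \<phi>'(2) \<psi>'(2) by (auto simp: renaming_def)
  ultimately show ?case by blast
next
  case (inf \<phi> x)
  obtain y where y: "y \<notin> \<rho> ` (fv_fm \<phi> - {x})" using fresh_variable[of \<rho> \<phi> x \<phi>] by blast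
  obtain \<phi>' where \<phi>': "palyutin L \<phi>'" "renaming M N (\<rho>(x := y)) \<phi> \<phi>'" using inf.IH by blast
  have "palyutin L (InfF y \<phi>')" using \<phi>'(1) by (rule palyutin.inf)
  moreover have "renaming M N \<rho> (InfF x \<phi>) (InfF y \<phi>')"
    using renaming_binder[OF \<phi>'(2) y] by (simp add: renaming_def)
  ultimately show ?case by blast
next
  case (sup \<phi> x)
  obtain y where y: "y \<notin> \<rho> ` (fv_fm \<phi> - {x})" using fresh_variable[of \<rho> \<phi> x \<phi>] by blast
  obtain \<phi>' where \<phi>': "palyutin L \<phi>'" "renaming M N (\<rho>(x := y)) \<phi> \<phi>'" using sup.IH by blast
  have "palyutin L (SupF y \<phi>')" using \<phi>'(1) by (rule palyutin.sup)
  moreover have "renaming M N \<rho> (SupF x \<phi>) (SupF y \<phi>')"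
    using renaming_binder[OF \<phi>'(2) y] by (simp add: renaming_def)
  ultimately show ?case by blast
next
  case (pal \<phi> \<psi> D \<Delta> x)
  obtain y where y: "y \<notin> \<rho> ` (fv_fm \<phi> - {x})" "y \<notin> \<rho> ` (fv_fm \<psi> - {x})"
    using fresh_variable[of \<rho> \<phi> x \<psi>] by blast
  obtain \<phi>' where \<phi>': "palyutin L \<phi>'" "renaming M N (\<rho>(x := y)) \<phi> \<phi>'" using pal.IH(1) by blast
  obtain \<psi>' where \<psi>': "palyutin L \<psi>'" "renaming M N (\<rho>(x := y)) \<psi> \<psi>'" using pal.IH(2) by blast
  let ?\<theta> = "\<lambda>x \<phi> \<psi>. MaxF (InfF x \<phi>) (SupF x (MinF (Conn1 D \<phi>) (MinF (ConstF \<Delta>) \<psi>)))"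
  have "palyutin L (?\<theta> y \<phi>' \<psi>')" using pal.hyps \<phi>'(1) \<psi>'(1) by (intro palyutin.pal)
  moreover have "renaming M N \<rho> (?\<theta> x \<phi> \<psi>) (?\<theta> y \<phi>' \<psi>')"
    using renaming_binder[OF \<phi>'(2) y(1)] renaming_binder[OF \<psi>'(2) y(2)] by (auto simp: renaming_def)
  ultimately show ?case by blast
qed

section \<open>Isomorphic reduced powers\<close>

text \<open>Atomic formulas are enough: preserved distances make \<open>h\<close> injective, and
  \<open>h\<close> commutes with a function symbol because the distance between a variable and the
  applied term keeps its value 0.\<close>

lemma isomorphicI_palyutin:
  assumes M: "bounded_struct L M" "\<And>a b. a \<in> Dom M \<Longrightarrow> b \<in> Dom M \<Longrightarrow> Met M a b = 0 \<longleftrightarrow> a = b"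
    and N: "bounded_struct L N" "\<And>a b. a \<in> Dom N \<Longrightarrow> b \<in> Dom N \<Longrightarrow> Met N a b = 0 \<longleftrightarrow> a = b"
    and surj: "h ` Dom M = Dom N"
    and val: "\<And>\<phi> e. palyutin L \<phi> \<Longrightarrow> \<forall>x. e x \<in> Dom M \<Longrightarrow> fm_val N (\<lambda>x. h (e x)) \<phi> = fm_val M e \<phi>"
  shows "isomorphic L M N"
proof -
  have hN: "h a \<in> Dom N" if "a \<in> Dom M" for a using surj that by blast
  have dist: "Met N (h a) (h b) = Met M a b" if "a \<in> Dom M" "b \<in> Dom M" for a b
    using val[of "DistF (Var 0) (Var 1)" "\<lambda>x. if x = 0 then a else b"] that by (simp add: palyutin.dist)
  have "inj_on h (Dom M)"
    by (rule inj_onI) (metis M(2) N(2) dist hN)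
  then have bij: "bij_betw h (Dom M) (Dom N)" using surj by (simp add: bij_betw_def)
  obtain a0 where a0: "a0 \<in> Dom M" using M(1) by (auto simp: bounded_struct_def)
  have PredI: "PredI N p (map h as) = PredI M p as"
    if p: "p \<in> PredSyms L" and as: "as \<in> tuples (Dom M) (PredArity L p)" for p as
  proof -
    let ?e = "\<lambda>x. if x < PredArity L p then as ! x else a0"
    have e: "\<forall>x. ?e x \<in> Dom M" using a0 as nth_mem by (auto simp: tuples_def)
    have list: "map (\<lambda>x. g (?e x)) [0..<PredArity L p] = map g as" for g :: "_ \<Rightarrow> 'z"
      using as by (intro nth_equalityI) (auto simp: tuples_def)
    have "fm_val N (\<lambda>x. h (?e x)) (PredF p (map Var [0..<PredArity L p])) =
        fm_val M ?e (PredF p (map Var [0..<PredArity L p]))"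
      using p by (intro val e palyutin.pred) simp
    then show ?thesis using list[of h] list[of "\<lambda>a. a"] by (simp add: o_def)
  qed
  have FunI: "FunI N f (map h as) = h (FunI M f as)"
    if f: "f \<in> FunSyms L" and as: "as \<in> tuples (Dom M) (FunArity L f)" for f as
  proof -
    let ?n = "FunArity L f"
    \<comment> \<open>Variable 0 names the value of the function and variable \<open>Suc k\<close>
      its \<open>k\<close>-th argument.\<close>
    let ?e = "\<lambda>x. case x of 0 \<Rightarrow> FunI M f as | Suc k \<Rightarrow> if k < ?n then as ! k else a0"
    let ?\<phi> = "DistF (Var 0) (App f (map (\<lambda>k. Var (Suc k)) [0..<?n]))"
    have fM: "FunI M f as \<in> Dom M" using M(1) f as by (simp add: bounded_struct_def)
    then have e: "\<forall>x. ?e x \<in> Dom M" using a0 as nth_mem by (auto simp: tuples_def split: nat.split)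
    have list: "map (\<lambda>k. g (?e (Suc k))) [0..<?n] = map g as" for g :: "_ \<Rightarrow> 'z"
      using as by (intro nth_equalityI) (auto simp: tuples_def)
    have "map h as \<in> tuples (Dom N) ?n" using as hN by (auto simp: tuples_def)
    then have fN: "FunI N f (map h as) \<in> Dom N" using N(1) f by (simp add: bounded_struct_def)
    have "fm_val N (\<lambda>x. h (?e x)) ?\<phi> = fm_val M ?e ?\<phi>"
      using f by (intro val e palyutin.dist) auto
    moreover have "fm_val N (\<lambda>x. h (?e x)) ?\<phi> = Met N (h (FunI M f as)) (FunI N f (map h as))"
      using list[of h] by (simp add: o_def)
    moreover have "fm_val M ?e ?\<phi> = Met M (FunI M f as) (FunI M f as)"
      using list[of "\<lambda>a. a"] by (simp add: o_def)
    ultimately have "Met N (h (FunI M f as)) (FunI N f (map h as)) = 0" using M(2)[OF fM fM] by simp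
    then show ?thesis using N(2)[OF hN[OF fM] fN] by simp
  qed
  show ?thesis unfolding isomorphic_def using bij dist FunI PredI by blast
qed

text \<open>The matching \<open>R\<close> need not be a function. As the distance is a Palyutin
  formula, pairs of \<open>R\<close> whose left classes coincide have equal right classes, and vice
  versa, so every choice of partners induces the same bijection of classes.\<close>

lemma isomorphic_reduced_powersI:
  fixes F :: "'i filter" and R :: "(('i \<Rightarrow> 'a) \<times> ('i \<Rightarrow> 'b)) set"
  assumes L: "metric_signature L" "L_structure L M" "L_structure L N" and F: "F \<noteq> bot"
    and R: "\<And>a b i. (a, b) \<in> R \<Longrightarrow> a i \<in> Dom M \<and> b i \<in> Dom N"
    and left: "\<And>a. \<forall>i. a i \<in> Dom M \<Longrightarrow> \<exists>b. (a, b) \<in> R"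
    and right: "\<And>b. \<forall>i. b i \<in> Dom N \<Longrightarrow> \<exists>a. (a, b) \<in> R"
    and eq: "\<And>e \<phi>. palyutin L \<phi> \<Longrightarrow> \<forall>x. e x \<in> R \<Longrightarrow>
      real_limsup F (\<lambda>i. fm_val M (\<lambda>x. fst (e x) i) \<phi>) = real_limsup F (\<lambda>i. fm_val N (\<lambda>x. snd (e x) i) \<phi>)"
  shows "isomorphic L (reduced_power M F) (reduced_power N F)"
proof -
  interpret M: signature_power L M F by unfold_locales (use L F in auto)
  interpret N: signature_power L N F by unfold_locales (use L F in auto)
  have RM: "fst p \<in> M.Seqs" and RN: "snd p \<in> N.Seqs" if "p \<in> R" for p
    using R[of "fst p" "snd p"] that by auto
  then have cl_in: "M.cl (fst p) \<in> Dom M.P" "N.cl (snd p) \<in> Dom N.P" if "p \<in> R" for p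
    using that unfolding M.Dom_P N.Dom_P by blast+
  have val: "fm_val N.P (\<lambda>x. N.cl (snd (e x))) \<phi> = fm_val M.P (\<lambda>x. M.cl (fst (e x))) \<phi>"
    if "palyutin L \<phi>" "\<forall>x. e x \<in> R" for e \<phi>
    using M.palyutin_fm_val[OF that(1), of "\<lambda>x. fst (e x)"] N.palyutin_fm_val[OF that(1), of "\<lambda>x. snd (e x)"]
      eq[OF that] RM RN that(2) by simp
  define pick where "pick A = (SOME p. p \<in> R \<and> M.cl (fst p) = A)" for A
  define h where "h A = N.cl (snd (pick A))" for A
  have pick: "pick A \<in> R" "M.cl (fst (pick A)) = A" if A: "A \<in> Dom M.P" for A
  proof -
    obtain a where a: "A = M.cl a" "\<forall>i. a i \<in> Dom M" using A unfolding M.Dom_P by auto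
    then obtain b where "(a, b) \<in> R" using left by blast
    then have "\<exists>p. p \<in> R \<and> M.cl (fst p) = A" using a by force
    then have "pick A \<in> R \<and> M.cl (fst (pick A)) = A" unfolding pick_def by (rule someI_ex)
    then show "pick A \<in> R" "M.cl (fst (pick A)) = A" by simp_all
  qed
  show ?thesis
  proof (rule isomorphicI_palyutin[OF M.bounded_P M.Met_P_eq_0_iff N.bounded_P N.Met_P_eq_0_iff])
    show "h ` Dom M.P = Dom N.P"
    proof (intro equalityI subsetI)
      fix B assume "B \<in> h ` Dom M.P"
      then show "B \<in> Dom N.P" using pick(1) cl_in(2) unfolding h_def by blast
    next
      fix B assume "B \<in> Dom N.P"
      then obtain b where b: "B = N.cl b" "\<forall>i. b i \<in> Dom N" unfolding N.Dom_P by auto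
      then obtain a where ab: "(a, b) \<in> R" using right by blast
      \<comment> \<open>The partner picked for the class of \<open>a\<close> may differ from
        \<open>b\<close>, but it has distance 0 from \<open>b\<close> in the power.\<close>
      let ?q = "pick (M.cl a)"
      have a: "M.cl a \<in> Dom M.P" using cl_in(1)[OF ab] by simp
      have "Met N.P (N.cl (snd ?q)) (N.cl b) = Met M.P (M.cl (fst ?q)) (M.cl a)"
        using val[of "DistF (Var 0) (Var 1)" "\<lambda>x. if x = 0 then ?q else (a, b)"] pick(1)[OF a] ab
        by (simp add: palyutin.dist)
      also have "\<dots> = 0" using M.Met_P_eq_0_iff[OF a a] pick(2)[OF a] by simp
      finally have "h (M.cl a) = B"
        using N.Met_P_eq_0_iff[OF cl_in(2)[OF pick(1)[OF a]] cl_in(2)[OF ab]] by (simp add: h_def b(1))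
      with a show "B \<in> h ` Dom M.P" by blast
    qed
    show "fm_val N.P (\<lambda>x. h (E x)) \<phi> = fm_val M.P E \<phi>" if "palyutin L \<phi>" "\<forall>x. E x \<in> Dom M.P" for \<phi> E
      using val[OF that(1), of "\<lambda>x. pick (E x)"] pick that(2) by (simp add: h_def)
  qed
qed

section \<open>Iterated filters\<close>

text \<open>The Fubini product: a set is large if \<open>F\<close>-almost all of its sections are
  \<open>E\<close>-large.\<close>

definition iterated_filter :: "'i filter \<Rightarrow> 'j filter \<Rightarrow> ('i \<times> 'j) filter" where
  "iterated_filter F E = Abs_filter (\<lambda>P. eventually (\<lambda>i. eventually (\<lambda>j. P (i, j)) E) F)"

lemma eventually_iterated:
  "eventually P (iterated_filter F E) \<longleftrightarrow> eventually (\<lambda>i. eventually (\<lambda>j. P (i, j)) E) F"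
  unfolding iterated_filter_def
proof (rule eventually_Abs_filter, unfold_locales)
  fix P Q assume "eventually (\<lambda>i. eventually (\<lambda>j. P (i, j)) E) F" "eventually (\<lambda>i. eventually (\<lambda>j. Q (i, j)) E) F"
  then show "eventually (\<lambda>i. eventually (\<lambda>j. P (i, j) \<and> Q (i, j)) E) F"
    by eventually_elim (rule eventually_conj)
next
  fix P Q assume "\<forall>x. P x \<longrightarrow> Q x" "eventually (\<lambda>i. eventually (\<lambda>j. P (i, j)) E) F"
  then show "eventually (\<lambda>i. eventually (\<lambda>j. Q (i, j)) E) F"
    by (elim eventually_mono) (auto elim: eventually_mono)
qed simp

lemma iterated_filter_not_bot: "F \<noteq> bot \<Longrightarrow> E \<noteq> bot \<Longrightarrow> iterated_filter F E \<noteq> bot"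
  unfolding trivial_limit_def eventually_iterated by (simp add: trivial_limit_def)

lemma real_limsup_iterated:
  assumes F: "F \<noteq> bot" "E \<noteq> bot" and w: "bounded (range w)"
  shows "real_limsup (iterated_filter F E) w = real_limsup F (\<lambda>i. real_limsup E (\<lambda>j. w (i, j)))"
proof (rule real_limsup_eqI)
  fix r
  obtain B where B: "\<And>x. \<bar>w x\<bar> \<le> B" using w unfolding bounded_range_iff_abs by blast
  have wi: "bounded (range (\<lambda>j. w (i, j)))" for i
    using B unfolding bounded_range_iff_abs by blast
  have "\<bar>real_limsup E (\<lambda>j. w (i, j))\<bar> \<le> B" for i by (intro real_limsup_abs_le F B)
  then have lim: "bounded (range (\<lambda>i. real_limsup E (\<lambda>j. w (i, j))))"
    unfolding bounded_range_iff_abs by blast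
  have "(\<forall>s>r. eventually (\<lambda>i. eventually (\<lambda>j. w (i, j) < s) E) F) \<longleftrightarrow>
      (\<forall>s>r. eventually (\<lambda>i. real_limsup E (\<lambda>j. w (i, j)) < s) F)"
  proof (intro iffI allI impI)
    fix s assume *: "\<forall>s>r. eventually (\<lambda>i. eventually (\<lambda>j. w (i, j) < s) E) F" and "r < s"
    \<comment> \<open>The inner limit superior inherits only a weak inequality, so an intermediate
      bound is used first.\<close>
    then obtain s' where "r < s'" "s' < s" using dense by blast
    have "eventually (\<lambda>i. eventually (\<lambda>j. w (i, j) < s') E) F" using * \<open>r < s'\<close> by blast
    then show "eventually (\<lambda>i. real_limsup E (\<lambda>j. w (i, j)) < s) F"
    proof eventually_elim
      case (elim i)
      then have "real_limsup E (\<lambda>j. w (i, j)) \<le> s'"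
        by (intro real_limsup_leI F wi) (auto elim: eventually_mono)
      with \<open>s' < s\<close> show ?case by simp
    qed
  next
    fix s assume *: "\<forall>s>r. eventually (\<lambda>i. real_limsup E (\<lambda>j. w (i, j)) < s) F" and "r < s"
    then have "eventually (\<lambda>i. real_limsup E (\<lambda>j. w (i, j)) < s) F" by blast
    then show "eventually (\<lambda>i. eventually (\<lambda>j. w (i, j) < s) E) F"
      by eventually_elim (rule real_limsup_less_eventually[OF F(2) wi])
  qed
  then show "real_limsup (iterated_filter F E) w \<le> r \<longleftrightarrow>
      real_limsup F (\<lambda>i. real_limsup E (\<lambda>j. w (i, j))) \<le> r"
    by (simp add: real_limsup_le_iff[OF F(1) lim] eventually_iterated
        real_limsup_le_iff[OF iterated_filter_not_bot[OF F] w])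
qed

lemma real_limsup_filtermap:
  assumes "F \<noteq> bot" and "bounded (range u)"
  shows "real_limsup (filtermap h F) u = real_limsup F (\<lambda>i. u (h i))"
proof (rule real_limsup_eqI)
  fix r
  have "bounded (range (\<lambda>i. u (h i)))" using assms(2) by (rule bounded_subset) auto
  then show "real_limsup (filtermap h F) u \<le> r \<longleftrightarrow> real_limsup F (\<lambda>i. u (h i)) \<le> r"
    using assms by (simp add: real_limsup_le_iff filtermap_bot_iff eventually_filtermap)
qed

text \<open>Along \<open>h\<close> the product filter is moved to another index type. A family over
  that type is read as a family of sequences, and the inner limit superior becomes
  \<open>lim_val\<close>.\<close>

lemma real_limsup_iterated_power:
  assumes L: "metric_signature L" "L_structure L M" and F: "F \<noteq> bot" and \<phi>: "wf_fm L \<phi>"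
    and e: "\<And>x i n. e x i n \<in> Dom M" and h: "\<And>y. inv h (h y) = y"
  shows "bounded (range (\<lambda>i. lim_val M (\<lambda>x. e x i) \<phi>))"
    and "real_limsup (filtermap h (iterated_filter F cofinite))
        (\<lambda>j. fm_val M (\<lambda>x. e x (fst (inv h j)) (snd (inv h j))) \<phi>) = real_limsup F (\<lambda>i. lim_val M (\<lambda>x. e x i) \<phi>)"
proof -
  obtain B where "\<And>e. seq_env M e \<Longrightarrow> \<bar>lim_val M e \<phi>\<bar> \<le> B"
    using lim_val_bounded[OF L \<phi>] by blast
  then show "bounded (range (\<lambda>i. lim_val M (\<lambda>x. e x i) \<phi>))"
    unfolding bounded_range_iff_abs using e by (intro exI[of _ B]) simp
  obtain B' where B': "\<And>e. \<forall>x. e x \<in> Dom M \<Longrightarrow> \<bar>fm_val M e \<phi>\<bar> \<le> B'"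
    using fm_val_bounded[OF L_structure_bounded[OF L(2)] \<phi>] by blast
  have b: "bounded (range (\<lambda>j. fm_val M (\<lambda>x. e x (fst (inv h j)) (snd (inv h j))) \<phi>))"
    "bounded (range (\<lambda>y. fm_val M (\<lambda>x. e x (fst y) (snd y)) \<phi>))"
    unfolding bounded_range_iff_abs using e by (intro exI[of _ B'] allI B'; simp)+
  have cof: "(cofinite :: nat filter) \<noteq> bot" by simp
  show "real_limsup (filtermap h (iterated_filter F cofinite))
        (\<lambda>j. fm_val M (\<lambda>x. e x (fst (inv h j)) (snd (inv h j))) \<phi>) = real_limsup F (\<lambda>i. lim_val M (\<lambda>x. e x i) \<phi>)"
    unfolding real_limsup_filtermap[OF iterated_filter_not_bot[OF F cof] b(1)] h
      real_limsup_iterated[OF F cof b(2)] by (simp add: lim_val_def)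
qed

section \<open>Construction of the filter\<close>

context structure_pair
begin

definition default_M :: "nat \<Rightarrow> 'a" where "default_M = (\<lambda>_. SOME a. a \<in> Dom M)"
definition default_N :: "nat \<Rightarrow> 'b" where "default_N = (\<lambda>_. SOME b. b \<in> Dom N)"

lemma default_in: "default_M n \<in> Dom M" "default_N n \<in> Dom N"
  using M.M N.M by (simp_all add: default_M_def default_N_def L_structure_def some_in_eq)

text \<open>Variable \<open>k\<close> stands for the \<open>k\<close>-th point of the list; the
  default completes the assignment to a total one.\<close>

definition env_M :: "((nat \<Rightarrow> 'a) \<times> (nat \<Rightarrow> 'b)) list \<Rightarrow> nat \<Rightarrow> nat \<Rightarrow> 'a" where
  "env_M ps k = (if k < length ps then fst (ps ! k) else default_M)"

definition env_N :: "((nat \<Rightarrow> 'a) \<times> (nat \<Rightarrow> 'b)) list \<Rightarrow> nat \<Rightarrow> nat \<Rightarrow> 'b" where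
  "env_N ps k = (if k < length ps then snd (ps ! k) else default_N)"

definition points :: "((nat \<Rightarrow> 'a) \<times> (nat \<Rightarrow> 'b)) set" where
  "points = M.Seqs \<times> N.Seqs"

definition test :: "('f, 'p) fm \<Rightarrow> real \<Rightarrow> ((nat \<Rightarrow> 'a) \<times> (nat \<Rightarrow> 'b)) list \<Rightarrow> bool" where
  "test \<phi> eps ps \<longleftrightarrow> \<bar>lim_val M (env_M ps) \<phi> - lim_val N (env_N ps) \<phi>\<bar> < eps"

definition tests_of_arity :: "nat \<Rightarrow> (((nat \<Rightarrow> 'a) \<times> (nat \<Rightarrow> 'b)) list \<Rightarrow> bool) set" where
  "tests_of_arity n = {test \<phi> eps | \<phi> eps. palyutin L \<phi> \<and> fv_fm \<phi> \<subseteq> {..<n} \<and> eps > 0}"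

definition demands :: "((nat \<Rightarrow> 'a) \<times> (nat \<Rightarrow> 'b)) set set" where
  "demands = (\<lambda>c. {c} \<times> N.Seqs) ` M.Seqs \<union> (\<lambda>d. M.Seqs \<times> {d}) ` N.Seqs"

lemma lim_val_cong: "(\<And>x. x \<in> fv_fm \<phi> \<Longrightarrow> e x = e' x) \<Longrightarrow> lim_val S e \<phi> = lim_val S e' \<phi>"
  unfolding lim_val_def by (intro arg_cong[where f="real_limsup cofinite"] ext fm_val_cong) simp

lemma env_in:
  assumes "ps \<in> lists points"
  shows "env_M ps y n \<in> Dom M" "env_N ps y n \<in> Dom N"
proof -
  have "ps ! y \<in> points" if "y < length ps" using assms nth_mem[OF that] by auto
  then show "env_M ps y n \<in> Dom M" "env_N ps y n \<in> Dom N"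
    using default_in by (auto simp: env_M_def env_N_def points_def)
qed

lemma env_snoc:
  "env_M (ps @ [(c, d)]) = (env_M ps)(length ps := c)"
  "env_N (ps @ [(c, d)]) = (env_N ps)(length ps := d)"
  by (auto simp: env_M_def env_N_def fun_eq_iff nth_append)

text \<open>Palyutin equivalence enters the construction here: conditions on no points are
  statements about sentences.\<close>

lemma tests_base:
  assumes eq: "palyutin_equiv L M N" and "Q \<in> tests_of_arity 0"
  shows "Q []"
  using assms by (auto simp: tests_of_arity_def test_def lim_val_sentence palyutin_equiv_def)

lemma tests_rename:
  assumes "Q \<in> tests_of_arity n" and \<rho>: "\<And>k. k < n \<Longrightarrow> \<rho> k < m"
  shows "\<exists>Q'\<in>tests_of_arity m. \<forall>ps. length ps = m \<longrightarrow> Q' ps = Q (map (\<lambda>k. ps ! \<rho> k) [0..<n])"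
proof -
  obtain \<phi> eps where Q: "Q = test \<phi> eps" "palyutin L \<phi>" "fv_fm \<phi> \<subseteq> {..<n}" "eps > 0"
    using assms(1) by (auto simp: tests_of_arity_def)
  obtain \<phi>' where \<phi>': "palyutin L \<phi>'" "fv_fm \<phi>' \<subseteq> \<rho> ` fv_fm \<phi>"
    "\<forall>e. fm_val M e \<phi>' = fm_val M (\<lambda>x. e (\<rho> x)) \<phi>" "\<forall>e. fm_val N e \<phi>' = fm_val N (\<lambda>x. e (\<rho> x)) \<phi>"
    using palyutin_rename[OF Q(2), of M N \<rho>] unfolding renaming_def by blast
  have "fv_fm \<phi>' \<subseteq> {..<m}" using \<phi>'(2) Q(3) \<rho> by auto
  then have "test \<phi>' eps \<in> tests_of_arity m"
    unfolding tests_of_arity_def using \<phi>'(1) Q(4) by blast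
  moreover have "test \<phi>' eps ps = Q (map (\<lambda>k. ps ! \<rho> k) [0..<n])" if ps: "length ps = m" for ps
  proof -
    have "lim_val M (env_M ps) \<phi>' = lim_val M (\<lambda>x. env_M ps (\<rho> x)) \<phi>"
      "lim_val N (env_N ps) \<phi>' = lim_val N (\<lambda>x. env_N ps (\<rho> x)) \<phi>"
      using \<phi>'(3,4) by (simp_all add: lim_val_def)
    moreover have "lim_val M (\<lambda>x. env_M ps (\<rho> x)) \<phi> = lim_val M (env_M (map (\<lambda>k. ps ! \<rho> k) [0..<n])) \<phi>"
      "lim_val N (\<lambda>x. env_N ps (\<rho> x)) \<phi> = lim_val N (env_N (map (\<lambda>k. ps ! \<rho> k) [0..<n])) \<phi>"
      using Q(3) ps \<rho> by (auto intro!: lim_val_cong simp: env_M_def env_N_def)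
    ultimately show ?thesis by (simp add: Q(1) test_def)
  qed
  ultimately show ?thesis by blast
qed

text \<open>One step of the back-and-forth at the variable \<open>n\<close>, which denotes the point
  to be appended to a list of length \<open>n\<close>.\<close>

lemma tests_extend:
  assumes fin: "finite \<Q>" and \<Q>: "\<Q> \<subseteq> tests_of_arity (Suc n)"
  shows "\<exists>\<Q>'. finite \<Q>' \<and> \<Q>' \<subseteq> tests_of_arity n \<and> (\<forall>ps\<in>lists points. length ps = n \<longrightarrow>
    (\<forall>Q\<in>\<Q>'. Q ps) \<longrightarrow> (\<forall>d\<in>demands. \<exists>x\<in>d. \<forall>Q\<in>\<Q>. Q (ps @ [x])))"
proof -
  have "\<forall>Q\<in>\<Q>. \<exists>\<phi> eps. Q = test \<phi> eps \<and> palyutin L \<phi> \<and> fv_fm \<phi> \<subseteq> {..<Suc n} \<and> eps > 0"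
    using \<Q> unfolding tests_of_arity_def by blast
  then obtain \<phi> eps where Q: "\<And>Q. Q \<in> \<Q> \<Longrightarrow> Q = test (\<phi> Q) (eps Q) \<and> palyutin L (\<phi> Q) \<and>
      fv_fm (\<phi> Q) \<subseteq> {..<Suc n} \<and> eps Q > 0" by metis
  define \<Psi> where "\<Psi> = \<phi> ` \<Q>"
  \<comment> \<open>One tolerance for all the finitely many tests; the element 1 covers the case of
    none.\<close>
  define eps0 where "eps0 = Min (insert 1 (eps ` \<Q>))"
  have \<Psi>: "finite \<Psi>" "\<forall>\<psi>\<in>\<Psi>. palyutin L \<psi>" "(\<Union>\<psi>\<in>\<Psi>. fv_fm \<psi>) - {n} \<subseteq> {..<n}"
    using fin Q by (fastforce simp: \<Psi>_def less_Suc_eq)+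
  have eps0: "eps0 > 0" and eps0_le: "\<And>Q. Q \<in> \<Q> \<Longrightarrow> eps0 \<le> eps Q"
    using fin Q by (auto simp: eps0_def)
  from palyutin_back_and_forth[OF M.L M.M N.M \<Psi>(1,2) eps0, of n]
  obtain \<Psi>' \<delta> where \<Psi>': "finite \<Psi>'" "\<forall>\<psi>\<in>\<Psi>'. palyutin L \<psi> \<and> fv_fm \<psi> \<subseteq> (\<Union>\<psi>\<in>\<Psi>. fv_fm \<psi>) - {n}" "\<delta> > 0"
    and bf: "\<forall>e e'. seq_env M e \<longrightarrow> seq_env N e' \<longrightarrow> lim_agree M N \<Psi>' \<delta> e e' \<longrightarrow>
      extendable M N n \<Psi> eps0 e e'"
    by (elim exE conjE) (rule that; assumption)
  show ?thesis
  proof (intro exI[of _ "(\<lambda>\<psi>. test \<psi> \<delta>) ` \<Psi>'"] conjI ballI impI)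
    show "finite ((\<lambda>\<psi>. test \<psi> \<delta>) ` \<Psi>')" using \<Psi>'(1) by simp
    show "(\<lambda>\<psi>. test \<psi> \<delta>) ` \<Psi>' \<subseteq> tests_of_arity n"
    proof
      fix Q' assume "Q' \<in> (\<lambda>\<psi>. test \<psi> \<delta>) ` \<Psi>'"
      then obtain \<psi> where \<psi>: "\<psi> \<in> \<Psi>'" "Q' = test \<psi> \<delta>" by blast
      have "palyutin L \<psi>" "fv_fm \<psi> \<subseteq> {..<n}" using \<Psi>'(2) \<psi>(1) \<Psi>(3) by blast+
      then show "Q' \<in> tests_of_arity n" using \<psi>(2) \<Psi>'(3) unfolding tests_of_arity_def by blast
    qed
    fix ps D assume ps: "ps \<in> lists points" "length ps = n" and holds: "\<forall>Q\<in>(\<lambda>\<psi>. test \<psi> \<delta>) ` \<Psi>'. Q ps"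
      and D: "D \<in> demands"
    have "lim_agree M N \<Psi>' \<delta> (env_M ps) (env_N ps)"
      using holds by (simp add: lim_agree_def test_def)
    moreover have "seq_env M (env_M ps)" "seq_env N (env_N ps)"
      using env_in[OF ps(1)] by blast+
    ultimately have ext: "extendable M N n \<Psi> eps0 (env_M ps) (env_N ps)" using bf by blast
    have "\<exists>c d. (c, d) \<in> D \<and> lim_agree M N \<Psi> eps0 ((env_M ps)(n := c)) ((env_N ps)(n := d))"
      using D unfolding demands_def
    proof
      assume "D \<in> (\<lambda>c. {c} \<times> N.Seqs) ` M.Seqs"
      then obtain c where c: "D = {c} \<times> N.Seqs" "\<forall>n. c n \<in> Dom M" by auto
      then obtain d where "\<forall>n. d n \<in> Dom N" "lim_agree M N \<Psi> eps0 ((env_M ps)(n := c)) ((env_N ps)(n := d))"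
        using ext unfolding extendable_def by blast
      then show ?thesis using c(1) by (intro exI[of _ c] exI[of _ d]) auto
    next
      assume "D \<in> (\<lambda>d. M.Seqs \<times> {d}) ` N.Seqs"
      then obtain d where d: "D = M.Seqs \<times> {d}" "\<forall>n. d n \<in> Dom N" by auto
      then obtain c where "\<forall>n. c n \<in> Dom M" "lim_agree M N \<Psi> eps0 ((env_M ps)(n := c)) ((env_N ps)(n := d))"
        using ext unfolding extendable_def by blast
      then show ?thesis using d(1) by (intro exI[of _ c] exI[of _ d]) auto
    qed
    then obtain c d where cd: "(c, d) \<in> D" "lim_agree M N \<Psi> eps0 (env_M (ps @ [(c, d)])) (env_N (ps @ [(c, d)]))"
      unfolding env_snoc ps(2) by blast
    have "Q (ps @ [(c, d)])" if "Q \<in> \<Q>" for Q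
    proof -
      have "test (\<phi> Q) (eps Q) (ps @ [(c, d)])"
        using cd(2) that eps0_le[OF that] by (fastforce simp: lim_agree_def test_def \<Psi>_def)
      then show ?thesis using Q[OF that] by simp
    qed
    with cd(1) show "\<exists>x\<in>D. \<forall>Q\<in>\<Q>. Q (ps @ [x])" by blast
  qed
qed

lemma demand_props: "D \<in> demands \<Longrightarrow> D \<subseteq> points" "D \<in> demands \<Longrightarrow> D \<noteq> {}"
proof -
  have "default_M \<in> M.Seqs" "default_N \<in> N.Seqs" using default_in by simp_all
  then show "D \<in> demands \<Longrightarrow> D \<subseteq> points" "D \<in> demands \<Longrightarrow> D \<noteq> {}"
    unfolding demands_def points_def by blast+
qed

text \<open>With \<open>'t\<close> taken as \<open>'k set\<close> there is room for pairs of
  sequences, the indices form \<open>'k set set\<close>, and \<open>'k set set set\<close> is large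
  enough to name all families of sequences from either structure. Each such family occurs as a
  demand, which makes the matching total on both sides.\<close>

theorem palyutin_equiv_imp_isomorphic:
  assumes eq: "palyutin_equiv L M N" and inf: "infinite (UNIV :: 'k set)"
    and le: "(UNIV :: 'a set) \<lesssim> (UNIV :: 'k set)" "(UNIV :: 'b set) \<lesssim> (UNIV :: 'k set)"
  shows "\<exists>F :: 'k set set filter. F \<noteq> bot \<and> isomorphic L (reduced_power M F) (reduced_power N F)"
proof -
  have inf1: "infinite (UNIV :: 'k set set)" and inf2: "infinite (UNIV :: 'k set set set)"
    using inf by (simp_all add: Finite_Set.finite_set)
  have nat_le: "(UNIV :: nat set) \<lesssim> (UNIV :: 'k set)" using inf by (simp add: infinite_le_lepoll)
  have seq_le: "(UNIV :: (nat \<Rightarrow> 'a) set) \<lesssim> (UNIV :: 'k set set)" "(UNIV :: (nat \<Rightarrow> 'b) set) \<lesssim> (UNIV :: 'k set set)"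
    by (intro lepoll_functions inf nat_le le)+
  have pair_le: "(UNIV :: ((nat \<Rightarrow> 'a) \<times> (nat \<Rightarrow> 'b)) set) \<lesssim> (UNIV :: 'k set set)"
    using lepoll_Times[OF inf1 seq_le] by simp
  obtain f :: "'k set set set \<Rightarrow> 'k set set \<Rightarrow> 'k set" where
    f: "\<forall>J p. J \<lesssim> (UNIV :: 'k set set) \<longrightarrow> (\<exists>i. \<forall>j\<in>J. f j i = p j)"
    using independent_functions_exist[OF inf1] by blast
  interpret E: extension_system f points tests_of_arity demands
  proof unfold_locales
    show "infinite (UNIV :: 'k set set)" by (rule inf1)
    show "\<exists>i. \<forall>j\<in>A. f j i = q j" if "A \<lesssim> (UNIV :: 'k set set)" for A q using f that by blast
    show "(UNIV :: ((nat \<Rightarrow> 'a) \<times> (nat \<Rightarrow> 'b)) set) \<lesssim> (UNIV :: 'k set set)" by (rule pair_le)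
    show "Q []" if "Q \<in> tests_of_arity 0" for Q using that by (rule tests_base[OF eq])
    show "\<exists>Q'\<in>tests_of_arity m. \<forall>ps. length ps = m \<longrightarrow> Q' ps = Q (map (\<lambda>k. ps ! \<rho> k) [0..<n])"
      if "Q \<in> tests_of_arity n" "\<And>k. k < n \<Longrightarrow> \<rho> k < m" for Q n m \<rho>
      using that by (rule tests_rename)
    show "\<exists>\<Q>'. finite \<Q>' \<and> \<Q>' \<subseteq> tests_of_arity n \<and> (\<forall>ps\<in>lists points. length ps = n \<longrightarrow>
        (\<forall>Q\<in>\<Q>'. Q ps) \<longrightarrow> (\<forall>d\<in>demands. \<exists>x\<in>d. \<forall>Q\<in>\<Q>. Q (ps @ [x])))"
      if "finite \<Q>" "\<Q> \<subseteq> tests_of_arity (Suc n)" for \<Q> n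
      using that by (rule tests_extend)
    show "D \<subseteq> points" "D \<noteq> {}" if "D \<in> demands" for D using that by (rule demand_props)+
  qed
  have up: "(UNIV :: 'k set set) \<lesssim> (UNIV :: 'k set set set)" using lepoll_Pow_self[of "UNIV :: 'k set set"] by simp
  have fun_le: "(UNIV :: ('k set set \<Rightarrow> nat \<Rightarrow> 'a) set) \<lesssim> (UNIV :: 'k set set set set)"
    "(UNIV :: ('k set set \<Rightarrow> nat \<Rightarrow> 'b) set) \<lesssim> (UNIV :: 'k set set set set)"
    by (rule lepoll_functions[OF inf2 lepoll_refl lepoll_trans[OF seq_le(1) up]],
        rule lepoll_functions[OF inf2 lepoll_refl lepoll_trans[OF seq_le(2) up]])
  have inf3: "infinite (UNIV :: 'k set set set set)" using inf2 by (simp add: Finite_Set.finite_set)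
  have "range (Inl :: _ \<Rightarrow> ('k set set \<Rightarrow> nat \<Rightarrow> 'a) + ('k set set \<Rightarrow> nat \<Rightarrow> 'b)) \<lesssim> (UNIV :: 'k set set set set)"
    "range (Inr :: _ \<Rightarrow> ('k set set \<Rightarrow> nat \<Rightarrow> 'a) + ('k set set \<Rightarrow> nat \<Rightarrow> 'b)) \<lesssim> (UNIV :: 'k set set set set)"
    using image_lepoll fun_le lepoll_trans by blast+
  from lepoll_Un[OF inf3 this]
  obtain s :: "'k set set set \<Rightarrow> ('k set set \<Rightarrow> nat \<Rightarrow> 'a) + ('k set set \<Rightarrow> nat \<Rightarrow> 'b)" where s: "surj s"
    unfolding lepoll_iff UNIV_sum[symmetric] by (metis top.extremum_uniqueI)
  \<comment> \<open>Families whose values are sequences in the structure are demanded as they stand;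
    other values are replaced by defaults, so that every name yields demands.\<close>
  define D where "D z = (case s z of
      Inl \<alpha> \<Rightarrow> (\<lambda>i. if \<alpha> i \<in> M.Seqs then {\<alpha> i} \<times> N.Seqs else {default_M} \<times> N.Seqs)
    | Inr \<beta> \<Rightarrow> (\<lambda>i. if \<beta> i \<in> N.Seqs then M.Seqs \<times> {\<beta> i} else M.Seqs \<times> {default_N}))" for z
  have "D z i \<in> demands" for z i
    using default_in by (auto simp: D_def demands_def split: sum.split)
  then obtain F0 p where F0: "F0 \<noteq> bot" and p: "\<And>z i. p z i \<in> D z i"
    and tests: "\<And>Q zs. Q \<in> tests_of_arity (length zs) \<Longrightarrow> eventually (\<lambda>i. Q (map (\<lambda>z. p z i) zs)) F0"
    using E.generic_points_exist[of D] by blast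
  have pX: "p z i \<in> points" for z i using p demand_props(1) \<open>\<And>z i. D z i \<in> demands\<close> by blast
  \<comment> \<open>The infinite index type absorbs the factor \<open>nat\<close>, so the product
    filter can be moved onto the index type itself.\<close>
  have "(UNIV :: ('k set set \<times> nat) set) \<approx> (UNIV :: 'k set set set)"
  proof (rule lepoll_antisym)
    have "(UNIV :: nat set) \<lesssim> (UNIV :: 'k set set set)" using inf2 by (simp add: infinite_le_lepoll)
    from lepoll_Times[OF inf2 lepoll_refl this]
    show "(UNIV :: ('k set set \<times> nat) set) \<lesssim> (UNIV :: 'k set set set)" by simp
    show "(UNIV :: 'k set set set) \<lesssim> (UNIV :: ('k set set \<times> nat) set)"
      unfolding lepoll_def by (rule exI[of _ "\<lambda>i. (i, 0)"]) (simp add: inj_on_def)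
  qed
  then obtain h :: "'k set set \<times> nat \<Rightarrow> 'k set set" where h: "bij h" unfolding eqpoll_def by blast
  define G where "G = iterated_filter F0 (cofinite :: nat filter)"
  define F where "F = filtermap h G"
  have G: "G \<noteq> bot" unfolding G_def by (rule iterated_filter_not_bot[OF F0 M.F])
  then have F: "F \<noteq> bot" by (simp add: F_def filtermap_bot_iff)
  \<comment> \<open>The sequence at each index is spread over its copy of \<open>nat\<close>, which
    turns a family of sequences into a single family of elements.\<close>
  define code where "code z = ((\<lambda>x. fst (p z (fst (inv h x))) (snd (inv h x))), (\<lambda>x. snd (p z (fst (inv h x))) (snd (inv h x))))" for z
  define R where "R = range code"
  have inv_h: "inv h (h x) = x" for x using h by (simp add: bij_def)
  have h_inv: "h (inv h x) = x" for x using h by (simp add: bij_def surj_f_inv_f)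
  have "isomorphic L (reduced_power M F) (reduced_power N F)"
  proof (rule isomorphic_reduced_powersI[OF M.L M.M N.M F])
    show "a i \<in> Dom M \<and> b i \<in> Dom N" if ab: "(a, b) \<in> R" for a b i
    proof -
      obtain z where "(a, b) = code z" using ab by (auto simp: R_def)
      then show ?thesis using pX[of z "fst (inv h i)"] by (auto simp: code_def points_def)
    qed
    show "\<exists>b. (a, b) \<in> R" if a: "\<forall>i. a i \<in> Dom M" for a
    proof -
      \<comment> \<open>Conversely, a family on the index type is cut along \<open>h\<close> into
        its sequences and looked up in the enumeration.\<close>
      obtain z where z: "s z = Inl (\<lambda>i n. a (h (i, n)))" using s by (metis surjD)
      have "fst (p z i) = (\<lambda>n. a (h (i, n)))" for i
        using p[of z i] a by (auto simp: D_def z)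
      then have "fst (code z) = a" by (simp add: code_def h_inv)
      then show ?thesis unfolding R_def by (metis prod.collapse rangeI)
    qed
    show "\<exists>a. (a, b) \<in> R" if b: "\<forall>i. b i \<in> Dom N" for b
    proof -
      obtain z where z: "s z = Inr (\<lambda>i n. b (h (i, n)))" using s by (metis surjD)
      have "snd (p z i) = (\<lambda>n. b (h (i, n)))" for i
        using p[of z i] b by (auto simp: D_def z)
      then have "snd (code z) = b" by (simp add: code_def h_inv)
      then show ?thesis unfolding R_def by (metis prod.collapse rangeI)
    qed
    fix e :: "nat \<Rightarrow> ('k set set \<Rightarrow> 'a) \<times> ('k set set \<Rightarrow> 'b)" and \<phi>
    assume \<phi>: "palyutin L \<phi>" and e: "\<forall>x. e x \<in> R"
    have "\<exists>z. e x = code z" for x using e by (auto simp: R_def)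
    then obtain z where z: "\<And>x. e x = code (z x)" by metis
    \<comment> \<open>\<open>insert 0\<close> provides a maximum for sentences; the finitely many
      points with numbers below \<open>m\<close> are those put into the test.\<close>
    define m where "m = Suc (Max (insert 0 (fv_fm \<phi>)))"
    have m: "fv_fm \<phi> \<subseteq> {..<m}" by (auto simp: m_def less_Suc_eq_le finite_fv_fm)
    have wf: "wf_fm L \<phi>" by (rule palyutin_wf[OF \<phi>])
    let ?eM = "\<lambda>i x n. fst (p (z x) i) n" and ?eN = "\<lambda>i x n. snd (p (z x) i) n"
    have eM: "?eM i x n \<in> Dom M" and eN: "?eN i x n \<in> Dom N" for i x n
      using pX[of "z x" i] by (auto simp: points_def)
    note limM = real_limsup_iterated_power[OF M.L M.M F0 wf, of "\<lambda>x i n. ?eM i x n", OF eM inv_h]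
    note limN = real_limsup_iterated_power[OF M.L N.M F0 wf, of "\<lambda>x i n. ?eN i x n", OF eN inv_h]
    have "real_limsup F0 (\<lambda>i. lim_val M (?eM i) \<phi>) = real_limsup F0 (\<lambda>i. lim_val N (?eN i) \<phi>)"
    proof (rule real_limsup_close[OF F0 limM(1) limN(1)])
      fix eps :: real assume "eps > 0"
      then have "test \<phi> eps \<in> tests_of_arity (length (map z [0..<m]))"
        using \<phi> m by (auto simp: tests_of_arity_def)
      from tests[OF this]
      show "eventually (\<lambda>i. \<bar>lim_val M (?eM i) \<phi> - lim_val N (?eN i) \<phi>\<bar> \<le> eps) F0"
      proof eventually_elim
        case (elim i)
        have "lim_val M (env_M (map (\<lambda>z. p z i) (map z [0..<m]))) \<phi> = lim_val M (?eM i) \<phi>"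
          "lim_val N (env_N (map (\<lambda>z. p z i) (map z [0..<m]))) \<phi> = lim_val N (?eN i) \<phi>"
          using m by (auto intro!: lim_val_cong simp: env_M_def env_N_def)
        with elim show ?case unfolding test_def by simp
      qed
    qed
    then show "real_limsup F (\<lambda>i. fm_val M (\<lambda>x. fst (e x) i) \<phi>) = real_limsup F (\<lambda>i. fm_val N (\<lambda>x. snd (e x) i) \<phi>)"
      using limM(2) limN(2) by (simp add: F_def G_def z code_def)
  qed
  with F show ?thesis by blast
qed

end

theorem theorem3p12:
  fixes L :: "('f, 'p) metric_sig"
    and M :: "('f, 'p, 'a) metric_struct"
    and N :: "('f, 'p, 'b) metric_struct"
  assumes "metric_signature L" and "L_structure L M" and "L_structure L N"
  shows "(palyutin_equiv L M N \<longleftrightarrow>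
            elem_equiv L (reduced_power M (cofinite :: nat filter))
                         (reduced_power N (cofinite :: nat filter)))
    \<and> (palyutin_equiv L M N \<longleftrightarrow>
            (\<exists>F :: ('f, 'p, 'a, 'b) index filter.
               F \<noteq> bot \<and> isomorphic L (reduced_power M F) (reduced_power N F)))
    \<and> ((\<exists>F :: 'i filter. F \<noteq> bot \<and> isomorphic L (reduced_power M F) (reduced_power N F)) \<longrightarrow>
            palyutin_equiv L M N)"
proof -
  interpret structure_pair L M N
    using assms by unfold_locales auto
  \<comment> \<open>The summand \<open>nat\<close> makes this type infinite whatever the other
    summands are.\<close>
  have "infinite (UNIV :: ('f + 'p + 'a + 'b + nat) set)" by simp
  moreover have "(UNIV :: 'a set) \<lesssim> (UNIV :: ('f + 'p + 'a + 'b + nat) set)"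
    unfolding lepoll_def by (intro exI[of _ "\<lambda>a. Inr (Inr (Inl a))"]) (simp add: inj_on_def)
  moreover have "(UNIV :: 'b set) \<lesssim> (UNIV :: ('f + 'p + 'a + 'b + nat) set)"
    unfolding lepoll_def by (intro exI[of _ "\<lambda>b. Inr (Inr (Inr (Inl b)))"]) (simp add: inj_on_def)
  ultimately have iso: "\<exists>F :: ('f, 'p, 'a, 'b) index filter.
      F \<noteq> bot \<and> isomorphic L (reduced_power M F) (reduced_power N F)" if "palyutin_equiv L M N"
    using that by (intro palyutin_equiv_imp_isomorphic)
  show ?thesis
  proof (intro conjI iffI impI)
    show "palyutin_equiv L M N" if "elem_equiv L M.P N.P"
      using that by (rule elem_equiv_reduced_power_imp_palyutin_equiv[OF assms M.F])
  qed (elim palyutin_equiv_imp_elem_equiv iso exE conjE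
      isomorphic_reduced_power_imp_palyutin_equiv[OF assms]; assumption)+
qed

end
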